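(* Let $D>0$, let $b\le 0$, and let $W$ be a standard Brownian motion started at $0$. Put $b^*=b/\sqrt D$ and $\beta(y)=(b-y)/\sqrt D$ for $y\in\mathbb R$. Let $H_b=\inf\{s\in[D,\infty)\,:\, W_v<b \text{ for all } v\in(s-D,s)\}$ and let $h_b$ be the density on $(0,\infty)\times\mathbb R$ characterized by $E[\mathbf 1_{\{H_b\le u\}}\phi(W_u)]=\int_{\mathbb R}\phi(y)h_b(u,y)\,dy$ for all $u>0$ and all bounded measurable $\phi$. Then for all reals $u>0$ and $y$, $$h_b(u,y)=\frac{1}{2D}\sum_{1\le n<u/D}\frac{(-1)^{n-1}}{(2\pi)^{n/2}}\Big(\rho_{b^*,\beta(y)}*\nu^{*(n-1)}\Big)\Big(\tfrac12\big(\tfrac uD-n\big)\Big),$$ where the sum is over all integers $n\ge1$ with $n<u/D$.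
   Context: Convolution of functions on $(0,\infty)$ is $(f*g)(t)=\int_0^t f(s)g(t-s)\,ds$. $\nu(u)=\frac{2}{\sqrt\pi}\frac{\sqrt u}{2u+1}$ for $u\ge0$; $\nu^{*(0)}$ is the Dirac delta at $0$ (so $f*\nu^{*(0)}=f$) and for $n\ge1$, $\nu^{*(n)}$ is the $n$-fold convolution of $\nu$ with itself. For real $\alpha\ge 0$, $\chi_\alpha(u)=\frac{1}{\sqrt{\pi u}}\exp\!\big(-\frac{\alpha^2}{4u}\big)$, $u>0$. For real $c$, $g_c(u)=\frac{1}{\sqrt{\pi u}}\int_0^\infty x\exp\!\big(-\tfrac12x^2-\frac{(c-x)^2}{4u}\big)dx$, $u>0$ (equivalently, $g_c$ is the function on $(0,\infty)$ whose Laplace transform is $G_c(z)=z^{-1/2}\int_0^\infty x\exp(-\frac12x^2-|c-x|\sqrt z)\,dx$ on $\mathrm{Re}\,z>0$, principal branch of $\sqrt z$). For reals $a,c$: $\rho_{a,c}=\sqrt D\,\chi_{|a+c|}*\nu$ if $c\le0$, and $\rho_{a,c}=\sqrt D\,\chi_{|a|}*g_c$ if $c>0$. *)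

theory Defs
  imports "HOL-Probability.Probability"
begin

text \<open>Standard Brownian motion started at 0 on a probability space M (time index [0,inf)).\<close>
definition std_BM :: "'a measure \<Rightarrow> (real \<Rightarrow> 'a \<Rightarrow> real) \<Rightarrow> bool" where
  "std_BM M W \<longleftrightarrow>
     prob_space M \<and>
     (\<forall>t\<ge>0. W t \<in> borel_measurable M) \<and>
     (\<forall>\<omega>\<in>space M. W 0 \<omega> = 0 \<and> continuous_on {0..} (\<lambda>t. W t \<omega>)) \<and>
     (\<forall>s t. 0 \<le> s \<and> s < t \<longrightarrow>
        distributed M lborel (\<lambda>\<omega>. W t \<omega> - W s \<omega>) (normal_density 0 (sqrt (t - s)))) \<and>
     (\<forall>(ts::nat \<Rightarrow> real) n. 0 \<le> ts 0 \<and> (\<forall>i<n. ts i < ts (Suc i)) \<longrightarrow>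
        prob_space.indep_vars M (\<lambda>_. borel) (\<lambda>i \<omega>. W (ts (Suc i)) \<omega> - W (ts i) \<omega>) {..<n})"

text \<open>H_b = inf{s >= D : W_v < b for all v in (s-D,s)}, with inf of the empty set = infinity.\<close>
definition H_time :: "real \<Rightarrow> real \<Rightarrow> (real \<Rightarrow> 'a \<Rightarrow> real) \<Rightarrow> 'a \<Rightarrow> ereal" where
  "H_time D b W \<omega> = Inf (ereal ` {s. D \<le> s \<and> (\<forall>v. s - D < v \<and> v < s \<longrightarrow> W v \<omega> < b)})"

text \<open>Convolution of functions on (0,inf).\<close>
definition conv :: "(real \<Rightarrow> real) \<Rightarrow> (real \<Rightarrow> real) \<Rightarrow> real \<Rightarrow> real" where
  "conv f g t = (LBINT s:{0..t}. f s * g (t - s))"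

definition nu :: "real \<Rightarrow> real" where
  "nu u = 2 / sqrt pi * sqrt u / (2 * u + 1)"

text \<open>conv_nu_pow f n = f * nu^{*(n)}  (nu^{*(0)} is the Dirac delta at 0).\<close>
fun conv_nu_pow :: "(real \<Rightarrow> real) \<Rightarrow> nat \<Rightarrow> real \<Rightarrow> real" where
  "conv_nu_pow f 0 = f"
| "conv_nu_pow f (Suc n) = conv (conv_nu_pow f n) nu"

definition chi :: "real \<Rightarrow> real \<Rightarrow> real" where
  "chi \<alpha> u = 1 / sqrt (pi * u) * exp (- (\<alpha>\<^sup>2) / (4 * u))"

definition g_fun :: "real \<Rightarrow> real \<Rightarrow> real" where
  "g_fun c u = 1 / sqrt (pi * u) *
     (LBINT x:{0..}. x * exp (- (x\<^sup>2) / 2 - (c - x)\<^sup>2 / (4 * u)))"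

definition rho :: "real \<Rightarrow> real \<Rightarrow> real \<Rightarrow> real \<Rightarrow> real" where
  "rho D a c u = (if c \<le> 0 then sqrt D * conv (chi \<bar>a + c\<bar>) nu u
                  else sqrt D * conv (chi \<bar>a\<bar>) (g_fun c) u)"

definition h_formula :: "real \<Rightarrow> real \<Rightarrow> real \<Rightarrow> real \<Rightarrow> real" where
  "h_formula D b u y = 1 / (2 * D) *
     (\<Sum>n\<in>{n::nat. 1 \<le> n \<and> real n < u / D}.
        (-1) ^ (n - 1) / (2 * pi) powr (real n / 2) *
        conv_nu_pow (rho D (b / sqrt D) ((b - y) / sqrt D)) (n - 1) ((u / D - real n) / 2))"

end

theory Submission
  imports Defs "HOL-Real_Asymp.Real_Asymp"
begin

text \<open>
  After rescaling, D = 1. For small a consider the set of times s < u - 1, not later than H, at which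
  the path is below b on (s + a, s + 1) but not on (s, s + 1). Almost surely, for all small
  a it is an interval of length a, ending at the start of the first long excursion, if H is at most u,
  and empty otherwise. Hence the law of W at time u on the event that H is at most u is the limit of the
  mean length of this set divided by a. By the Markov property and the reflection principle this limit is
  a boundary derivative of the killed heat semigroup, which expresses the density at time u
  through the densities at the level b at times before u - 1. The formula of the statement
  satisfies the same renewal equation, so the two agree by induction on the integer part of u.
\<close>

section \<open>Paths below a level\<close>

text \<open>The start of the first long excursion is not a stopping time, so the path cannot be
  restarted there. The window of length \<open>a\<close> avoids this: for fixed \<open>s\<close> the
  event combines a condition on the past of \<open>s\<close> with one on the path between
  \<open>s\<close> and \<open>s + 1\<close>, and the Markov property at the deterministic times
  \<open>s\<close>, \<open>s + a\<close>, \<open>s + 1\<close> suffices. Its probability is a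
  difference of two semigroup expressions that collapses to a single image term at the point
  \<open>b + \<bar>x - b\<bar>\<close>. Integrated over the position \<open>x\<close> at time
  \<open>s\<close>, this is of order \<open>a\<close>: one factor sqrt a comes from the decay of the
  killed semigroup at the level, another from the width of the strip of relevant positions. Hence
  only the density at the level itself survives in the limit. On the side of the formula, both
  branches of \<open>rho\<close> are \<open>conv (chi a) (g_fun c)\<close> when
  \<open>a \<le> 0\<close>, because \<open>nu\<close> is \<open>g_fun 0\<close> and a first passage
  kernel turns \<open>g_fun 0\<close> into \<open>g_fun c\<close> for negative \<open>c\<close>. The
  renewal equation is then a shift of index in a sum of convolutions. The sign of \<open>b\<close>
  matters on the path side too: started at 0, the path almost surely does not stay below
  \<open>b\<close> during (0, 1).\<close>

definition below :: "(real \<Rightarrow> real) \<Rightarrow> real \<Rightarrow> real \<Rightarrow> real \<Rightarrow> bool" where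
  "below w b p q \<longleftrightarrow> (\<forall>v. p < v \<and> v < q \<longrightarrow> w v < b)"

definition stopped :: "(real \<Rightarrow> real) \<Rightarrow> real \<Rightarrow> real \<Rightarrow> bool" where
  "stopped w b u \<longleftrightarrow> (\<exists>g. 0 \<le> g \<and> g \<le> u - 1 \<and> below w b g (g + 1))"

lemma below_mono: "below w b p q \<Longrightarrow> p \<le> p' \<Longrightarrow> q' \<le> q \<Longrightarrow> below w b p' q'"
  by (auto simp: below_def)

text \<open>A point strictly between the limits lies strictly between some pair of approximating
  endpoints. The open interval in \<open>below\<close> is what makes the property closed, and the
  compactness arguments on paths rest on it.\<close>

lemma below_limit:
  assumes "p' \<longlonglongrightarrow> p" "q' \<longlonglongrightarrow> q" "\<And>n::nat. below w b (p' n) (q' n)"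
  shows "below w b p q"
  unfolding below_def
proof safe
  fix v assume v: "p < v" "v < q"
  have "eventually (\<lambda>n. p' n < v \<and> v < q' n) sequentially"
    using order_tendstoD(2)[OF assms(1) v(1)] order_tendstoD(1)[OF assms(2) v(2)]
    by eventually_elim auto
  then obtain n where "p' n < v" "v < q' n" using eventually_happens'[OF sequentially_bot] by blast
  then show "w v < b" using assms(3)[of n] by (auto simp: below_def)
qed

lemma below_extend_left:
  assumes cont: "continuous_on {0..} w" and "0 < g" "g < q" "below w b g q" "w g < b"
  shows "\<exists>g'. 0 \<le> g' \<and> g' < g \<and> below w b g' q"
proof -
  obtain d where d: "d > 0" "\<And>x. x \<ge> 0 \<Longrightarrow> dist x g < d \<Longrightarrow> dist (w x) (w g) < b - w g"
    using cont[unfolded continuous_on_iff, rule_format, of g "b - w g"] assms(2,5) by auto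
  let ?g = "max 0 (g - d)"
  have "below w b ?g q"
    unfolding below_def
  proof safe
    fix v assume v: "max 0 (g - d) < v" "v < q"
    show "w v < b"
    proof (cases "v > g")
      case True then show ?thesis using assms(4) v by (auto simp: below_def)
    next
      case False
      then have "dist (w v) (w g) < b - w g" using v by (intro d) (auto simp: dist_real_def)
      then show ?thesis by (auto simp: dist_real_def)
    qed
  qed
  then show ?thesis using d(1) assms(2) by (intro exI[of _ ?g]) auto
qed

text \<open>Otherwise there are such windows with \<open>a\<close> tending to 0; their starting
  times accumulate at some \<open>l\<close> in the compact interval, and \<open>below_limit\<close>
  makes \<open>l\<close> the start of an excursion of unit length.\<close>

lemma uniform_not_below:
  assumes "\<And>s. 0 \<le> s \<Longrightarrow> s \<le> c \<Longrightarrow> \<not> below w b s (s + 1)"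
  shows "\<exists>a0>0. \<forall>a s. 0 < a \<and> a < a0 \<and> 0 \<le> s \<and> s \<le> c \<longrightarrow> \<not> below w b (s + a) (s + 1)"
proof (rule ccontr)
  assume H: "\<not> ?thesis"
  have "\<exists>a s. 0 < a \<and> a < 1 / real (Suc n) \<and> 0 \<le> s \<and> s \<le> c \<and> below w b (s + a) (s + 1)" for n
  proof -
    have "1 / real (Suc n) > 0" by simp
    then show ?thesis using H by blast
  qed
  then obtain a s where as: "\<And>n. 0 < a n" "\<And>n. a n < 1 / real (Suc n)"
    "\<And>n. 0 \<le> s n" "\<And>n. s n \<le> c" "\<And>n. below w b (s n + a n) (s n + 1)" by metis
  have "\<forall>n. s n \<in> {0..c}" using as by auto
  then obtain l r where l: "l \<in> {0..c}" and r: "strict_mono r" and lim: "(s \<circ> r) \<longlonglongrightarrow> l"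
    using compact_Icc[of 0 c] unfolding compact_def by metis
  have "a \<longlonglongrightarrow> 0"
    by (rule tendsto_sandwich[OF _ _ tendsto_const LIMSEQ_inverse_real_of_nat])
      (use as in \<open>auto simp: inverse_eq_divide intro!: always_eventually less_imp_le\<close>)
  then have "(a \<circ> r) \<longlonglongrightarrow> 0" using r by (rule LIMSEQ_subseq_LIMSEQ)
  then have "(\<lambda>n. (s \<circ> r) n + (a \<circ> r) n) \<longlonglongrightarrow> l + 0" "(\<lambda>n. (s \<circ> r) n + 1) \<longlonglongrightarrow> l + 1"
    using tendsto_add[OF lim] tendsto_add[OF lim tendsto_const] by blast+
  then have "below w b (l + 0) (l + 1)" by (rule below_limit) (use as in auto)
  then show False using assms l by auto
qed

text \<open>The possible starts form a set closed under limits, so its infimum belongs to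
  it.\<close>

lemma stopped_first:
  assumes "stopped w b u"
  shows "\<exists>g. 0 \<le> g \<and> g \<le> u - 1 \<and> below w b g (g + 1) \<and> (\<forall>s. 0 \<le> s \<and> s < g \<longrightarrow> \<not> below w b s (s + 1))"
proof -
  let ?S = "{g. 0 \<le> g \<and> below w b g (g + 1)}"
  have ne: "?S \<noteq> {}" using assms by (auto simp: stopped_def)
  have bdd: "bdd_below ?S" by (auto intro!: bdd_belowI[of _ 0])
  obtain s where s: "\<And>n. s n \<in> ?S" "s \<longlonglongrightarrow> Inf ?S"
  proof -
    have "Inf ?S \<in> closure ?S" using ne bdd by (rule closure_contains_Inf)
    then show ?thesis using that unfolding closure_sequential by blast
  qed
  have "(\<lambda>n. s n + 1) \<longlonglongrightarrow> Inf ?S + 1" using s(2) by (intro tendsto_intros)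
  then have b: "below w b (Inf ?S) (Inf ?S + 1)" using s by (intro below_limit[OF s(2)]) auto
  obtain g where g: "0 \<le> g" "g \<le> u - 1" "below w b g (g + 1)" using assms by (auto simp: stopped_def)
  have "Inf ?S \<le> g" using g bdd by (intro cInf_lower) auto
  moreover have "0 \<le> Inf ?S" using ne by (intro cInf_greatest) auto
  moreover have "\<not> below w b s (s + 1)" if "0 \<le> s" "s < Inf ?S" for s
    proof
    assume "below w b s (s + 1)"
    then have "Inf ?S \<le> s" using that by (intro cInf_lower[OF _ bdd]) auto
    then show False using that by simp
  qed
  ultimately show ?thesis using b g(2) by (intro exI[of _ "Inf ?S"]) auto
qed

text \<open>The test for earlier excursions is made at time \<open>s\<close>, not at
  \<open>s + 1\<close>, so that it belongs to the past of \<open>s\<close> and the Markov property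
  applies. The price is that it does not exclude windows beginning during the first long excursion;
  \<open>no_adjacent_uniform\<close> deals with them.\<close>

definition entrance_set :: "(real \<Rightarrow> real) \<Rightarrow> real \<Rightarrow> real \<Rightarrow> real \<Rightarrow> real set" where
  "entrance_set w b u a = {s. 0 < s \<and> s < u - 1 \<and> \<not> stopped w b s \<and>
     below w b (s + a) (s + 1) \<and> \<not> below w b s (s + 1)}"

lemma entrance_set_not_stopped:
  assumes "\<not> stopped w b u"
  shows "\<exists>a0>0. \<forall>a. 0 < a \<and> a < a0 \<longrightarrow> entrance_set w b u a = {}"
proof -
  have "\<exists>a0>0. \<forall>a s. 0 < a \<and> a < a0 \<and> 0 \<le> s \<and> s \<le> u - 1 \<longrightarrow> \<not> below w b (s + a) (s + 1)"
    using assms by (intro uniform_not_below) (auto simp: stopped_def)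
  then obtain a0 where a0: "a0 > 0" "\<And>a s. 0 < a \<Longrightarrow> a < a0 \<Longrightarrow> 0 \<le> s \<Longrightarrow> s \<le> u - 1 \<Longrightarrow> \<not> below w b (s + a) (s + 1)"
    by blast
  have "entrance_set w b u a = {}" if "0 < a" "a < a0" for a
    using a0(2)[OF that] by (auto simp: entrance_set_def)
  then show ?thesis using a0(1) by blast
qed

text \<open>Meant for \<open>t = g + 1\<close>, one unit of time after the start \<open>g\<close> of
  the first long excursion. Windows beginning just before \<open>t\<close>, with a high point
  between \<open>t\<close> and \<open>s + a\<close>, force in the limit a value at least
  \<open>b\<close> at \<open>t\<close> that is followed at once by another excursion of unit
  length.\<close>

lemma no_adjacent_uniform:
  assumes cont: "continuous_on {0..} w" and "0 \<le> t"
    and "\<not> (w t \<ge> b \<and> below w b t (t + 1))"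
  shows "\<exists>a0>0. \<forall>a s. 0 < a \<and> a < a0 \<and> t - a \<le> s \<and> s < t \<longrightarrow>
     \<not> (below w b (s + a) (s + 1) \<and> (\<exists>v. t \<le> v \<and> v \<le> s + a \<and> w v \<ge> b))"
proof (rule ccontr)
  assume H: "\<not> ?thesis"
  have "\<exists>a s v. 0 < a \<and> a < 1 / real (Suc n) \<and> t - a \<le> s \<and> s < t \<and> below w b (s + a) (s + 1)
     \<and> t \<le> v \<and> v \<le> s + a \<and> w v \<ge> b" (is "?E n") for n
  proof (rule ccontr)
    assume "\<not> ?E n"
    then have "1 / real (Suc n) > 0 \<and> (\<forall>a s. 0 < a \<and> a < 1 / real (Suc n) \<and> t - a \<le> s \<and> s < t \<longrightarrow>
     \<not> (below w b (s + a) (s + 1) \<and> (\<exists>v. t \<le> v \<and> v \<le> s + a \<and> w v \<ge> b)))" by auto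
    then show False using H by (elim notE) (rule exI)
  qed
  then obtain a s v where as: "\<And>n. 0 < a n" "\<And>n. a n < 1 / real (Suc n)"
    "\<And>n. t - a n \<le> s n" "\<And>n. s n < t" "\<And>n. below w b (s n + a n) (s n + 1)"
    "\<And>n. t \<le> v n" "\<And>n. v n \<le> s n + a n" "\<And>n. w (v n) \<ge> b" by metis
  have a: "a \<longlonglongrightarrow> 0"
    by (rule tendsto_sandwich[OF _ _ tendsto_const LIMSEQ_inverse_real_of_nat])
      (use as in \<open>auto simp: inverse_eq_divide intro!: always_eventually less_imp_le\<close>)
  have s: "s \<longlonglongrightarrow> t"
  proof (rule tendsto_sandwich[OF _ _ _ tendsto_const])
    show "(\<lambda>n. t - a n) \<longlonglongrightarrow> t" using tendsto_diff[OF tendsto_const a, of t] by simp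
  qed (use as in \<open>auto intro!: always_eventually less_imp_le\<close>)
  have sa: "(\<lambda>n. s n + a n) \<longlonglongrightarrow> t" using tendsto_add[OF s a] by simp
  have v: "v \<longlonglongrightarrow> t"
    by (rule tendsto_sandwich[OF _ _ tendsto_const sa]) (use as in \<open>auto intro!: always_eventually\<close>)
  have "(\<lambda>n. s n + 1) \<longlonglongrightarrow> t + 1" using s by (intro tendsto_intros)
  then have "below w b t (t + 1)" using as by (intro below_limit[OF sa]) auto
  moreover have "(\<lambda>n. w (v n)) \<longlonglongrightarrow> w t"
    by (rule continuous_on_tendsto_compose[OF cont v]) (use as(6) assms(2) in \<open>auto intro!: always_eventually order.trans[OF assms(2)]\<close>)
  then have "w t \<ge> b" by (rule LIMSEQ_le_const) (use as in auto)
  ultimately show False using assms(3) by auto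
qed

text \<open>Let \<open>g\<close> be the first start. If \<open>s < g - a\<close>, then either
  \<open>g\<close>, where the path is at least \<open>b\<close>, lies inside the window, or
  \<open>s\<close> is so early that \<open>uniform_not_below\<close> applies. If
  \<open>s \<ge> g\<close>, some high point must lie in (s, s + a]; it cannot lie before
  \<open>g + 1\<close>, and beyond that it is the configuration excluded by
  \<open>adj\<close>.\<close>

lemma entrance_set_stopped:
  assumes cont: "continuous_on {0..} w" and "\<not> below w b 0 1"
    and adj: "\<And>g. 0 \<le> g \<Longrightarrow> below w b g (g + 1) \<Longrightarrow> w (g + 1) \<ge> b \<Longrightarrow> below w b (g + 1) (g + 2) \<Longrightarrow> False"
    and "stopped w b u"
  shows "\<exists>a0>0. \<forall>a. 0 < a \<and> a < a0 \<longrightarrow> (\<exists>g. entrance_set w b u a = {g - a..<g})"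
proof -
  obtain g where g: "0 \<le> g" "g \<le> u - 1" "below w b g (g + 1)"
    and min: "\<And>s. 0 \<le> s \<Longrightarrow> s < g \<Longrightarrow> \<not> below w b s (s + 1)"
    using stopped_first[OF assms(4)] by blast
  have g0: "0 < g" using g assms(2) by (cases "g = 0") auto
  \<comment> \<open>Otherwise continuity would prolong the excursion to the left of
    \<open>g\<close>, against minimality. Room on the left is available because \<open>g\<close> is
    positive, which is why excursions starting at time 0 are excluded.\<close>
  have wg: "w g \<ge> b"
  proof (rule ccontr)
    assume "\<not> w g \<ge> b"
    then obtain g' where "0 \<le> g'" "g' < g" "below w b g' (g + 1)"
      using below_extend_left[OF cont g0 _ g(3)] by auto
    then show False using min[of g'] below_mono[of w b g' "g + 1" g' "g' + 1"] by auto
  qed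
  have "\<exists>a0>0. \<forall>a s. 0 < a \<and> a < a0 \<and> 0 \<le> s \<and> s \<le> g - 1 \<longrightarrow> \<not> below w b (s + a) (s + 1)"
    using min by (intro uniform_not_below) auto
  then obtain a1 where a1: "a1 > 0" "\<And>a s. 0 < a \<Longrightarrow> a < a1 \<Longrightarrow> 0 \<le> s \<Longrightarrow> s \<le> g - 1 \<Longrightarrow> \<not> below w b (s + a) (s + 1)"
    by blast
  have na: "\<not> (w (g + 1) \<ge> b \<and> below w b (g + 1) (g + 1 + 1))"
    using adj[OF g(1,3)] by (auto simp: add.assoc)
  have "\<exists>a0>0. \<forall>a s. 0 < a \<and> a < a0 \<and> g + 1 - a \<le> s \<and> s < g + 1 \<longrightarrow>
     \<not> (below w b (s + a) (s + 1) \<and> (\<exists>v. g + 1 \<le> v \<and> v \<le> s + a \<and> w v \<ge> b))"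
    using g(1) by (intro no_adjacent_uniform[OF cont _ na]) auto
  then obtain a2 where a2: "a2 > 0" "\<And>a s v. 0 < a \<Longrightarrow> a < a2 \<Longrightarrow> g + 1 - a \<le> s \<Longrightarrow> s < g + 1 \<Longrightarrow>
     below w b (s + a) (s + 1) \<Longrightarrow> g + 1 \<le> v \<Longrightarrow> v \<le> s + a \<Longrightarrow> w v \<ge> b \<Longrightarrow> False"
    by blast
  have st: "stopped w b s \<longleftrightarrow> g + 1 \<le> s" for s
  proof
    assume "stopped w b s"
    then obtain g' where g': "0 \<le> g'" "g' \<le> s - 1" "below w b g' (g' + 1)" by (auto simp: stopped_def)
    have "g \<le> g'" using min[OF g'(1)] g'(3) by (meson not_le)
    then show "g + 1 \<le> s" using g' by simp
  next
    assume "g + 1 \<le> s" then show "stopped w b s" using g by (auto simp: stopped_def intro!: exI[of _ g])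
  qed
  have "entrance_set w b u a = {g - a..<g}" if a: "0 < a" "a < min (min a1 a2) (min g (1/2))" for a
  proof (intro set_eqI iffI)
    fix s assume "s \<in> {g - a..<g}"
    then have s: "g - a \<le> s" "s < g" by auto
    have "below w b (s + a) (s + 1)" using s by (intro below_mono[OF g(3)]) auto
    moreover have "\<not> below w b s (s + 1)" using min s a by auto
    ultimately show "s \<in> entrance_set w b u a" using s a g by (auto simp: entrance_set_def st)
  next
    fix s assume "s \<in> entrance_set w b u a"
    then have s: "0 < s" "s < u - 1" "s < g + 1" "below w b (s + a) (s + 1)" "\<not> below w b s (s + 1)"
      by (auto simp: entrance_set_def st)
    have "g - a \<le> s"
    proof (rule ccontr)
      assume "\<not> g - a \<le> s"
      then have *: "s + a < g" by simp
      show False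
      proof (cases "s + 1 > g")
        case True then show False using s(4) * wg by (auto simp: below_def)
      next
        case False then show False using a1(2)[of a s] a s by auto
      qed
    qed
    moreover have "s < g"
    proof (rule ccontr)
      assume "\<not> s < g"
      from s(5) obtain v where v: "s < v" "v < s + 1" "w v \<ge> b" by (auto simp: below_def not_less)
      have "v \<le> s + a" using s(4) v unfolding below_def by (smt (verit))
      moreover have "g + 1 \<le> v" using g(3) v \<open>\<not> s < g\<close> unfolding below_def by (smt (verit))
      ultimately show False using a2(2)[of a s v] a s v by auto
    qed
    ultimately show "s \<in> {g - a..<g}" by auto
  qed
  moreover have "min (min a1 a2) (min g (1/2)) > 0" using a1 a2 g0 by auto
  ultimately show ?thesis by blast
qed

section \<open>The size of the entrance set\<close>

lemma measure_small_diameter: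
  fixes S :: "real set"
  assumes "S \<in> sets lborel" "\<And>x y. x \<in> S \<Longrightarrow> y \<in> S \<Longrightarrow> x < y \<Longrightarrow> y \<le> x + a" "0 \<le> a"
  shows "emeasure lborel S \<le> ennreal a"
proof (cases "S = {}")
  case False
  then obtain x0 where x0: "x0 \<in> S" by auto
  have bd: "bdd_below S" by (rule bdd_belowI[of _ "x0 - a"]) (use assms(2)[OF _ x0] assms(3) in \<open>smt (verit)\<close>)
  have "S \<subseteq> {Inf S..Inf S + a}"
  proof safe
    fix x assume x: "x \<in> S"
    have "x - a \<le> Inf S" 
      by (rule cInf_greatest[OF False]) (use assms(2)[OF _ x] assms(3) in \<open>smt (verit)\<close>)
    then show "x \<in> {Inf S..Inf S + a}" using cInf_lower[OF x bd] by auto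
  qed
  then have "emeasure lborel S \<le> emeasure lborel {Inf S..Inf S + a}" by (intro emeasure_mono) auto
  then show ?thesis using assms(3) by simp
qed simp

text \<open>The high point that keeps \<open>y\<close> from being the start of a full excursion lies
  in (y, y + a]. If y > x + a and y < x + 1 - a, it falls into (x + a, x + 1), where membership of
  \<open>x\<close> forbids it.\<close>

lemma entrance_set_gap:
  assumes "x \<in> entrance_set w b u a" "y \<in> entrance_set w b u a" "x < y" "y < x + 1 - a" 
  shows "y \<le> x + a"
proof (rule ccontr)
  assume H: "\<not> y \<le> x + a"
  obtain v where v: "y < v" "v < y + 1" "w v \<ge> b" "v \<le> y + a"
    using assms(2) unfolding entrance_set_def below_def by (smt (verit) mem_Collect_eq)
  have "x + a < v" "v < x + 1" using v assms H by auto
  then show False using v assms(1) unfolding entrance_set_def below_def by (smt (verit) mem_Collect_eq)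
qed

text \<open>Cells of length 1/2 are shorter than 1 - a, so by \<open>entrance_set_gap\<close> the
  part of the set in each cell has diameter at most \<open>a\<close>. The bound is linear in
  \<open>a\<close> and the same for all paths: it dominates the measure divided by \<open>a\<close>
  in the later limit.\<close>

lemma emeasure_entrance_set:
  assumes "0 < a" "a \<le> 1/4" "entrance_set w b u a \<in> sets lborel"
  shows "emeasure lborel (entrance_set w b u a) \<le> ennreal (real (nat \<lceil>2 * u\<rceil>) * a)"
proof -
  let ?S = "entrance_set w b u a" and ?N = "nat \<lceil>2 * u\<rceil>"
  let ?I = "\<lambda>k::nat. ?S \<inter> {real k / 2..<(real k + 1) / 2}"
  have "?S \<subseteq> (\<Union>k<?N. ?I k)"
  proof
    fix s assume s: "s \<in> ?S"
    then have s': "0 < s" "s < u - 1" by (auto simp: entrance_set_def)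
    have "s \<in> ?I (nat \<lfloor>2 * s\<rfloor>)"
      using s s' by simp linarith
    moreover have "nat \<lfloor>2 * s\<rfloor> < ?N" using s' by linarith
    ultimately show "s \<in> (\<Union>k<?N. ?I k)" by blast
  qed
  then have "emeasure lborel ?S \<le> emeasure lborel (\<Union>k<?N. ?I k)"
    using assms(3) by (intro emeasure_mono) auto
  also have "\<dots> \<le> (\<Sum>k<?N. emeasure lborel (?I k))"
    using assms(3) by (intro emeasure_subadditive_finite) auto
  also have "\<dots> \<le> (\<Sum>k<?N. ennreal a)"
  proof (intro sum_mono measure_small_diameter)
    fix k x y assume "x \<in> ?I k" "y \<in> ?I k" "x < y"
    then show "y \<le> x + a" using assms by (intro entrance_set_gap[of x w b u a y]) (auto simp: field_simps)
  qed (use assms in auto)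
  also have "\<dots> = ennreal (real ?N * a)" using assms by (simp add: ennreal_mult ennreal_of_nat_eq_real_of_nat)
  finally show ?thesis .
qed

text \<open>The infimum of the admissible times is attained, again since \<open>below\<close>
  survives limits; so the comparison with \<open>u\<close> amounts to an excursion completed by time
  \<open>u\<close>.\<close>

lemma H_time_le_iff:
  assumes "D > 0"
  shows "H_time D b W \<omega> \<le> ereal u \<longleftrightarrow> (\<exists>s. D \<le> s \<and> s \<le> u \<and> below (\<lambda>t. W t \<omega>) b (s - D) s)"
proof
  let ?S = "{s. D \<le> s \<and> (\<forall>v. s - D < v \<and> v < s \<longrightarrow> W v \<omega> < b)}"
  assume H: "H_time D b W \<omega> \<le> ereal u"
  have ne: "?S \<noteq> {}"
  proof
    assume "?S = {}"
    with H show False unfolding H_time_def by (simp only: image_empty) (simp add: top_ereal_def)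
  qed
  have bdd: "bdd_below ?S" by (auto intro!: bdd_belowI[of _ D])
  have "Inf ?S \<in> closure ?S" using ne bdd by (rule closure_contains_Inf)
  then obtain s where s: "\<And>n. s n \<in> ?S" "s \<longlonglongrightarrow> Inf ?S" unfolding closure_sequential by blast
  have "(\<lambda>n. s n - D) \<longlonglongrightarrow> Inf ?S - D" using s(2) by (intro tendsto_intros)
  then have b: "below (\<lambda>t. W t \<omega>) b (Inf ?S - D) (Inf ?S)" using s by (intro below_limit[OF _ s(2)]) (auto simp: below_def)
  have "D \<le> Inf ?S" using ne by (intro cInf_greatest) auto
  moreover have "ereal (Inf ?S) = Inf (ereal ` ?S)"
    using ereal_Inf'[OF bdd ne] .
  with H have "ereal (Inf ?S) \<le> ereal u" unfolding H_time_def by simp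
  then have "Inf ?S \<le> u" by simp
  ultimately show "\<exists>s. D \<le> s \<and> s \<le> u \<and> below (\<lambda>t. W t \<omega>) b (s - D) s" using b by blast
next
  assume "\<exists>s. D \<le> s \<and> s \<le> u \<and> below (\<lambda>t. W t \<omega>) b (s - D) s"
  then obtain s where s: "D \<le> s" "s \<le> u" "below (\<lambda>t. W t \<omega>) b (s - D) s" by blast
  have "H_time D b W \<omega> \<le> ereal s"
    unfolding H_time_def by (rule INF_lower) (use s in \<open>auto simp: below_def\<close>)
  also have "\<dots> \<le> ereal u" using s by simp
  finally show "H_time D b W \<omega> \<le> ereal u" .
qed

section \<open>The heat semigroup and its killed version\<close>

lemma isCont_integral_dominated:
  fixes f :: "real \<Rightarrow> 'a \<Rightarrow> real"
  assumes [measurable]: "\<And>x. f x \<in> borel_measurable M" and w: "integrable M w" and d: "d > 0"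
    and bd: "\<And>x' y. \<bar>x' - x\<bar> < d \<Longrightarrow> \<bar>f x' y\<bar> \<le> w y" and c: "AE y in M. isCont (\<lambda>x. f x y) x"
  shows "isCont (\<lambda>x. \<integral>y. f x y \<partial>M) x"
  unfolding continuous_at_sequentially comp_def
proof safe
  fix X :: "nat \<Rightarrow> real" assume X: "X \<longlonglongrightarrow> x"
  obtain N where N: "\<And>n. n \<ge> N \<Longrightarrow> \<bar>X n - x\<bar> < d"
    using X[unfolded LIMSEQ_def] d by (auto simp: dist_real_def)
  have "(\<lambda>n. \<integral>y. f (X (n + N)) y \<partial>M) \<longlonglongrightarrow> (\<integral>y. f x y \<partial>M)"
  proof (rule integral_dominated_convergence[OF _ _ w])
    show "AE y in M. (\<lambda>n. f (X (n + N)) y) \<longlonglongrightarrow> f x y"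
      using c by eventually_elim (rule isCont_tendsto_compose[OF _ LIMSEQ_ignore_initial_segment[OF X]])
    show "AE y in M. norm (f (X (n + N)) y) \<le> w y" for n using bd N by auto
  qed measurable
  then show "(\<lambda>n. \<integral>y. f (X n) y \<partial>M) \<longlonglongrightarrow> (\<integral>y. f x y \<partial>M)" by (rule LIMSEQ_offset)
qed

definition gk :: "real \<Rightarrow> real \<Rightarrow> real" where
  "gk t x = normal_density 0 (sqrt t) x"

lemma gk_eq: "t > 0 \<Longrightarrow> gk t x = exp (- x\<^sup>2 / (2 * t)) / sqrt (2 * pi * t)"
  by (simp add: gk_def normal_density_def)

lemma gk_nonneg [simp]: "0 \<le> gk t x"
  by (simp add: gk_def)

lemma gk_minus [simp]: "gk t (- x) = gk t x"
  by (simp add: gk_def normal_density_def)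

lemma gk_measurable [measurable]:
  assumes [measurable]: "f \<in> borel_measurable M" "g \<in> borel_measurable M"
  shows "(\<lambda>x. gk (f x) (g x)) \<in> borel_measurable M"
  unfolding gk_def normal_density_def by measurable

lemma integrable_gk [simp, intro]: "t > 0 \<Longrightarrow> integrable lborel (gk t)"
  unfolding gk_def by simp

lemma integral_gk [simp]: "t > 0 \<Longrightarrow> (\<integral>x. gk t x \<partial>lborel) = 1"
  unfolding gk_def by simp

lemma integrable_gk_shift [simp, intro]: "t > 0 \<Longrightarrow> integrable lborel (\<lambda>y. gk t (y - x))"
  using lborel_integrable_real_affine[OF integrable_gk, of t 1 "-x"] by simp

lemma integral_gk_shift [simp]: "t > 0 \<Longrightarrow> (\<integral>y. gk t (y - x) \<partial>lborel) = 1"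
  using lborel_integral_real_affine[of 1 "gk t" "-x"] by simp

lemma gk_le: "t > 0 \<Longrightarrow> gk t x \<le> 1 / sqrt (2 * pi * t)"
  by (simp add: gk_eq divide_right_mono)

lemma square_diff_ge: "x\<^sup>2 / 2 - h\<^sup>2 \<le> (x - h)\<^sup>2" for x h :: real
  using zero_le_power2[of "x - 2 * h"] by (simp add: power2_eq_square algebra_simps)

text \<open>Follows from \<open>square_diff_ge\<close>, at the price of a doubled variance and a
  constant. The right side is free of \<open>h\<close>, which gives an integrable majorant for a
  moving starting point.\<close>

lemma gk_bound_shift:
  assumes "t > 0" "\<bar>h\<bar> \<le> 1"
  shows "gk t (z - h) \<le> sqrt 2 * exp (1 / (2 * t)) * gk (2 * t) z"
proof -
  have "z\<^sup>2 / 2 - h\<^sup>2 \<le> (z - h)\<^sup>2" by (rule square_diff_ge)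
  moreover have "h\<^sup>2 \<le> 1" using assms(2) by (simp add: abs_square_le_1)
  ultimately have "- (z - h)\<^sup>2 / (2 * t) \<le> 1 / (2 * t) + (- z\<^sup>2 / (2 * (2 * t)))"
    using assms(1) by (simp add: divide_simps)
  then have "exp (- (z - h)\<^sup>2 / (2 * t)) \<le> exp (1 / (2 * t)) * exp (- z\<^sup>2 / (2 * (2 * t)))"
    unfolding exp_add[symmetric] by simp
  then have "gk t (z - h) \<le> exp (1 / (2 * t)) * exp (- z\<^sup>2 / (2 * (2 * t))) / sqrt (2 * pi * t)"
    using assms(1) by (simp add: gk_eq divide_right_mono)
  also have "\<dots> = sqrt 2 * exp (1 / (2 * t)) * gk (2 * t) z"
    using assms(1) by (simp add: gk_eq real_sqrt_mult field_simps)
  finally show ?thesis .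
qed

definition heat :: "real \<Rightarrow> (real \<Rightarrow> real) \<Rightarrow> real \<Rightarrow> real" where
  "heat t f x = (\<integral>y. f y * gk t (y - x) \<partial>lborel)"

lemma integrable_heat:
  assumes [measurable]: "f \<in> borel_measurable borel" and "\<And>x. \<bar>f x\<bar> \<le> B" "t > 0"
  shows "integrable lborel (\<lambda>y. f y * gk t (y - x))"
proof (rule Bochner_Integration.integrable_bound)
  show "integrable lborel (\<lambda>y. B * gk t (y - x))" using assms(3) by simp
  have "0 \<le> B" using assms(2)[of 0] by simp
  then show "AE y in lborel. norm (f y * gk t (y - x)) \<le> norm (B * gk t (y - x))"
    using assms(2) by (auto simp: abs_mult intro!: mult_right_mono)
qed simp

lemma heat_bound:
  assumes [measurable]: "f \<in> borel_measurable borel" and B: "\<And>x. \<bar>f x\<bar> \<le> B" and t: "t > 0"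
  shows "\<bar>heat t f x\<bar> \<le> B"
proof -
  have "\<bar>heat t f x\<bar> \<le> (\<integral>y. \<bar>f y * gk t (y - x)\<bar> \<partial>lborel)"
    unfolding heat_def by (rule integral_abs_bound)
  also have "\<dots> \<le> (\<integral>y. B * gk t (y - x) \<partial>lborel)"
    using t by (intro integral_mono integrable_abs integrable_heat[OF assms]) (auto simp: abs_mult intro!: mult_right_mono B)
  also have "\<dots> = B" using t by simp
  finally show ?thesis .
qed

lemma heat_measurable [measurable]:
  assumes [measurable]: "f \<in> borel_measurable borel"
  shows "heat t f \<in> borel_measurable borel"
  unfolding heat_def by measurable

lemma heat_isCont:
  assumes [measurable]: "f \<in> borel_measurable borel" and B: "\<And>x. \<bar>f x\<bar> \<le> B" and t: "t > 0"
  shows "isCont (heat t f) x"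
  unfolding heat_def
proof (rule isCont_integral_dominated[where d=1 and w="\<lambda>y. B * (sqrt 2 * exp (1 / (2 * t)) * gk (2 * t) (y - x))"])
  show "integrable lborel (\<lambda>y. B * (sqrt 2 * exp (1 / (2 * t)) * gk (2 * t) (y - x)))"
    using t by (intro integrable_mult_right integrable_gk_shift) simp
  show "\<bar>f y * gk t (y - x')\<bar> \<le> B * (sqrt 2 * exp (1 / (2 * t)) * gk (2 * t) (y - x))" if "\<bar>x' - x\<bar> < 1" for x' y
    using gk_bound_shift[of t "x' - x" "y - x"] that t B[of y]
    by (auto simp: abs_mult algebra_simps intro!: mult_mono)
  show "AE y in lborel. isCont (\<lambda>x. f y * gk t (y - x)) x"
    using t by (auto simp: gk_def normal_density_def intro!: AE_I2 continuous_intros)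
qed (use t in auto)

lemma heat_shift: "heat t f (b + \<xi>) = (\<integral>\<eta>. f (b - \<eta>) * gk t (\<eta> + \<xi>) \<partial>lborel)"
proof -
  have "heat t f (b + \<xi>) = (\<integral>\<eta>. f (b - \<eta>) * gk t (- (\<eta> + \<xi>)) \<partial>lborel)"
    unfolding heat_def using lborel_integral_real_affine[of "-1" "\<lambda>y. f y * gk t (y - (b + \<xi>))" b]
    by (simp add: algebra_simps)
  then show ?thesis by (simp only: gk_minus)
qed

text \<open>Brownian scaling around the level: \<open>\<xi>\<close> measures the height of the start
  above \<open>b\<close> and \<open>\<eta>\<close> the depth of the endpoint below \<open>b\<close>,
  both in units of \<open>sqrt a\<close>.\<close>

lemma heat_scaled:
  assumes "a > 0"
  shows "heat a f (b + sqrt a * \<xi>) = (\<integral>\<eta>. f (b - sqrt a * \<eta>) * gk 1 (\<eta> + \<xi>) \<partial>lborel)"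
proof -
  have g: "gk a (sqrt a * z) * sqrt a = gk 1 z" for z
    using assms by (simp add: gk_eq power_mult_distrib real_sqrt_mult)
  have "heat a f (b + sqrt a * \<xi>) = (\<integral>\<eta>. f (b - \<eta>) * gk a (\<eta> + sqrt a * \<xi>) \<partial>lborel)"
    by (rule heat_shift)
  also have "\<dots> = sqrt a * (\<integral>\<eta>. f (b - sqrt a * \<eta>) * gk a (sqrt a * \<eta> + sqrt a * \<xi>) \<partial>lborel)"
    using lborel_integral_real_affine[of "sqrt a" "\<lambda>\<eta>. f (b - \<eta>) * gk a (\<eta> + sqrt a * \<xi>)" 0] assms by simp
  also have "\<dots> = (\<integral>\<eta>. f (b - sqrt a * \<eta>) * (gk a (sqrt a * (\<eta> + \<xi>)) * sqrt a) \<partial>lborel)"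
    by (subst integral_mult_right_zero[symmetric]) (simp add: algebra_simps)
  finally show ?thesis by (simp add: g)
qed

text \<open>The heat semigroup on the half-line below \<open>b\<close> with absorption at
  \<open>b\<close>, by the method of images: the mirror point \<open>2 * b - x\<close> of the start
  enters with a minus sign. The value 0 for starts at or above \<open>b\<close> lets it be composed
  with itself and with \<open>heat\<close> without further indicators.\<close>

definition killed :: "real \<Rightarrow> real \<Rightarrow> (real \<Rightarrow> real) \<Rightarrow> real \<Rightarrow> real" where
  "killed b t f x = (if x < b then heat t (\<lambda>y. f y * indicator {..<b} y) x
      - heat t (\<lambda>y. f y * indicator {..<b} y) (2 * b - x) else 0)"

lemma killed_measurable [measurable]:
  assumes [measurable]: "f \<in> borel_measurable borel"
  shows "killed b t f \<in> borel_measurable borel"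
  unfolding killed_def by measurable

lemma killed_bound:
  assumes [measurable]: "f \<in> borel_measurable borel" and B: "\<And>x. \<bar>f x\<bar> \<le> B" and t: "t > 0"
  shows "\<bar>killed b t f x\<bar> \<le> 2 * B"
proof -
  have "\<bar>heat t (\<lambda>y. f y * indicator {..<b} y) x\<bar> \<le> B" for x
    using B order_trans[OF abs_ge_zero B] by (intro heat_bound t) (auto simp: indicator_def)
  from this[of x] this[of "2 * b - x"] show ?thesis using order_trans[OF abs_ge_zero B] by (auto simp: killed_def)
qed

lemma killed_isCont:
  assumes [measurable]: "f \<in> borel_measurable borel" and B: "\<And>x. \<bar>f x\<bar> \<le> B" and t: "t > 0" and "x < b"
  shows "isCont (killed b t f) x"
proof -
  let ?h = "heat t (\<lambda>y. f y * indicator {..<b} y)"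
  have h: "isCont ?h x" for x
    using B order_trans[OF abs_ge_zero B] by (intro heat_isCont[where B=B] t) (auto simp: indicator_def)
  have "isCont (\<lambda>x. ?h x - ?h (2 * b - x)) x"
    by (intro continuous_intros h isCont_o2[OF _ h])
  moreover have "eventually (\<lambda>x. killed b t f x = ?h x - ?h (2 * b - x)) (nhds x)"
    using eventually_nhds_in_open[of "{..<b}" x] assms(4) by (auto elim!: eventually_mono simp: killed_def)
  ultimately show ?thesis by (simp add: isCont_cong)
qed

lemma killed_repr:
  assumes [measurable]: "f \<in> borel_measurable borel" and B: "\<And>x. \<bar>f x\<bar> \<le> B" and t: "t > 0" and "\<eta> > 0"
  shows "killed b t f (b - \<eta>) = (\<integral>x. indicator {0<..} x * (gk t (x - \<eta>) - gk t (x + \<eta>)) * f (b - x) \<partial>lborel)"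
proof -
  let ?f = "\<lambda>y. f y * indicator {..<b} y"
  have h: "heat t ?f (b + \<xi>) = (\<integral>x. indicator {0<..} x * gk t (x + \<xi>) * f (b - x) \<partial>lborel)" for \<xi>
    unfolding heat_shift by (intro Bochner_Integration.integral_cong) (auto simp: indicator_def)
  have i: "integrable lborel (\<lambda>x. indicator {0<..} x * gk t (x + \<xi>) * f (b - x))" for \<xi>
  proof -
    have "integrable lborel (\<lambda>x. (f (b - x) * indicator {0<..} x) * gk t (x - (- \<xi>)))"
      using B order_trans[OF abs_ge_zero B] by (intro integrable_heat[where B=B] t) (auto simp: indicator_def)
    then show ?thesis by (simp add: mult_ac)
  qed
  have "killed b t f (b - \<eta>) = heat t ?f (b + (- \<eta>)) - heat t ?f (b + \<eta>)"
    using assms(4) by (simp add: killed_def algebra_simps)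
  also have "\<dots> = (\<integral>x. indicator {0<..} x * gk t (x + - \<eta>) * f (b - x) - indicator {0<..} x * gk t (x + \<eta>) * f (b - x) \<partial>lborel)"
    unfolding h by (rule Bochner_Integration.integral_diff[symmetric]) (rule i)+
  finally show ?thesis by (simp add: algebra_simps)
qed

section \<open>Boundary behaviour of the killed semigroup\<close>

lemma abs_integral_le:
  fixes f g :: "'a \<Rightarrow> real"
  assumes "f \<in> borel_measurable M" "integrable M g" "\<And>x. \<bar>f x\<bar> \<le> g x"
  shows "integrable M f" "\<bar>integral\<^sup>L M f\<bar> \<le> integral\<^sup>L M g"
proof -
  show i: "integrable M f"
    by (rule Bochner_Integration.integrable_bound[OF assms(2,1)])
      (auto intro!: AE_I2 order_trans[OF assms(3)])
  have "\<bar>integral\<^sup>L M f\<bar> \<le> (\<integral>x. \<bar>f x\<bar> \<partial>M)" by (rule integral_abs_bound)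
  also have "\<dots> \<le> integral\<^sup>L M g" using i assms by (intro integral_mono) auto
  finally show "\<bar>integral\<^sup>L M f\<bar> \<le> integral\<^sup>L M g" .
qed

lemma has_bochner_integral_xexp:
  assumes "k > 0"
  shows "has_bochner_integral lborel (\<lambda>x::real. indicator {0<..} x * (x * exp (- (k * x\<^sup>2)))) (1 / (2 * k))"
proof -
  have "has_bochner_integral lborel (\<lambda>x::real. indicator {0..} x *\<^sub>R (exp (- x\<^sup>2) * x)) (1 / 2)"
    by (rule gaussian_moment_1)
  then have "has_bochner_integral lborel (\<lambda>x::real. indicator {0..} (0 + sqrt k * x) *\<^sub>R (exp (- (0 + sqrt k * x)\<^sup>2) * (0 + sqrt k * x))) ((1 / 2) /\<^sub>R \<bar>sqrt k\<bar>)"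
    using assms by (subst (asm) lborel_has_bochner_integral_real_affine_iff[of "sqrt k" _ _ 0]) auto
  then have "has_bochner_integral lborel (\<lambda>x::real. (1 / sqrt k) * (indicator {0..} (0 + sqrt k * x) *\<^sub>R (exp (- (0 + sqrt k * x)\<^sup>2) * (0 + sqrt k * x)))) ((1 / sqrt k) * ((1 / 2) /\<^sub>R \<bar>sqrt k\<bar>))"
    by (rule has_bochner_integral_mult_right)
  moreover have "(\<lambda>x::real. (1 / sqrt k) * (indicator {0..} (0 + sqrt k * x) *\<^sub>R (exp (- (0 + sqrt k * x)\<^sup>2) * (0 + sqrt k * x))))
     = (\<lambda>x. indicator {0<..} x * (x * exp (- (k * x\<^sup>2))))"
    using assms by (auto simp: fun_eq_iff indicator_def zero_le_mult_iff power_mult_distrib)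
  moreover have "(1 / sqrt k) * ((1 / 2) /\<^sub>R \<bar>sqrt k\<bar>) = 1 / (2 * k)"
    using assms by (simp add: field_simps)
  ultimately show ?thesis by simp
qed

section \<open>The constant in the boundary limit\<close>

lemma nn_integral_abs_real:
  fixes F :: "real \<Rightarrow> ennreal"
  assumes [measurable]: "F \<in> borel_measurable borel"
  shows "(\<integral>\<^sup>+x. F \<bar>x\<bar> \<partial>lborel) = 2 * (\<integral>\<^sup>+x. F x * indicator {0<..} x \<partial>lborel)"
proof -
  have "(\<integral>\<^sup>+x. F \<bar>x\<bar> \<partial>lborel) = (\<integral>\<^sup>+x. F x * indicator {0<..} x + F (- x) * indicator {..<0} x \<partial>lborel)"
    using AE_lborel_singleton[of 0]
    by (intro nn_integral_cong_AE) (auto simp: indicator_def elim!: eventually_mono)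
  also have "\<dots> = (\<integral>\<^sup>+x. F x * indicator {0<..} x \<partial>lborel) + (\<integral>\<^sup>+x. F (- x) * indicator {..<0} x \<partial>lborel)"
    by (intro nn_integral_add) auto
  also have "(\<integral>\<^sup>+x. F (- x) * indicator {..<0} x \<partial>lborel) = (\<integral>\<^sup>+x. F x * indicator {0<..} x \<partial>lborel)"
    by (subst nn_integral_real_affine[where c="-1" and t=0])
      (auto intro!: nn_integral_cong simp: indicator_def)
  finally show ?thesis by (simp add: mult_2)
qed

lemma ennreal_double_eqD: "2 * (J::ennreal) = ennreal r \<Longrightarrow> 0 \<le> r \<Longrightarrow> J = ennreal (r / 2)"
  using ennreal_mult_divide_eq[of 2 J] divide_ennreal[of r 2] by (simp add: mult.commute)

text \<open>The integrand is a triangle of height \<open>z\<close> over a base of length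
  \<open>2 * z\<close>; outside the base \<open>ennreal\<close> truncates negative values to
  0.\<close>

lemma nn_integral_tent:
  "(\<integral>\<^sup>+\<xi>. ennreal (z - \<bar>\<xi>\<bar>) \<partial>lborel) = ennreal (z\<^sup>2) * indicator {0<..} z"
proof (cases "z > 0")
  case True
  have "(\<integral>\<^sup>+\<xi>. ennreal (z - \<xi>) * indicator {0..z} \<xi> \<partial>lborel) = ennreal ((z * z - z\<^sup>2 / 2) - (z * 0 - 0\<^sup>2 / 2))"
    using True by (intro nn_integral_FTC_Icc) (auto intro!: derivative_eq_intros)
  moreover have "(\<integral>\<^sup>+\<xi>. ennreal (z - \<xi>) * indicator {0<..} \<xi> \<partial>lborel) = (\<integral>\<^sup>+\<xi>. ennreal (z - \<xi>) * indicator {0..z} \<xi> \<partial>lborel)"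
    using AE_lborel_singleton[of 0]
    by (intro nn_integral_cong_AE) (auto simp: indicator_def ennreal_neg elim!: eventually_mono)
  moreover have "2 * ennreal (z * z / 2) = ennreal (z * z)"
    using ennreal_mult'[of 2 "z * z / 2"] by simp
  ultimately show ?thesis using True
    by (subst nn_integral_abs_real[where F="\<lambda>\<xi>. ennreal (z - \<xi>)"]) (auto simp: power2_eq_square)
qed (auto simp: ennreal_neg)

lemma nn_integral_gk_half:
  "(\<integral>\<^sup>+z. ennreal (gk 1 z * z\<^sup>2) * indicator {0<..} z \<partial>lborel) = ennreal (1 / 2)"
proof -
  have "has_bochner_integral lborel (\<lambda>x. normal_density 0 1 x * (x - 0) ^ (2 * 1)) (fact (2 * 1) / ((2 / 1\<^sup>2) ^ 1 * fact 1))"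
    by (rule normal_moment_even) simp
  then have "has_bochner_integral lborel (\<lambda>x. gk 1 x * x\<^sup>2) 1"
    by (simp add: gk_def)
  then have "(\<integral>\<^sup>+z. ennreal (gk 1 z * z\<^sup>2) \<partial>lborel) = ennreal 1"
    by (subst nn_integral_eq_integral) (auto simp: has_bochner_integral_iff)
  moreover have "(\<integral>\<^sup>+z. ennreal (gk 1 \<bar>z\<bar> * \<bar>z\<bar>\<^sup>2) \<partial>lborel) = (\<integral>\<^sup>+z. ennreal (gk 1 z * z\<^sup>2) \<partial>lborel)"
    by (intro nn_integral_cong) (auto simp: gk_def normal_density_def)
  ultimately show ?thesis
    by (intro ennreal_double_eqD) (simp_all add: nn_integral_abs_real[where F="\<lambda>z. ennreal (gk 1 z * z\<^sup>2)", symmetric])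
qed

text \<open>Put z = \<eta> + \<bar>\<xi>\<bar>. Exchanging the integrals leaves for each positive z
  the area \<open>z\<^sup>2\<close> of a triangle, so the value is half the second moment of a
  standard Gaussian.\<close>

lemma boundary_constant_nn:
  "(\<integral>\<^sup>+\<xi>. (\<integral>\<^sup>+\<eta>. ennreal (indicator {0<..} \<eta> * \<eta> * gk 1 (\<eta> + \<bar>\<xi>\<bar>)) \<partial>lborel) \<partial>lborel) = ennreal (1 / 2)"
proof -
  have "(\<integral>\<^sup>+\<eta>. ennreal (indicator {0<..} \<eta> * \<eta> * gk 1 (\<eta> + \<bar>\<xi>\<bar>)) \<partial>lborel) =
     (\<integral>\<^sup>+z. ennreal (gk 1 z) * ennreal (z - \<bar>\<xi>\<bar>) \<partial>lborel)" for \<xi>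
    by (subst nn_integral_real_affine[where c=1 and t="- \<bar>\<xi>\<bar>"])
      (auto intro!: nn_integral_cong simp: indicator_def ennreal_neg ennreal_mult[symmetric] mult.commute)
  then have "(\<integral>\<^sup>+\<xi>. (\<integral>\<^sup>+\<eta>. ennreal (indicator {0<..} \<eta> * \<eta> * gk 1 (\<eta> + \<bar>\<xi>\<bar>)) \<partial>lborel) \<partial>lborel)
     = (\<integral>\<^sup>+\<xi>. (\<integral>\<^sup>+z. ennreal (gk 1 z) * ennreal (z - \<bar>\<xi>\<bar>) \<partial>lborel) \<partial>lborel)" by simp
  also have "\<dots> = (\<integral>\<^sup>+z. (\<integral>\<^sup>+\<xi>. ennreal (gk 1 z) * ennreal (z - \<bar>\<xi>\<bar>) \<partial>lborel) \<partial>lborel)"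
    by (rule lborel_pair.Fubini') measurable
  also have "\<dots> = (\<integral>\<^sup>+z. ennreal (gk 1 z * z\<^sup>2) * indicator {0<..} z \<partial>lborel)"
    by (simp add: nn_integral_cmult nn_integral_tent ennreal_mult mult.assoc)
  finally show ?thesis by (simp add: nn_integral_gk_half)
qed

text \<open>The cross term of the square is nonnegative, so the bound splits into a product; it then
  serves as majorant for the inner integral over \<eta> and for the outer one over \<xi>.\<close>

lemma gk_add_le:
  assumes "0 \<le> \<eta>" shows "gk 1 (\<eta> + \<bar>\<xi>\<bar>) \<le> exp (- \<eta>\<^sup>2 / 2) * exp (- \<xi>\<^sup>2 / 2)"
proof -
  have "\<eta>\<^sup>2 + \<xi>\<^sup>2 \<le> (\<eta> + \<bar>\<xi>\<bar>)\<^sup>2" using assms by (simp add: power2_sum)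
  then have "exp (- (\<eta> + \<bar>\<xi>\<bar>)\<^sup>2 / 2) \<le> exp (- \<eta>\<^sup>2 / 2) * exp (- \<xi>\<^sup>2 / 2)"
    unfolding exp_add[symmetric] by simp
  moreover have "gk 1 (\<eta> + \<bar>\<xi>\<bar>) \<le> exp (- (\<eta> + \<bar>\<xi>\<bar>)\<^sup>2 / 2)"
  proof -
    have "1 \<le> sqrt (2 * pi)" using pi_gt3 by (simp add: real_le_rsqrt)
    then show ?thesis using frac_le[of "exp (- (\<eta> + \<bar>\<xi>\<bar>)\<^sup>2 / 2)" _ 1 "sqrt (2 * pi)"] by (simp add: gk_eq)
  qed
  ultimately show ?thesis by simp
qed

lemma integrable_exp_sq: "integrable lborel (\<lambda>x::real. exp (- x\<^sup>2 / 2))"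
proof -
  have "integrable lborel (\<lambda>x. sqrt (2 * pi) * gk 1 x)" by (intro integrable_mult_right integrable_gk) simp
  then show ?thesis by (simp add: gk_eq)
qed

lemma integrable_boundary_inner:
  "integrable lborel (\<lambda>\<eta>. indicator {0<..} \<eta> * \<eta> * gk 1 (\<eta> + \<bar>\<xi>\<bar>))"
proof (rule Bochner_Integration.integrable_bound)
  show "integrable lborel (\<lambda>\<eta>. exp (- \<xi>\<^sup>2 / 2) * (indicator {0<..} \<eta> * (\<eta> * exp (- (1/2 * \<eta>\<^sup>2)))))"
    using has_bochner_integral_xexp[of "1/2"] by (intro integrable_mult_right) (auto simp: has_bochner_integral_iff)
  show "AE \<eta> in lborel. norm (indicator {0<..} \<eta> * \<eta> * gk 1 (\<eta> + \<bar>\<xi>\<bar>))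
     \<le> norm (exp (- \<xi>\<^sup>2 / 2) * (indicator {0<..} \<eta> * (\<eta> * exp (- (1/2 * \<eta>\<^sup>2)))))"
    using gk_add_le[of _ \<xi>] by (intro AE_I2) (auto simp: indicator_def abs_mult mult.commute intro!: mult_left_mono)
qed measurable

lemma boundary_constant:
  "(\<integral>\<xi>. (\<integral>\<eta>. indicator {0<..} \<eta> * \<eta> * gk 1 (\<eta> + \<bar>\<xi>\<bar>) \<partial>lborel) \<partial>lborel) = 1 / 2"
proof -
  have nn: "0 \<le> (\<integral>\<eta>. indicator {0<..} \<eta> * \<eta> * gk 1 (\<eta> + \<bar>\<xi>\<bar>) \<partial>lborel)" for \<xi>
    by (intro integral_nonneg_AE AE_I2) (auto simp: indicator_def)
  have "(\<integral>\<^sup>+\<xi>. ennreal (\<integral>\<eta>. indicator {0<..} \<eta> * \<eta> * gk 1 (\<eta> + \<bar>\<xi>\<bar>) \<partial>lborel) \<partial>lborel) = ennreal (1 / 2)"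
    using boundary_constant_nn
    by (subst (asm) nn_integral_eq_integral[OF integrable_boundary_inner]) (auto simp: indicator_def)
  then show ?thesis
    by (subst integral_eq_nn_integral) (simp_all only: nn enn2real_ennreal, simp_all add: nn)
qed

text \<open>With h = sqrt a * \<eta> and t = 1 - a, the image term is the direct term times
  \<open>exp (- (2 * x * h / t))\<close>, and \<open>1 - exp (- z) \<le> z\<close> produces the
  factor sqrt a. The restriction \<open>a \<le> 1/4\<close> gives \<open>2 / t \<le> 3\<close> and
  \<open>h\<^sup>2 \<le> \<eta>\<^sup>2 / 4\<close>; the resulting growth in \<eta> stays below the
  decay of a standard Gaussian.\<close>

lemma killed_kernel_bound:
  assumes a: "0 < a" "a \<le> 1/4" and "\<eta> > 0" "x > 0"
  shows "0 \<le> gk (1 - a) (x - sqrt a * \<eta>) - gk (1 - a) (x + sqrt a * \<eta>)" (is "0 \<le> ?d")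
    and "gk (1 - a) (x - sqrt a * \<eta>) - gk (1 - a) (x + sqrt a * \<eta>)
      \<le> sqrt a * (3 * \<eta> * exp (\<eta>\<^sup>2 / 8)) * (x * exp (- (1/4 * x\<^sup>2)))"
proof -
  let ?t = "1 - a" and ?h = "sqrt a * \<eta>"
  have t: "3/4 \<le> ?t" "?t < 1" using a by auto
  have h: "?h > 0" using a assms(3) by simp
  have "gk ?t (x + ?h) = gk ?t (x - ?h) * exp (- (2 * x * ?h / ?t))"
    using t by (simp add: gk_eq exp_add[symmetric] divide_simps) (simp add: algebra_simps power2_eq_square)
  then have d: "?d = gk ?t (x - ?h) * (1 - exp (- (2 * x * ?h / ?t)))" by (simp add: algebra_simps)
  have z: "0 \<le> 2 * x * ?h / ?t" using h t assms by simp
  show "0 \<le> ?d" unfolding d using z by (intro mult_nonneg_nonneg) auto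
  have 1: "1 - exp (- (2 * x * ?h / ?t)) \<le> 2 * x * ?h / ?t"
    using exp_ge_add_one_self[of "- (2 * x * ?h / ?t)"] by simp
  have "2 * x * ?h / ?t \<le> 2 * x * ?h / (2/3)"
    using h assms t by (intro divide_left_mono) auto
  then have "2 * x * ?h / ?t \<le> 3 * x * ?h" by (simp add: mult_ac)
  with 1 have 1: "1 - exp (- (2 * x * ?h / ?t)) \<le> 3 * x * ?h" by (rule order_trans)
  have "x\<^sup>2 / 2 - ?h\<^sup>2 \<le> (x - ?h)\<^sup>2" by (rule square_diff_ge)
  moreover have "?h\<^sup>2 \<le> \<eta>\<^sup>2 / 4" using a mult_right_mono[of "4 * a" 1 "\<eta>\<^sup>2"] by (simp add: power_mult_distrib)
  ultimately have "x\<^sup>2 / 2 - \<eta>\<^sup>2 / 4 \<le> (x - ?h)\<^sup>2" by simp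
  moreover have "(x - ?h)\<^sup>2 / 2 \<le> (x - ?h)\<^sup>2 / (2 * ?t)"
    using t by (intro divide_left_mono) auto
  ultimately have "- (x - ?h)\<^sup>2 / (2 * ?t) \<le> \<eta>\<^sup>2 / 8 + (- (1/4 * x\<^sup>2))" by simp
  then have e: "exp (- (x - ?h)\<^sup>2 / (2 * ?t)) \<le> exp (\<eta>\<^sup>2 / 8) * exp (- (1/4 * x\<^sup>2))"
    unfolding exp_add[symmetric] by simp
  have "1 \<le> 2 * pi * ?t" using t pi_gt3 mult_mono[of 6 "2*pi" "3/4" ?t] by simp
  then have "1 \<le> sqrt (2 * pi * ?t)" by simp
  then have "gk ?t (x - ?h) \<le> exp (- (x - ?h)\<^sup>2 / (2 * ?t))"
    using t frac_le[of "exp (- (x - ?h)\<^sup>2 / (2 * ?t))" _ 1 "sqrt (2 * pi * ?t)"] by (simp add: gk_eq)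
  with e have "gk ?t (x - ?h) \<le> exp (\<eta>\<^sup>2 / 8) * exp (- (1/4 * x\<^sup>2))" by simp
  then have "?d \<le> (exp (\<eta>\<^sup>2 / 8) * exp (- (1/4 * x\<^sup>2))) * (3 * x * ?h)"
    unfolding d using 1 z by (intro mult_mono) auto
  then show "?d \<le> sqrt a * (3 * \<eta> * exp (\<eta>\<^sup>2 / 8)) * (x * exp (- (1/4 * x\<^sup>2)))"
    by (simp add: mult_ac)
qed

text \<open>The direct and the image term are shifted by sqrt a * \<eta> in opposite directions, so
  the quotient tends to \<eta> times minus twice the derivative of \<open>gk 1\<close> at
  \<open>x\<close>.\<close>

lemma killed_kernel_limit:
  assumes "\<eta> > 0" "x > 0"
  shows "((\<lambda>a. (gk (1 - a) (x - sqrt a * \<eta>) - gk (1 - a) (x + sqrt a * \<eta>)) / sqrt a)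
     \<longlongrightarrow> \<eta> * (2 * x * gk 1 x)) (at_right 0)"
proof -
  have "((\<lambda>a. (exp (- (x - sqrt a * \<eta>)\<^sup>2 / (2 * (1 - a))) / sqrt (2 * pi * (1 - a)) - exp (- (x + sqrt a * \<eta>)\<^sup>2 / (2 * (1 - a))) / sqrt (2 * pi * (1 - a))) / sqrt a)
     \<longlongrightarrow> \<eta> * (2 * x * (exp (- x\<^sup>2 / 2) / sqrt (2 * pi)))) (at_right 0)"
    using assms by (real_asymp simp: field_simps powr_half_sqrt power2_eq_square)
  then have "((\<lambda>a. (exp (- (x - sqrt a * \<eta>)\<^sup>2 / (2 * (1 - a))) / sqrt (2 * pi * (1 - a)) - exp (- (x + sqrt a * \<eta>)\<^sup>2 / (2 * (1 - a))) / sqrt (2 * pi * (1 - a))) / sqrt a)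
     \<longlongrightarrow> \<eta> * (2 * x * gk 1 x)) (at_right 0)" by (simp add: gk_eq)
  moreover have "eventually (\<lambda>a::real. a < 1) (at_right 0)" by real_asymp
  then have "eventually (\<lambda>a. (exp (- (x - sqrt a * \<eta>)\<^sup>2 / (2 * (1 - a))) / sqrt (2 * pi * (1 - a)) - exp (- (x + sqrt a * \<eta>)\<^sup>2 / (2 * (1 - a))) / sqrt (2 * pi * (1 - a))) / sqrt a
     = (gk (1 - a) (x - sqrt a * \<eta>) - gk (1 - a) (x + sqrt a * \<eta>)) / sqrt a) (at_right 0)"
    by eventually_elim (simp add: gk_eq)
  ultimately show ?thesis by (rule Lim_transform_eventually)
qed

section \<open>Rescaling at the level b\<close>

context
  fixes b B :: real and \<psi> :: "real \<Rightarrow> real"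
  assumes \<psi> [measurable]: "\<psi> \<in> borel_measurable borel" and B: "\<And>x. \<bar>\<psi> x\<bar> \<le> B"
begin

lemma killed_scaled_eq:
  assumes a: "0 < a" "a \<le> 1/4"
  shows "killed b (1 - a) \<psi> (b - sqrt a * \<eta>) / sqrt a = indicator {0<..} \<eta> *
    (\<integral>x. indicator {0<..} x * ((gk (1 - a) (x - sqrt a * \<eta>) - gk (1 - a) (x + sqrt a * \<eta>)) / sqrt a) * \<psi> (b - x) \<partial>lborel)"
proof (cases "\<eta> > 0")
  case True
  have "killed b (1 - a) \<psi> (b - sqrt a * \<eta>) / sqrt a =
    (\<integral>x. (indicator {0<..} x * (gk (1 - a) (x - sqrt a * \<eta>) - gk (1 - a) (x + sqrt a * \<eta>)) * \<psi> (b - x)) / sqrt a \<partial>lborel)"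
    using a True by (subst killed_repr[OF \<psi> B]) auto
  then show ?thesis using True by (simp add: mult_ac)
next
  case False
  then have "b \<le> b - sqrt a * \<eta>" using a by (simp add: mult_nonneg_nonpos)
  then show ?thesis using False by (simp add: killed_def)
qed

lemma killed_scaled_integrand_bound:
  assumes a: "0 < a" "a \<le> 1/4" and "\<eta> > 0"
  shows "\<bar>indicator {0<..} x * ((gk (1 - a) (x - sqrt a * \<eta>) - gk (1 - a) (x + sqrt a * \<eta>)) / sqrt a) * \<psi> (b - x)\<bar>
     \<le> (3 * \<eta> * exp (\<eta>\<^sup>2 / 8) * B) * (indicator {0<..} x * (x * exp (- (1/4 * x\<^sup>2))))"
proof (cases "x > 0")
  case True
  let ?d = "(gk (1 - a) (x - sqrt a * \<eta>) - gk (1 - a) (x + sqrt a * \<eta>)) / sqrt a"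
  have "0 \<le> ?d" "?d \<le> 3 * \<eta> * exp (\<eta>\<^sup>2 / 8) * (x * exp (- (1/4 * x\<^sup>2)))"
    using killed_kernel_bound[OF assms True] a by (auto simp: divide_simps mult_ac)
  then have "\<bar>?d * \<psi> (b - x)\<bar> \<le> 3 * \<eta> * exp (\<eta>\<^sup>2 / 8) * (x * exp (- (1/4 * x\<^sup>2))) * B"
    unfolding abs_mult using B[of "b - x"] assms(3) True by (intro mult_mono) auto
  then show ?thesis using True by (simp add: mult_ac)
qed simp

text \<open>The 6 is 3 times 2, where 3 comes from \<open>killed_kernel_bound\<close> and 2 is the
  integral of \<open>x * exp (- (1/4 * x\<^sup>2))\<close> over the half-line.\<close>

lemma killed_scaled_bound:
  assumes a: "0 < a" "a \<le> 1/4"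
  shows "\<bar>killed b (1 - a) \<psi> (b - sqrt a * \<eta>) / sqrt a\<bar> \<le> 6 * B * (indicator {0<..} \<eta> * (\<eta> * exp (\<eta>\<^sup>2 / 8)))"
proof (cases "\<eta> > 0")
  case True
  let ?g = "\<lambda>x. indicator {0<..} x * ((gk (1 - a) (x - sqrt a * \<eta>) - gk (1 - a) (x + sqrt a * \<eta>)) / sqrt a) * \<psi> (b - x)"
  let ?w = "\<lambda>x. (3 * \<eta> * exp (\<eta>\<^sup>2 / 8) * B) * (indicator {0<..} x * (x * exp (- (1/4 * x\<^sup>2))))"
  have w: "has_bochner_integral lborel ?w ((3 * \<eta> * exp (\<eta>\<^sup>2 / 8) * B) * (1 / (2 * (1/4))))"
    by (intro has_bochner_integral_mult_right has_bochner_integral_xexp) auto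
  have "\<bar>integral\<^sup>L lborel ?g\<bar> \<le> integral\<^sup>L lborel ?w"
    by (rule abs_integral_le(2)[OF _ integrable.intros[OF w] killed_scaled_integrand_bound[OF a True]]) measurable
  then have "\<bar>integral\<^sup>L lborel ?g\<bar> \<le> 6 * B * (\<eta> * exp (\<eta>\<^sup>2 / 8))"
    unfolding has_bochner_integral_integral_eq[OF w] by (simp add: mult_ac)
  then show ?thesis using True unfolding killed_scaled_eq[OF a] by simp
next
  case False then show ?thesis unfolding killed_scaled_eq[OF a] by simp
qed

lemma killed_scaled_limit:
  assumes a: "\<And>n. 0 < a n" "\<And>n. a n \<le> 1/4" "a \<longlonglongrightarrow> 0"
  shows "(\<lambda>n. killed b (1 - a n) \<psi> (b - sqrt (a n) * \<eta>) / sqrt (a n)) \<longlonglongrightarrow>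
    indicator {0<..} \<eta> * \<eta> * (\<integral>x. indicator {0<..} x * (2 * x * gk 1 x) * \<psi> (b - x) \<partial>lborel)"
proof (cases "\<eta> > 0")
  case True
  have fl: "filterlim a (at_right 0) sequentially"
    using a less_imp_neq[OF a(1)] by (auto simp: filterlim_at intro!: always_eventually)
  have "(\<lambda>n. \<integral>x. indicator {0<..} x * ((gk (1 - a n) (x - sqrt (a n) * \<eta>) - gk (1 - a n) (x + sqrt (a n) * \<eta>)) / sqrt (a n)) * \<psi> (b - x) \<partial>lborel)
     \<longlonglongrightarrow> (\<integral>x. indicator {0<..} x * (\<eta> * (2 * x * gk 1 x)) * \<psi> (b - x) \<partial>lborel)"
  proof (rule integral_dominated_convergence[where w="\<lambda>x. (3 * \<eta> * exp (\<eta>\<^sup>2 / 8) * B) * (indicator {0<..} x * (x * exp (- (1/4 * x\<^sup>2))))"])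
    show "integrable lborel (\<lambda>x. (3 * \<eta> * exp (\<eta>\<^sup>2 / 8) * B) * (indicator {0<..} x * (x * exp (- (1/4 * x\<^sup>2)))))"
      by (intro integrable_mult_right integrable.intros[OF has_bochner_integral_xexp]) auto
    show "AE x in lborel. (\<lambda>n. indicator {0<..} x * ((gk (1 - a n) (x - sqrt (a n) * \<eta>) - gk (1 - a n) (x + sqrt (a n) * \<eta>)) / sqrt (a n)) * \<psi> (b - x))
      \<longlonglongrightarrow> indicator {0<..} x * (\<eta> * (2 * x * gk 1 x)) * \<psi> (b - x)"
    proof (rule AE_I2)
      fix x :: real
      show "(\<lambda>n. indicator {0<..} x * ((gk (1 - a n) (x - sqrt (a n) * \<eta>) - gk (1 - a n) (x + sqrt (a n) * \<eta>)) / sqrt (a n)) * \<psi> (b - x))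
      \<longlonglongrightarrow> indicator {0<..} x * (\<eta> * (2 * x * gk 1 x)) * \<psi> (b - x)"
      proof (cases "x > 0")
        case x: True
        show ?thesis
          by (intro tendsto_mult tendsto_const filterlim_compose[OF killed_kernel_limit[OF True x] fl])
      qed simp
    qed
  qed (use killed_scaled_integrand_bound[OF a(1,2) True] in auto)
  then show ?thesis using True unfolding killed_scaled_eq[OF a(1,2)]
    by (simp add: mult_ac flip: integral_mult_right_zero)
next
  case False then show ?thesis unfolding killed_scaled_eq[OF a(1,2)] by simp
qed

definition "boundary_inner a \<xi> = (\<integral>\<eta>. killed b (1 - a) \<psi> (b - sqrt a * \<eta>) / sqrt a * gk 1 (\<eta> + \<bar>\<xi>\<bar>) \<partial>lborel)"

text \<open>Substituting x = b + sqrt a * \<xi> gives one factor sqrt a. The killed semigroup at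
  depths of order sqrt a, divided by sqrt a inside \<open>boundary_inner\<close>, gives another.
  Together they cancel 1 / a, and what remains is bounded and has a limit.\<close>

lemma boundary_rescale:
  assumes a: "0 < a" "a \<le> 1/4"
  shows "1 / a * (\<integral>x. r x * heat a (killed b (1 - a) \<psi>) (b + \<bar>x - b\<bar>) \<partial>lborel) =
    (\<integral>\<xi>. r (b + sqrt a * \<xi>) * boundary_inner a \<xi> \<partial>lborel)"
proof -
  have h: "heat a (killed b (1 - a) \<psi>) (b + \<bar>(b + sqrt a * \<xi>) - b\<bar>) = sqrt a * boundary_inner a \<xi>" for \<xi>
  proof -
    have "heat a (killed b (1 - a) \<psi>) (b + \<bar>(b + sqrt a * \<xi>) - b\<bar>) = heat a (killed b (1 - a) \<psi>) (b + sqrt a * \<bar>\<xi>\<bar>)"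
      using a by (simp add: abs_mult)
    also have "\<dots> = sqrt a * boundary_inner a \<xi>"
      unfolding heat_scaled[OF a(1)] boundary_inner_def integral_mult_right_zero[symmetric]
      using a by (intro Bochner_Integration.integral_cong) auto
    finally show ?thesis .
  qed
  have "(\<integral>x. r x * heat a (killed b (1 - a) \<psi>) (b + \<bar>x - b\<bar>) \<partial>lborel) =
     sqrt a * (\<integral>\<xi>. r (b + sqrt a * \<xi>) * (sqrt a * boundary_inner a \<xi>) \<partial>lborel)"
    using lborel_integral_real_affine[of "sqrt a" "\<lambda>x. r x * heat a (killed b (1 - a) \<psi>) (b + \<bar>x - b\<bar>)" b] a
    by (simp only: h) simp
  also have "(\<integral>\<xi>. r (b + sqrt a * \<xi>) * (sqrt a * boundary_inner a \<xi>) \<partial>lborel) = (\<integral>\<xi>. sqrt a * (r (b + sqrt a * \<xi>) * boundary_inner a \<xi>) \<partial>lborel)"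
    by (intro Bochner_Integration.integral_cong) auto
  also have "\<dots> = sqrt a * (\<integral>\<xi>. r (b + sqrt a * \<xi>) * boundary_inner a \<xi> \<partial>lborel)"
    by (rule integral_mult_right_zero)
  also have "sqrt a * (sqrt a * (\<integral>\<xi>. r (b + sqrt a * \<xi>) * boundary_inner a \<xi> \<partial>lborel)) = a * (\<integral>\<xi>. r (b + sqrt a * \<xi>) * boundary_inner a \<xi> \<partial>lborel)"
    using a by (simp add: mult.assoc[symmetric])
  finally show ?thesis using a by simp
qed

text \<open>The Gaussian factor absorbs the growth \<open>exp (\<eta>\<^sup>2 / 8)\<close> and
  leaves the exponent 3/8 = 1/2 - 1/8.\<close>

lemma boundary_inner_integrand_bound:
  assumes a: "0 < a" "a \<le> 1/4"
  shows "\<bar>killed b (1 - a) \<psi> (b - sqrt a * \<eta>) / sqrt a * gk 1 (\<eta> + \<bar>\<xi>\<bar>)\<bar>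
    \<le> (6 * B * exp (- \<xi>\<^sup>2 / 2)) * (indicator {0<..} \<eta> * (\<eta> * exp (- (3/8 * \<eta>\<^sup>2))))"
proof (cases "\<eta> > 0")
  case True
  have "0 \<le> B" using order_trans[OF abs_ge_zero B] .
  then have "\<bar>killed b (1 - a) \<psi> (b - sqrt a * \<eta>) / sqrt a * gk 1 (\<eta> + \<bar>\<xi>\<bar>)\<bar>
    \<le> (6 * B * (indicator {0<..} \<eta> * (\<eta> * exp (\<eta>\<^sup>2 / 8)))) * (exp (- \<eta>\<^sup>2 / 2) * exp (- \<xi>\<^sup>2 / 2))"
    unfolding abs_mult using killed_scaled_bound[OF a, of \<eta>] gk_add_le[of \<eta> \<xi>] True by (intro mult_mono) auto
  also have "\<dots> = (6 * B * exp (- \<xi>\<^sup>2 / 2)) * (indicator {0<..} \<eta> * (\<eta> * (exp (\<eta>\<^sup>2 / 8) * exp (- \<eta>\<^sup>2 / 2))))"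
    by (simp add: mult_ac)
  also have "exp (\<eta>\<^sup>2 / 8) * exp (- \<eta>\<^sup>2 / 2) = exp (- (3/8 * \<eta>\<^sup>2))"
    unfolding exp_add[symmetric] by simp
  finally show ?thesis .
next
  case False then show ?thesis unfolding killed_scaled_eq[OF a] by simp
qed

lemma boundary_inner_bound:
  assumes a: "0 < a" "a \<le> 1/4"
  shows "\<bar>boundary_inner a \<xi>\<bar> \<le> 8 * B * exp (- \<xi>\<^sup>2 / 2)"
proof -
  let ?w = "\<lambda>\<eta>. (6 * B * exp (- \<xi>\<^sup>2 / 2)) * (indicator {0<..} \<eta> * (\<eta> * exp (- (3/8 * \<eta>\<^sup>2))))"
  \<comment> \<open>Dividing \<open>6 * B\<close> by \<open>2 * (3/8)\<close> yields the
    \<open>8 * B\<close> of the claim.\<close>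
  have w: "has_bochner_integral lborel ?w ((6 * B * exp (- \<xi>\<^sup>2 / 2)) * (1 / (2 * (3/8))))"
    by (intro has_bochner_integral_mult_right has_bochner_integral_xexp) auto
  have "\<bar>boundary_inner a \<xi>\<bar> \<le> integral\<^sup>L lborel ?w"
    unfolding boundary_inner_def
    by (rule abs_integral_le(2)[OF _ integrable.intros[OF w] boundary_inner_integrand_bound[OF a]]) measurable
  then show ?thesis unfolding has_bochner_integral_integral_eq[OF w] by (simp add: mult_ac)
qed

lemma boundary_inner_limit:
  assumes a: "\<And>n. 0 < a n" "\<And>n. a n \<le> 1/4" "a \<longlonglongrightarrow> 0"
  shows "(\<lambda>n. boundary_inner (a n) \<xi>) \<longlonglongrightarrow> (\<integral>\<eta>. indicator {0<..} \<eta> * \<eta> * gk 1 (\<eta> + \<bar>\<xi>\<bar>) \<partial>lborel)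
    * (\<integral>x. indicator {0<..} x * (2 * x * gk 1 x) * \<psi> (b - x) \<partial>lborel)" (is "_ \<longlonglongrightarrow> _ * ?K")
proof -
  have "(\<lambda>n. boundary_inner (a n) \<xi>) \<longlonglongrightarrow> (\<integral>\<eta>. indicator {0<..} \<eta> * \<eta> * ?K * gk 1 (\<eta> + \<bar>\<xi>\<bar>) \<partial>lborel)"
    unfolding boundary_inner_def
  proof (rule integral_dominated_convergence[where w="\<lambda>\<eta>. (6 * B * exp (- \<xi>\<^sup>2 / 2)) * (indicator {0<..} \<eta> * (\<eta> * exp (- (3/8 * \<eta>\<^sup>2))))"])
    show "integrable lborel (\<lambda>\<eta>. (6 * B * exp (- \<xi>\<^sup>2 / 2)) * (indicator {0<..} \<eta> * (\<eta> * exp (- (3/8 * \<eta>\<^sup>2)))))"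
      by (intro integrable_mult_right integrable.intros[OF has_bochner_integral_xexp]) auto
    show "AE \<eta> in lborel. (\<lambda>n. killed b (1 - a n) \<psi> (b - sqrt (a n) * \<eta>) / sqrt (a n) * gk 1 (\<eta> + \<bar>\<xi>\<bar>))
      \<longlonglongrightarrow> indicator {0<..} \<eta> * \<eta> * ?K * gk 1 (\<eta> + \<bar>\<xi>\<bar>)"
      by (intro AE_I2 tendsto_mult killed_scaled_limit[OF a] tendsto_const)
    show "AE \<eta> in lborel. norm (killed b (1 - a n) \<psi> (b - sqrt (a n) * \<eta>) / sqrt (a n) * gk 1 (\<eta> + \<bar>\<xi>\<bar>))
      \<le> (6 * B * exp (- \<xi>\<^sup>2 / 2)) * (indicator {0<..} \<eta> * (\<eta> * exp (- (3/8 * \<eta>\<^sup>2))))" for n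
      unfolding real_norm_def by (intro AE_I2 boundary_inner_integrand_bound a)
  qed measurable
  also have "(\<integral>\<eta>. indicator {0<..} \<eta> * \<eta> * ?K * gk 1 (\<eta> + \<bar>\<xi>\<bar>) \<partial>lborel) = (\<integral>\<eta>. (indicator {0<..} \<eta> * \<eta> * gk 1 (\<eta> + \<bar>\<xi>\<bar>)) * ?K \<partial>lborel)"
    by (simp add: mult_ac)
  finally show ?thesis by (simp only: integral_mult_left_zero)
qed

lemma boundary_inner_measurable [measurable]: "boundary_inner a \<in> borel_measurable borel"
  unfolding boundary_inner_def by measurable

text \<open>Only bounds for \<open>r\<close> and \<open>\<psi>\<close> enter, uniformly in
  \<open>a\<close>. Applied with \<open>R\<close> of the form C / sqrt s, it bounds the entrance
  means by an integrable function of \<open>s\<close>.\<close>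

lemma boundary_bound:
  assumes a: "0 < a" "a \<le> 1/4" and [measurable]: "r \<in> borel_measurable borel" and R: "\<And>x. \<bar>r x\<bar> \<le> R"
  shows "\<bar>1 / a * (\<integral>x. r x * heat a (killed b (1 - a) \<psi>) (b + \<bar>x - b\<bar>) \<partial>lborel)\<bar> \<le> 8 * sqrt (2 * pi) * R * B"
proof -
  let ?w = "\<lambda>\<xi>. R * (8 * B * exp (- \<xi>\<^sup>2 / 2))"
  have w: "integrable lborel ?w" by (intro integrable_mult_right integrable_exp_sq)
  have R0: "0 \<le> R" using order_trans[OF abs_ge_zero R] .
  have bd: "\<bar>r (b + sqrt a * \<xi>) * boundary_inner a \<xi>\<bar> \<le> ?w \<xi>" for \<xi>
    unfolding abs_mult using R0 by (intro mult_mono R boundary_inner_bound a) auto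
  have "\<bar>\<integral>\<xi>. r (b + sqrt a * \<xi>) * boundary_inner a \<xi> \<partial>lborel\<bar> \<le> integral\<^sup>L lborel ?w"
    by (rule abs_integral_le(2)[OF _ w bd]) measurable
  also have "integral\<^sup>L lborel ?w = R * (8 * B * (\<integral>\<xi>. sqrt (2 * pi) * gk 1 \<xi> \<partial>lborel))"
    by (simp add: gk_eq)
  also have "\<dots> = 8 * sqrt (2 * pi) * R * B"
    by (subst integral_mult_right_zero) simp
  finally show ?thesis unfolding boundary_rescale[OF a] .
qed

text \<open>As \<open>a\<close> tends to 0 the relevant positions concentrate at the level, so only
  \<open>r b\<close> remains. The value 1/2 of \<open>boundary_constant\<close> cancels the 2 of the
  kernel derivative. The weight \<open>x * gk 1 x\<close> is, up to the factor 1 / sqrt (2 pi), the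
  Rayleigh density: the law of the depth below \<open>b\<close> at the end of an excursion that has
  just survived for unit time.\<close>

lemma boundary_limit:
  assumes a: "\<And>n. 0 < a n" "\<And>n. a n \<le> 1/4" "a \<longlonglongrightarrow> 0"
    and [measurable]: "r \<in> borel_measurable borel" and R: "\<And>x. \<bar>r x\<bar> \<le> R" and cont: "isCont r b"
  shows "(\<lambda>n. 1 / a n * (\<integral>x. r x * heat (a n) (killed b (1 - a n) \<psi>) (b + \<bar>x - b\<bar>) \<partial>lborel))
    \<longlonglongrightarrow> r b * (\<integral>x. indicator {0<..} x * (x * gk 1 x) * \<psi> (b - x) \<partial>lborel)"
proof -
  let ?K = "\<integral>x. indicator {0<..} x * (2 * x * gk 1 x) * \<psi> (b - x) \<partial>lborel"
  let ?J = "\<lambda>\<xi>. \<integral>\<eta>. indicator {0<..} \<eta> * \<eta> * gk 1 (\<eta> + \<bar>\<xi>\<bar>) \<partial>lborel"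
  let ?w = "\<lambda>\<xi>. R * (8 * B * exp (- \<xi>\<^sup>2 / 2))"
  have R0: "0 \<le> R" using order_trans[OF abs_ge_zero R] .
  have "(\<lambda>n. \<integral>\<xi>. r (b + sqrt (a n) * \<xi>) * boundary_inner (a n) \<xi> \<partial>lborel) \<longlonglongrightarrow> (\<integral>\<xi>. r b * (?J \<xi> * ?K) \<partial>lborel)"
  proof (rule integral_dominated_convergence[where w="?w"])
    show "integrable lborel ?w" by (intro integrable_mult_right integrable_exp_sq)
    show "AE \<xi> in lborel. (\<lambda>n. r (b + sqrt (a n) * \<xi>) * boundary_inner (a n) \<xi>) \<longlonglongrightarrow> r b * (?J \<xi> * ?K)"
    proof (intro AE_I2 tendsto_mult[OF _ boundary_inner_limit[OF a]] isCont_tendsto_compose[OF cont])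
      fix \<xi>
      have "(\<lambda>n. b + sqrt (a n) * \<xi>) \<longlonglongrightarrow> b + sqrt 0 * \<xi>" by (intro tendsto_intros a)
      then show "(\<lambda>n. b + sqrt (a n) * \<xi>) \<longlonglongrightarrow> b" by simp
    qed
    show "AE \<xi> in lborel. norm (r (b + sqrt (a n) * \<xi>) * boundary_inner (a n) \<xi>) \<le> ?w \<xi>" for n
      unfolding real_norm_def abs_mult using R0 by (intro AE_I2 mult_mono R boundary_inner_bound a) auto
  qed measurable
  also have "(\<integral>\<xi>. r b * (?J \<xi> * ?K) \<partial>lborel) = r b * ((1/2) * ?K)"
    by (simp only: integral_mult_right_zero integral_mult_left_zero boundary_constant)
  also have "(1/2) * ?K = (\<integral>x. indicator {0<..} x * (x * gk 1 x) * \<psi> (b - x) \<partial>lborel)"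
    by (simp add: mult_ac flip: integral_mult_right_zero)
  finally show ?thesis unfolding boundary_rescale[OF a(1,2)] .
qed

end

section \<open>Brownian motion and the Markov property\<close>

locale brownian =
  fixes M :: "'a measure" and W :: "real \<Rightarrow> 'a \<Rightarrow> real"
  assumes BM: "std_BM M W"
begin

sublocale prob_space M
  using BM by (simp add: std_BM_def)

lemma W_measurable: "t \<ge> 0 \<Longrightarrow> W t \<in> borel_measurable M"
  using BM by (simp add: std_BM_def)

lemma W_zero: "\<omega> \<in> space M \<Longrightarrow> W 0 \<omega> = 0"
  using BM by (simp add: std_BM_def)

lemma W_continuous: "\<omega> \<in> space M \<Longrightarrow> continuous_on {0..} (\<lambda>t. W t \<omega>)"
  using BM by (simp add: std_BM_def)

lemma W_increment: "0 \<le> s \<Longrightarrow> s < t \<Longrightarrow> distributed M lborel (\<lambda>\<omega>. W t \<omega> - W s \<omega>) (gk (t - s))"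
  using BM by (simp add: std_BM_def gk_def[abs_def])

lemma W_indep: "0 \<le> ts 0 \<Longrightarrow> (\<And>i. i < n \<Longrightarrow> ts i < ts (Suc i)) \<Longrightarrow>
    indep_vars (\<lambda>_. borel) (\<lambda>i \<omega>. W (ts (Suc i)) \<omega> - W (ts i) \<omega>) {..<n}" for ts :: "nat \<Rightarrow> real"
  using BM by (simp add: std_BM_def)

section \<open>The natural filtration and independence of later increments\<close>

definition past :: "real \<Rightarrow> 'a measure" where
  "past t = sigma (space M) (\<Union>v\<in>{0..t}. {W v -` B \<inter> space M |B. B \<in> sets borel})"

lemma space_past [simp]: "space (past t) = space M"
  unfolding past_def by (rule space_measure_of) auto

lemma sets_past: "sets (past t) = sigma_sets (space M) (\<Union>v\<in>{0..t}. {W v -` B \<inter> space M |B. B \<in> sets borel})"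
  unfolding past_def by (rule sets_measure_of) auto

lemma sets_past_subset: "sets (past t) \<subseteq> sets M"
  unfolding sets_past by (rule sets.sigma_sets_subset) (auto intro!: measurable_sets[OF W_measurable])

lemma sets_past_mono: "s \<le> t \<Longrightarrow> sets (past s) \<subseteq> sets (past t)"
  unfolding sets_past by (intro sigma_sets_mono' UN_mono) auto

lemma measurable_past: "f \<in> measurable (past t) N \<Longrightarrow> f \<in> measurable M N"
  using sets_past_subset[of t] by (auto simp: measurable_def)

lemma W_past: "0 \<le> v \<Longrightarrow> v \<le> t \<Longrightarrow> W v \<in> borel_measurable (past t)"
proof (rule measurableI)
  fix A :: "real set" assume v: "0 \<le> v" "v \<le> t" and A: "A \<in> sets borel"
  show "W v -` A \<inter> space (past t) \<in> sets (past t)"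
    unfolding sets_past space_past using v A by (intro sigma_sets.Basic UN_I[of v] CollectI exI[of _ A]) auto
qed simp

text \<open>A generator of \<open>past p\<close> closed under intersection, as the pi-lambda
  argument requires.\<close>

definition cylinders :: "real \<Rightarrow> 'a set set" where
  "cylinders p = {E. \<exists>I B. finite I \<and> I \<subseteq> {0..p} \<and> (\<forall>t. B t \<in> sets (borel :: real measure)) \<and>
     E = {\<omega>\<in>space M. \<forall>t\<in>I. W t \<omega> \<in> B t}}"

lemma cylinder_measurable: "E \<in> cylinders p \<Longrightarrow> E \<in> sets M"
proof -
  assume "E \<in> cylinders p"
  then obtain I B where I: "finite I" "I \<subseteq> {0..p}" "\<And>t. B t \<in> sets (borel :: real measure)"
    "E = {\<omega>\<in>space M. \<forall>t\<in>I. W t \<omega> \<in> B t}" by (auto simp: cylinders_def)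
  have "{\<omega>\<in>space M. W t \<omega> \<in> B t} \<in> sets M" if "t \<in> I" for t
    using measurable_sets[OF W_measurable I(3), of t t] that I(2) by (auto simp: vimage_def Int_def conj_commute)
  then show ?thesis unfolding I(4) by (intro sets.sets_Collect_finite_All I(1))
qed

lemma Int_stable_cylinders: "Int_stable (cylinders p)"
proof (rule Int_stableI)
  fix a b assume "a \<in> cylinders p" "b \<in> cylinders p"
  then obtain I B J C where I: "finite I" "I \<subseteq> {0..p}" "\<And>t. B t \<in> sets (borel :: real measure)"
    "a = {\<omega>\<in>space M. \<forall>t\<in>I. W t \<omega> \<in> B t}"
    and J: "finite J" "J \<subseteq> {0..p}" "\<And>t. C t \<in> sets (borel :: real measure)"
    "b = {\<omega>\<in>space M. \<forall>t\<in>J. W t \<omega> \<in> C t}" unfolding cylinders_def by blast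
  let ?D = "\<lambda>t. (if t \<in> I then B t else UNIV) \<inter> (if t \<in> J then C t else UNIV)"
  have "a \<inter> b = {\<omega>\<in>space M. \<forall>t\<in>I \<union> J. W t \<omega> \<in> ?D t}" unfolding I(4) J(4) by auto
  moreover have "\<forall>t. ?D t \<in> sets borel" using I(3) J(3) by auto
  ultimately show "a \<inter> b \<in> cylinders p" unfolding cylinders_def using I(1,2) J(1,2)
    by (intro CollectI exI[of _ "I \<union> J"] exI[of _ ?D]) auto
qed

lemma sets_past_cylinders: "sets (past p) \<subseteq> sigma_sets (space M) (cylinders p)"
  unfolding sets_past
proof (rule sigma_sets_mono)
  show "(\<Union>v\<in>{0..p}. {W v -` B \<inter> space M |B. B \<in> sets borel}) \<subseteq> sigma_sets (space M) (cylinders p)"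
  proof safe
    fix v and B :: "real set" assume v: "v \<in> {0..p}" and B: "B \<in> sets borel"
    have "W v -` B \<inter> space M \<in> cylinders p" unfolding cylinders_def using v B
      by (intro CollectI exI[of _ "{v}"] exI[of _ "\<lambda>_. B"]) auto
    then show "W v -` B \<inter> space M \<in> sigma_sets (space M) (cylinders p)" by (rule sigma_sets.Basic)
  qed
qed

text \<open>\<open>std_BM\<close> gives independence of increments along increasing grids only. The
  times of the cylinder event, together with 0 and \<open>p\<close>, are sorted into such a grid and
  \<open>q\<close> is appended. Since the path starts at 0, its values at grid times are partial
  sums of increments, so the event depends on all increments but the last.\<close>

lemma indep_cylinder_increment:
  assumes p: "0 \<le> p" "p < q" and a: "a \<in> cylinders p" and B: "B \<in> sets borel"
  shows "prob (a \<inter> ((\<lambda>\<omega>. W q \<omega> - W p \<omega>) -` B \<inter> space M)) = prob a * prob ((\<lambda>\<omega>. W q \<omega> - W p \<omega>) -` B \<inter> space M)"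
proof -
  obtain I C where I: "finite I" "I \<subseteq> {0..p}" "\<And>t. C t \<in> sets (borel :: real measure)"
    "a = {\<omega>\<in>space M. \<forall>t\<in>I. W t \<omega> \<in> C t}" using a by (auto simp: cylinders_def)
  define L where "L = sorted_list_of_set (I \<union> {0, p})"
  have L: "set L = I \<union> {0, p}" "sorted L" "distinct L" unfolding L_def using I(1)
    by (simp_all del: sorted_list_of_set_insert_remove Un_insert_right)
  define n where "n = length L"
  have n: "n > 0" using L(1) by (auto simp: n_def)
  \<comment> \<open>Every index from \<open>n\<close> on gives \<open>q\<close>, so the increment
    with index \<open>n - 1\<close> is exactly the one from \<open>p\<close> to
    \<open>q\<close>.\<close>
  define ts where "ts i = (if i < n then L ! i else q)" for i
  have Lmem: "L ! i \<in> {0..p}" if "i < n" for i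
    using that L(1) I(2) p nth_mem[of i L] by (auto simp: n_def)
  have ts0: "ts 0 = 0"
  proof -
    have "0 \<in> set L" using L(1) by simp
    then obtain i where i: "i < n" "L ! i = 0" unfolding n_def in_set_conv_nth by blast
    have "L ! 0 \<le> 0" using sorted_nth_mono[OF L(2), of 0 i] i by (simp add: n_def)
    then show ?thesis using Lmem[of 0] n by (auto simp: ts_def)
  qed
  have tsl: "ts (n - 1) = p"
  proof -
    have "p \<in> set L" using L(1) by simp
    then obtain i where i: "i < n" "L ! i = p" unfolding n_def in_set_conv_nth by blast
    have "p \<le> L ! (n - 1)" using sorted_nth_mono[OF L(2), of i "n - 1"] i by (simp add: n_def)
    then show ?thesis using Lmem[of "n - 1"] n by (auto simp: ts_def)
  qed
  have inc: "ts i < ts (Suc i)" if "i < n" for i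
  proof (cases "Suc i < n")
    case True
    then show ?thesis using sorted_wrt_nth_less[of "(<)" L i "Suc i"] L(2,3) that
      by (simp add: ts_def n_def strict_sorted_iff)
  next
    case False
    then show ?thesis using Lmem[OF that] that p by (auto simp: ts_def)
  qed
  define X where "X i \<omega> = W (ts (Suc i)) \<omega> - W (ts i) \<omega>" for i \<omega>
  have ind: "indep_vars (\<lambda>_. borel) X {..<n}"
    using W_indep[of ts n] ts0 inc by (simp add: X_def[abs_def])
  let ?P = "PiM {..<n - 1} (\<lambda>_. borel :: real measure)" and ?Q = "PiM {n - 1} (\<lambda>_. borel :: real measure)"
  have iv: "indep_var ?P (\<lambda>\<omega>. restrict (\<lambda>i. X i \<omega>) {..<n - 1}) ?Q (\<lambda>\<omega>. restrict (\<lambda>i. X i \<omega>) {n - 1})"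
    using n by (intro indep_var_restrict[OF ind]) auto
  have sum: "W (ts j) \<omega> = (\<Sum>i<j. X i \<omega>)" if "\<omega> \<in> space M" for j \<omega>
    unfolding X_def using W_zero[OF that] ts0 by (subst sum_lessThan_telescope) simp
  \<comment> \<open>A sum up to a grid index \<open>j < n\<close> uses only increments with index
    below \<open>n - 1\<close>, so \<open>A\<close> lives on the product without the last
    coordinate.\<close>
  define A where "A = {x\<in>space ?P. \<forall>j<n. L ! j \<in> I \<longrightarrow> (\<Sum>i<j. x i) \<in> C (L ! j)}"
  have A: "A \<in> sets ?P"
  proof -
    have "{x\<in>space ?P. \<forall>j\<in>{j. j < n \<and> L ! j \<in> I}. (\<Sum>i<j. x i) \<in> C (L ! j)} \<in> sets ?P"
    proof (intro sets.sets_Collect_finite_All)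
      fix j assume j: "j \<in> {j. j < n \<and> L ! j \<in> I}"
      have "(\<lambda>x. \<Sum>i<j. x i) \<in> borel_measurable ?P"
        using j by (intro borel_measurable_sum measurable_component_singleton) auto
      from measurable_sets[OF this I(3)[of "L ! j"]]
      show "{x\<in>space ?P. (\<Sum>i<j. x i) \<in> C (L ! j)} \<in> sets ?P" by (simp add: vimage_def Int_def conj_commute)
    qed simp
    moreover have "A = {x\<in>space ?P. \<forall>j\<in>{j. j < n \<and> L ! j \<in> I}. (\<Sum>i<j. x i) \<in> C (L ! j)}"
      unfolding A_def by blast
    ultimately show ?thesis by (simp only:)
  qed
  define B' where "B' = {x\<in>space ?Q. x (n - 1) \<in> B}"
  have B': "B' \<in> sets ?Q"
    using measurable_sets[OF measurable_component_singleton[of "n - 1" "{n - 1}" "\<lambda>_. borel"] B]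
    unfolding B'_def by (simp add: vimage_def Int_def conj_commute)
  have e1: "(\<lambda>\<omega>. restrict (\<lambda>i. X i \<omega>) {..<n - 1}) -` A \<inter> space M = a"
  proof -
    have "restrict (\<lambda>i. X i \<omega>) {..<n - 1} \<in> A \<longleftrightarrow> (\<forall>t\<in>I. W t \<omega> \<in> C t)" if "\<omega> \<in> space M" for \<omega>
    proof -
      have "(\<Sum>i<j. restrict (\<lambda>i. X i \<omega>) {..<n - 1} i) = (\<Sum>i<j. X i \<omega>)" if "j < n" for j
        using that by (intro sum.cong) auto
      then have "restrict (\<lambda>i. X i \<omega>) {..<n - 1} \<in> A \<longleftrightarrow> (\<forall>j<n. L ! j \<in> I \<longrightarrow> (\<Sum>i<j. X i \<omega>) \<in> C (L ! j))"
        unfolding A_def by (simp add: space_PiM)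
      also have "\<dots> \<longleftrightarrow> (\<forall>j<n. L ! j \<in> I \<longrightarrow> W (L ! j) \<omega> \<in> C (L ! j))"
        by (simp add: sum[OF that, symmetric] ts_def)
      also have "\<dots> \<longleftrightarrow> (\<forall>t\<in>I. W t \<omega> \<in> C t)"
      proof (intro iffI ballI allI impI)
        fix t assume *: "\<forall>j<n. L ! j \<in> I \<longrightarrow> W (L ! j) \<omega> \<in> C (L ! j)" and t: "t \<in> I"
        then have "t \<in> set L" using L(1) by simp
        then obtain j where "j < n" "L ! j = t" unfolding n_def in_set_conv_nth by blast
        then show "W t \<omega> \<in> C t" using * t by auto
      qed simp
      finally show ?thesis .
    qed
    then show ?thesis unfolding I(4) by auto
  qed
  have e2: "(\<lambda>\<omega>. restrict (\<lambda>i. X i \<omega>) {n - 1}) -` B' \<inter> space M = (\<lambda>\<omega>. W q \<omega> - W p \<omega>) -` B \<inter> space M"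
    using n tsl by (auto simp: B'_def space_PiM X_def) (auto simp: ts_def)
  have "prob ((\<lambda>\<omega>. (restrict (\<lambda>i. X i \<omega>) {..<n - 1}, restrict (\<lambda>i. X i \<omega>) {n - 1})) -` (A \<times> B') \<inter> space M)
     = prob a * prob ((\<lambda>\<omega>. W q \<omega> - W p \<omega>) -` B \<inter> space M)"
    using indep_varD[OF iv A B'] unfolding e1 e2 .
  moreover have "(\<lambda>\<omega>. (restrict (\<lambda>i. X i \<omega>) {..<n - 1}, restrict (\<lambda>i. X i \<omega>) {n - 1})) -` (A \<times> B') \<inter> space M
     = a \<inter> ((\<lambda>\<omega>. W q \<omega> - W p \<omega>) -` B \<inter> space M)"
    unfolding e1[symmetric] e2[symmetric] by auto
  ultimately show ?thesis by simp
qed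

lemma indep_past_increment:
  assumes p: "0 \<le> p" "p < q"
  shows "indep_set (sets (past p)) {(\<lambda>\<omega>. W q \<omega> - W p \<omega>) -` B \<inter> space M | B. B \<in> sets borel}"
proof -
  let ?Y = "\<lambda>\<omega>. W q \<omega> - W p \<omega>"
  have [measurable]: "?Y \<in> borel_measurable M" using p W_measurable[of p] W_measurable[of q] by simp
  let ?G = "{?Y -` B \<inter> space M | B. B \<in> sets borel}"
  have "indep_set (cylinders p) ?G"
    using indep_cylinder_increment[OF p] by (intro indep_setI) (auto simp: cylinder_measurable)
  moreover have "Int_stable ?G"
  proof (rule Int_stableI)
    fix a b assume "a \<in> ?G" "b \<in> ?G"
    then obtain A B where "a = ?Y -` A \<inter> space M" "b = ?Y -` B \<inter> space M" "A \<in> sets borel" "B \<in> sets borel" by auto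
    then show "a \<inter> b \<in> ?G" by (intro CollectI exI[of _ "A \<inter> B"]) auto
  qed
  ultimately have ind: "indep_set (sigma_sets (space M) (cylinders p)) (sigma_sets (space M) ?G)"
    by (intro indep_set_sigma_sets Int_stable_cylinders)
  then show ?thesis using sets_past_cylinders[of p] unfolding indep_sets2_eq by blast
qed

text \<open>The identity, seen as a random variable with values in \<open>past p\<close>, carries
  the whole history. Independence says that its joint law with the increment is a product measure,
  and Fubini then integrates out the increment with the history frozen.\<close>

lemma markov_increment:
  assumes p: "0 \<le> p" "p < q" and G [measurable]: "G \<in> borel_measurable (past p \<Otimes>\<^sub>M borel)"
    and B: "\<And>x. \<bar>G x\<bar> \<le> B"
  shows "(\<integral>\<omega>. G (\<omega>, W q \<omega> - W p \<omega>) \<partial>M) = (\<integral>\<omega>. (\<integral>z. G (\<omega>, z) * gk (q - p) z \<partial>lborel) \<partial>M)"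
proof -
  let ?Y = "\<lambda>\<omega>. W q \<omega> - W p \<omega>"
  have Y [measurable]: "?Y \<in> borel_measurable M" using p W_measurable[of p] W_measurable[of q] by simp
  have id [measurable]: "(\<lambda>\<omega>. \<omega>) \<in> measurable M (past p)"
    by (rule measurable_past) (rule measurable_ident_sets, simp)
  interpret P1: prob_space "distr M (past p) (\<lambda>\<omega>. \<omega>)" by (rule prob_space_distr) measurable
  interpret P2: prob_space "distr M borel ?Y" by (rule prob_space_distr) measurable
  interpret P: pair_prob_space "distr M (past p) (\<lambda>\<omega>. \<omega>)" "distr M borel ?Y" ..
  have eq: "distr M (past p) (\<lambda>\<omega>. \<omega>) \<Otimes>\<^sub>M distr M borel ?Y = distr M (past p \<Otimes>\<^sub>M borel) (\<lambda>\<omega>. (\<omega>, ?Y \<omega>))"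
  proof (rule pair_measure_eqI)
    fix A :: "'a set" and C :: "real set" assume "A \<in> sets (distr M (past p) (\<lambda>\<omega>. \<omega>))" "C \<in> sets (distr M borel ?Y)"
    then have A: "A \<in> sets (past p)" and C: "C \<in> sets borel" by auto
    have "prob (A \<inter> (?Y -` C \<inter> space M)) = prob A * prob (?Y -` C \<inter> space M)"
      using C by (intro indep_setD[OF indep_past_increment[OF p]] A) auto
    moreover have "A \<inter> space M = A" using sets.sets_into_space[OF A] by auto
    moreover have "(\<lambda>\<omega>. (\<omega>, ?Y \<omega>)) -` (A \<times> C) \<inter> space M = A \<inter> (?Y -` C \<inter> space M)" using sets.sets_into_space[OF A] by auto
    ultimately show "emeasure (distr M (past p) (\<lambda>\<omega>. \<omega>)) A * emeasure (distr M borel ?Y) C =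
       emeasure (distr M (past p \<Otimes>\<^sub>M borel) (\<lambda>\<omega>. (\<omega>, ?Y \<omega>))) (A \<times> C)"
      using A C by (subst (1 2 3) emeasure_distr) (auto simp: emeasure_eq_measure ennreal_mult)
  qed (auto simp: P1.sigma_finite_measure_axioms P2.sigma_finite_measure_axioms)
  have dY: "distr M borel ?Y = density lborel (gk (q - p))"
    using W_increment[OF p] unfolding distributed_def by (simp cong: distr_cong)
  have "(\<integral>\<omega>. G (\<omega>, ?Y \<omega>) \<partial>M) = (\<integral>x. G x \<partial>distr M (past p \<Otimes>\<^sub>M borel) (\<lambda>\<omega>. (\<omega>, ?Y \<omega>)))"
    by (subst integral_distr) auto
  also have "\<dots> = (\<integral>x. G x \<partial>(distr M (past p) (\<lambda>\<omega>. \<omega>) \<Otimes>\<^sub>M distr M borel ?Y))" by (simp only: eq)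
  also have "\<dots> = (\<integral>\<omega>. (\<integral>z. G (\<omega>, z) \<partial>distr M borel ?Y) \<partial>distr M (past p) (\<lambda>\<omega>. \<omega>))"
    using B by (intro P.integral_fst'[symmetric] P.integrable_const_bound[where B=B]) auto
  also have "\<dots> = (\<integral>\<omega>. (\<integral>z. G (\<omega>, z) \<partial>distr M borel ?Y) \<partial>M)"
    by (subst integral_distr) (auto intro!: P2.borel_measurable_lebesgue_integral)
  also have "\<dots> = (\<integral>\<omega>. (\<integral>z. G (\<omega>, z) * gk (q - p) z \<partial>lborel) \<partial>M)"
  proof (rule Bochner_Integration.integral_cong[OF refl])
    fix \<omega> assume "\<omega> \<in> space M"
    then have [measurable]: "(\<lambda>z. G (\<omega>, z)) \<in> borel_measurable borel"
      using measurable_Pair2[OF G] by simp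
    show "(\<integral>z. G (\<omega>, z) \<partial>distr M borel ?Y) = (\<integral>z. G (\<omega>, z) * gk (q - p) z \<partial>lborel)"
      unfolding dY by (subst integral_real_density) (auto simp: mult.commute)
  qed
  finally show ?thesis .
qed

section \<open>The Markov property, reflected increments and one-time laws\<close>

lemma markov:
  fixes f :: "real \<Rightarrow> real"
  assumes p: "0 \<le> p" "p < q" and E: "E \<in> sets (past p)" and [measurable]: "f \<in> borel_measurable borel"
    and B: "\<And>x. \<bar>f x\<bar> \<le> B"
  shows "(\<integral>\<omega>. indicator E \<omega> * f (W q \<omega>) \<partial>M) = (\<integral>\<omega>. indicator E \<omega> * heat (q - p) f (W p \<omega>) \<partial>M)"
proof -
  note [measurable] = E W_past[OF p(1) order_refl]
  have B0: "0 \<le> B" using abs_ge_zero[of "f 0"] B[of 0] by linarith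
  let ?G = "\<lambda>(\<omega>, z). indicator E \<omega> * f (W p \<omega> + z)"
  have "(\<integral>\<omega>. ?G (\<omega>, W q \<omega> - W p \<omega>) \<partial>M) = (\<integral>\<omega>. (\<integral>z. ?G (\<omega>, z) * gk (q - p) z \<partial>lborel) \<partial>M)"
    using B B0 by (intro markov_increment[OF p, where B=B]) (auto simp: indicator_def)
  also have "\<dots> = (\<integral>\<omega>. indicator E \<omega> * heat (q - p) f (W p \<omega>) \<partial>M)"
  proof (rule Bochner_Integration.integral_cong[OF refl])
    fix \<omega>
    have "heat (q - p) f (W p \<omega>) = (\<integral>z. f (W p \<omega> + z) * gk (q - p) z \<partial>lborel)"
      unfolding heat_def using lborel_integral_real_affine[of 1 "\<lambda>y. f y * gk (q - p) (y - W p \<omega>)" "W p \<omega>"] by simp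
    then show "(\<integral>z. ?G (\<omega>, z) * gk (q - p) z \<partial>lborel) = indicator E \<omega> * heat (q - p) f (W p \<omega>)"
      by (simp add: mult.assoc)
  qed
  finally show ?thesis by simp
qed

lemma reflect_increment:
  fixes f :: "real \<Rightarrow> real"
  assumes p: "0 \<le> p" "p \<le> q" and E: "E \<in> sets (past p)" and [measurable]: "f \<in> borel_measurable borel"
    and B: "\<And>x. \<bar>f x\<bar> \<le> B"
  shows "(\<integral>\<omega>. indicator E \<omega> * f (W q \<omega>) \<partial>M) = (\<integral>\<omega>. indicator E \<omega> * f (2 * W p \<omega> - W q \<omega>) \<partial>M)"
proof (cases "p = q")
  case False
  then have pq: "p < q" using p by simp
  note [measurable] = E W_past[OF p(1) order_refl]
  have B0: "0 \<le> B" using abs_ge_zero[of "f 0"] B[of 0] by linarith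
  let ?G = "\<lambda>(\<omega>, z). indicator E \<omega> * f (W p \<omega> + z)"
  let ?H = "\<lambda>(\<omega>, z). indicator E \<omega> * f (W p \<omega> - z)"
  have 1: "(\<integral>\<omega>. ?G (\<omega>, W q \<omega> - W p \<omega>) \<partial>M) = (\<integral>\<omega>. (\<integral>z. ?G (\<omega>, z) * gk (q - p) z \<partial>lborel) \<partial>M)"
    using B B0 by (intro markov_increment[OF p(1) pq, where B=B]) (auto simp: indicator_def)
  have 2: "(\<integral>\<omega>. ?H (\<omega>, W q \<omega> - W p \<omega>) \<partial>M) = (\<integral>\<omega>. (\<integral>z. ?H (\<omega>, z) * gk (q - p) z \<partial>lborel) \<partial>M)"
    using B B0 by (intro markov_increment[OF p(1) pq, where B=B]) (auto simp: indicator_def)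
  have "(\<integral>z. ?G (\<omega>, z) * gk (q - p) z \<partial>lborel) = (\<integral>z. ?H (\<omega>, z) * gk (q - p) z \<partial>lborel)" for \<omega>
    using lborel_integral_real_affine[of "-1" "\<lambda>z. ?G (\<omega>, z) * gk (q - p) z" 0] by simp
  with 1 2 have "(\<integral>\<omega>. ?G (\<omega>, W q \<omega> - W p \<omega>) \<partial>M) = (\<integral>\<omega>. ?H (\<omega>, W q \<omega> - W p \<omega>) \<partial>M)" by simp
  then show ?thesis by (simp add: algebra_simps)
qed (simp add: algebra_simps)

lemma W_density:
  fixes f :: "real \<Rightarrow> real"
  assumes t: "0 < t" and [measurable]: "f \<in> borel_measurable borel"
  shows "(\<integral>\<omega>. f (W t \<omega>) \<partial>M) = (\<integral>x. f x * gk t x \<partial>lborel)"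
    and "integrable M (\<lambda>\<omega>. f (W t \<omega>)) \<longleftrightarrow> integrable lborel (\<lambda>x. f x * gk t x)"
proof -
  note [measurable] = W_measurable[of t] W_measurable[of 0]
  have d: "distributed M lborel (\<lambda>\<omega>. W t \<omega> - W 0 \<omega>) (gk t)" using W_increment[of 0 t] t by simp
  have m: "(\<lambda>\<omega>. W t \<omega> - W 0 \<omega>) \<in> borel_measurable M" using t W_measurable[of t] W_measurable[of 0] by simp
  have "(\<integral>x. gk t x * f x \<partial>lborel) = (\<integral>\<omega>. f (W t \<omega> - W 0 \<omega>) \<partial>M)"
    by (rule distributed_integral[OF d]) auto
  also have "\<dots> = (\<integral>\<omega>. f (W t \<omega>) \<partial>M)" by (intro Bochner_Integration.integral_cong) (auto simp: W_zero)
  finally show "(\<integral>\<omega>. f (W t \<omega>) \<partial>M) = (\<integral>x. f x * gk t x \<partial>lborel)" by (simp add: mult.commute)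
  have "integrable lborel (\<lambda>x. gk t x * f x) = integrable M (\<lambda>\<omega>. f (W t \<omega> - W 0 \<omega>))"
    by (rule distributed_integrable[OF d]) auto
  also have "\<dots> = integrable M (\<lambda>\<omega>. f (W t \<omega>))"
    by (intro Bochner_Integration.integrable_cong) (auto simp: W_zero)
  finally show "integrable M (\<lambda>\<omega>. f (W t \<omega>)) \<longleftrightarrow> integrable lborel (\<lambda>x. f x * gk t x)" by (simp add: mult.commute)
qed

lemma W_neq: "0 < t \<Longrightarrow> AE \<omega> in M. W t \<omega> \<noteq> c"
proof -
  assume t: "0 < t"
  note [measurable] = W_measurable[OF less_imp_le[OF t]]
  have "(\<integral>\<omega>. indicator {c} (W t \<omega>) \<partial>M) = (\<integral>x. indicator {c} x * gk t x \<partial>lborel)"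
    by (rule W_density[OF t]) simp
  also have "\<dots> = (\<integral>x. 0 \<partial>(lborel :: real measure))"
    using AE_lborel_singleton[of c] by (intro integral_cong_AE) (auto elim!: eventually_mono)
  finally have "(\<integral>\<omega>. indicator {c} (W t \<omega>) \<partial>M) = (0::real)" by simp
  moreover have "(\<integral>\<omega>. indicator {c} (W t \<omega>) \<partial>M) = (\<integral>\<omega>. indicator {\<omega>\<in>space M. W t \<omega> = c} \<omega> \<partial>M :: real)"
    by (intro Bochner_Integration.integral_cong) (auto simp: indicator_def)
  moreover have "(\<integral>\<omega>. indicator {\<omega>\<in>space M. W t \<omega> = c} \<omega> \<partial>M) = prob {\<omega>\<in>space M. W t \<omega> = c}"
    by (subst Bochner_Integration.integral_indicator) (auto intro: arg_cong[where f=prob])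
  ultimately have "prob {\<omega>\<in>space M. W t \<omega> = c} = 0" by simp
  then show ?thesis by (subst AE_iff_measurable[OF _ refl]) (auto simp: emeasure_eq_measure)
qed

end

section \<open>The reflection principle\<close>

lemma inverse_Suc_lt: "0 < (d::real) \<Longrightarrow> \<exists>n::nat. 1 / (real n + 1) < d"
  using reals_Archimedean[of d] by (auto simp: inverse_eq_divide add.commute)

text \<open>A continuous path attains its maximum on each compact subinterval, so staying strictly
  below \<open>b\<close> leaves a positive gap there, and the gap passes from rational times to all
  times. The right side is a countable combination of events at fixed times.\<close>

lemma below_iff_rational:
  assumes cont: "continuous_on {0..} w" and p: "0 \<le> p"
  shows "below w b p q \<longleftrightarrow> (\<forall>n::nat. \<exists>m::nat. \<forall>r\<in>\<rat>. p + 1 / (real n + 1) \<le> r \<and> r \<le> q - 1 / (real n + 1) \<longrightarrow> w r \<le> b - 1 / (real m + 1))"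
    (is "_ \<longleftrightarrow> ?R")
proof
  assume H: "below w b p q"
  show ?R
  proof
    fix n :: nat
    let ?I = "{p + 1 / (real n + 1)..q - 1 / (real n + 1)}"
    have I: "p < x \<and> x < q" if "x \<in> ?I" for x
    proof -
      have "0 < 1 / (real n + 1)" by simp
      then show ?thesis using that unfolding atLeastAtMost_iff by linarith
    qed
    show "\<exists>m::nat. \<forall>r\<in>\<rat>. p + 1 / (real n + 1) \<le> r \<and> r \<le> q - 1 / (real n + 1) \<longrightarrow> w r \<le> b - 1 / (real m + 1)"
    proof (cases "?I = {}")
      case False
      have "continuous_on ?I w" by (rule continuous_on_subset[OF cont]) (use I p in force)
      then obtain x where x: "x \<in> ?I" "\<And>y. y \<in> ?I \<Longrightarrow> w y \<le> w x"
        using continuous_attains_sup[of ?I w] False by auto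
      have "w x < b" using H I[OF x(1)] by (auto simp: below_def)
      then obtain m :: nat where "1 / (real m + 1) < b - w x" using inverse_Suc_lt[of "b - w x"] by auto
      then show ?thesis using x(2) by (intro exI[of _ m]) force
    qed auto
  qed
next
  assume R: ?R
  show "below w b p q" unfolding below_def
  proof safe
    fix v assume v: "p < v" "v < q"
    obtain n :: nat where n: "1 / (real n + 1) < min (v - p) (q - v)"
      using inverse_Suc_lt[of "min (v - p) (q - v)"] v by auto
    obtain m :: nat where m: "\<And>r. r \<in> \<rat> \<Longrightarrow> p + 1 / (real n + 1) \<le> r \<Longrightarrow> r \<le> q - 1 / (real n + 1) \<Longrightarrow> w r \<le> b - 1 / (real m + 1)"
      using R by blast
    have "w v \<le> b - 1 / (real m + 1)"
    proof (rule ccontr)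
      assume H: "\<not> ?thesis"
      then obtain d where d: "d > 0" "\<And>x. x \<ge> 0 \<Longrightarrow> dist x v < d \<Longrightarrow> dist (w x) (w v) < w v - (b - 1 / (real m + 1))"
        using cont[unfolded continuous_on_iff, rule_format, of v "w v - (b - 1 / (real m + 1))"] p v by auto
      have "v < min (v + d) (q - 1 / (real n + 1))" using d n by auto
      then obtain r where r: "r \<in> \<rat>" "v < r" "r < min (v + d) (q - 1 / (real n + 1))"
        using Rats_dense_in_real by blast
      have "dist (w r) (w v) < w v - (b - 1 / (real m + 1))" using r p v by (intro d) (auto simp: dist_real_def)
      moreover have "w r \<le> b - 1 / (real m + 1)" using r n by (intro m) auto
      ultimately show False by (auto simp: dist_real_def)
    qed
    moreover have "0 < 1 / (real m + 1)" by simp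
    ultimately show "w v < b" by linarith
  qed
qed

text \<open>The starts are parametrised as \<open>\<theta> * (u - 1)\<close> with rational
  \<open>\<theta>\<close> in [0, 1], which keeps them in the allowed range. Shortening the excursion
  by 1 / (n + 1) at both ends absorbs the rounding of the start, and compactness of [0, 1] recovers
  an exact start from the approximate ones.\<close>

lemma stopped_iff_rational:
  assumes "1 \<le> u"
  shows "stopped w b u \<longleftrightarrow> (\<forall>n::nat. \<exists>\<theta>\<in>\<rat> \<inter> {0..1}. below w b (\<theta> * (u - 1) + 1 / (real n + 1)) (\<theta> * (u - 1) + 1 - 1 / (real n + 1)))"
    (is "_ \<longleftrightarrow> ?R")
proof
  assume "stopped w b u"
  then obtain g where g: "0 \<le> g" "g \<le> u - 1" "below w b g (g + 1)" by (auto simp: stopped_def)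
  show ?R
  proof
    fix n :: nat
    let ?e = "1 / (real n + 1)"
    have e: "0 < ?e" by simp
    have "\<exists>\<theta>\<in>\<rat> \<inter> {0..1}. \<bar>\<theta> * (u - 1) - g\<bar> \<le> ?e"
    proof (cases "g = 0")
      case True then show ?thesis using e by (intro bexI[of _ 0]) auto
    next
      case False
      then have u: "0 < u - 1" using g by auto
      \<comment> \<open>A rational \<open>\<theta>\<close> just below g / (u - 1) moves the start to
        the left by less than the margin \<open>?e\<close> and keeps it nonnegative.\<close>
      have "max 0 ((g - ?e) / (u - 1)) < g / (u - 1)" using False g u e by (auto simp: divide_strict_right_mono)
      then obtain \<theta> where t: "\<theta> \<in> \<rat>" "max 0 ((g - ?e) / (u - 1)) < \<theta>" "\<theta> < g / (u - 1)"
        using Rats_dense_in_real by blast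
      have "\<theta> * (u - 1) < g" using t(3) u by (simp add: pos_less_divide_eq)
      moreover have "g - ?e < \<theta> * (u - 1)" using t(2) u by (simp add: pos_divide_less_eq)
      moreover have "\<theta> \<le> 1" using t(3) g u by (smt (verit) divide_le_eq_1_pos)
      ultimately show ?thesis using t by (intro bexI[of _ \<theta>]) auto
    qed
    then obtain \<theta> where t: "\<theta> \<in> \<rat> \<inter> {0..1}" "\<bar>\<theta> * (u - 1) - g\<bar> \<le> ?e" by blast
    have "below w b (\<theta> * (u - 1) + ?e) (\<theta> * (u - 1) + 1 - ?e)"
      using t(2) by (intro below_mono[OF g(3)]) auto
    then show "\<exists>\<theta>\<in>\<rat> \<inter> {0..1}. below w b (\<theta> * (u - 1) + ?e) (\<theta> * (u - 1) + 1 - ?e)" using t(1) by blast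
  qed
next
  assume ?R
  then obtain \<theta> where t: "\<And>n::nat. \<theta> n \<in> \<rat> \<inter> {0..1}"
    "\<And>n. below w b (\<theta> n * (u - 1) + 1 / (real n + 1)) (\<theta> n * (u - 1) + 1 - 1 / (real n + 1))" by metis
  have "\<forall>n. \<theta> n \<in> {0..1}" using t by auto
  then obtain l r where l: "l \<in> {0..1}" and r: "strict_mono r" and lim: "(\<theta> \<circ> r) \<longlonglongrightarrow> l"
    using compact_Icc[of 0 "1::real"] unfolding compact_def by metis
  have "(\<lambda>n. 1 / (real n + 1)) \<longlonglongrightarrow> 0"
    using LIMSEQ_inverse_real_of_nat by (simp add: inverse_eq_divide add.commute)
  then have e: "(\<lambda>n. 1 / (real (r n) + 1)) \<longlonglongrightarrow> 0"
    using LIMSEQ_subseq_LIMSEQ[OF _ r] by (fastforce simp: comp_def)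
  have lim': "(\<lambda>n. \<theta> (r n)) \<longlonglongrightarrow> l" using lim by (simp add: comp_def)
  have "below w b (l * (u - 1) + 0) (l * (u - 1) + 1 - 0)"
    by (rule below_limit[OF tendsto_add[OF tendsto_mult[OF lim' tendsto_const] e]
       tendsto_diff[OF tendsto_add[OF tendsto_mult[OF lim' tendsto_const] tendsto_const] e]]) (rule t)
  moreover have "l * (u - 1) \<le> 1 * (u - 1)" using l assms by (intro mult_right_mono) auto
  ultimately show "stopped w b u" unfolding stopped_def using l assms
    by (intro exI[of _ "l * (u - 1)"]) auto
qed

text \<open>Because a first start exists, the times at which the path is stopped form a closed
  half-line or the empty set, and the condition is continuous from the right in \<open>s\<close>.
  Rational times then give measurability jointly in time and path.\<close>

lemma stopped_iff_rational_gt: "stopped w b s \<longleftrightarrow> (\<forall>r\<in>\<rat>. s < r \<longrightarrow> stopped w b r)"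
proof
  assume "\<forall>r\<in>\<rat>. s < r \<longrightarrow> stopped w b r"
  then have H: "\<And>r. r \<in> \<rat> \<Longrightarrow> s < r \<Longrightarrow> stopped w b r" by blast
  obtain r0 where r0: "r0 \<in> \<rat>" "s < r0" using Rats_dense_in_real[of s "s + 1"] by auto
  obtain g where g: "0 \<le> g" "below w b g (g + 1)" "\<And>s. 0 \<le> s \<Longrightarrow> s < g \<Longrightarrow> \<not> below w b s (s + 1)"
    using stopped_first[OF H[OF r0]] by blast
  have "g \<le> s - 1"
  proof (rule ccontr)
    assume "\<not> g \<le> s - 1"
    then obtain r where r: "r \<in> \<rat>" "s < r" "r < g + 1" using Rats_dense_in_real[of s "g + 1"] by auto
    obtain g' where "0 \<le> g'" "g' \<le> r - 1" "below w b g' (g' + 1)" using H[OF r(1,2)] by (auto simp: stopped_def)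
    then show False using g(3)[of g'] r by auto
  qed
  then show "stopped w b s" using g by (auto simp: stopped_def)
qed (auto simp: stopped_def intro: order_trans)

section \<open>First passage along finer and finer grids\<close>

definition grid :: "real \<Rightarrow> real \<Rightarrow> nat \<Rightarrow> nat \<Rightarrow> real" where
  "grid p q n k = p + real k * ((q - p) / real (Suc n))"

lemma grid_mem: "p < q \<Longrightarrow> k \<le> Suc n \<Longrightarrow> grid p q n k \<in> {p..q}"
proof -
  assume pq: "p < q" and k: "k \<le> Suc n"
  have "real k * ((q - p) / real (Suc n)) \<le> real (Suc n) * ((q - p) / real (Suc n))"
    using pq k by (intro mult_right_mono) auto
  then show ?thesis using pq by (auto simp: grid_def)
qed

lemma grid_mesh: "(\<lambda>n. (q - p) / real (Suc n)) \<longlonglongrightarrow> 0"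
  using tendsto_mult[OF tendsto_const[of "q - p"] LIMSEQ_inverse_real_of_nat] by (simp add: inverse_eq_divide)

lemma grid_hits:
  fixes w :: "real \<Rightarrow> real"
  assumes pq: "p < q" and cont: "continuous_on {p..q} w" and v: "v \<in> {p..q}" "w v > \<beta>"
  shows "eventually (\<lambda>n. \<exists>k\<le>Suc n. w (grid p q n k) > \<beta>) sequentially"
proof -
  obtain d where d: "d > 0" "\<And>x. x \<in> {p..q} \<Longrightarrow> dist x v < d \<Longrightarrow> dist (w x) (w v) < w v - \<beta>"
    using cont[unfolded continuous_on_iff, rule_format, of v "w v - \<beta>"] v by auto
  have "eventually (\<lambda>n. (q - p) / real (Suc n) < d) sequentially"
    using order_tendstoD(2)[OF grid_mesh d(1)] .
  then show ?thesis
  proof eventually_elim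
    case (elim n)
    define h where "h = (q - p) / real (Suc n)"
    have h: "h > 0" "h < d" using pq elim by (simp_all add: h_def)
    define k where "k = nat \<lfloor>(v - p) / h\<rfloor>"
    have k1: "real k \<le> (v - p) / h" "(v - p) / h < real k + 1"
      using v h by (auto simp: k_def)
    then have k2: "real k * h \<le> v - p" "v - p < real k * h + h"
      using h by (simp_all only: pos_le_divide_eq pos_divide_less_eq distrib_right mult_1)
    have "(v - p) / h \<le> real (Suc n)" using v pq by (simp add: h_def divide_simps)
    then have kn: "k \<le> Suc n" using k1 by linarith
    have "\<bar>p + real k * h - v\<bar> < d" using k2 h by linarith
    then have "dist (grid p q n k) v < d" by (simp add: dist_real_def grid_def h_def)
    from d(2)[OF grid_mem[OF pq kn] this] have "w (grid p q n k) > \<beta>" by (auto simp: dist_real_def)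
    then show ?case using kn by blast
  qed
qed

text \<open>The grid point before the first one above \<open>\<beta>\<close> has a value at most
  \<open>\<beta>\<close>, and uniform continuity makes the step between neighbours small. The
  assumption on \<open>w p\<close> ensures that there is a point before.\<close>

lemma grid_first_passage:
  fixes w :: "real \<Rightarrow> real"
  assumes pq: "p < q" and cont: "continuous_on {p..q} w" and v: "v \<in> {p..q}" "w v > \<beta>" and wp: "w p \<le> \<beta>"
  shows "(\<lambda>n. w (grid p q n (LEAST k. w (grid p q n k) > \<beta>))) \<longlonglongrightarrow> \<beta>"
proof (rule LIMSEQ_I)
  fix e :: real assume e: "0 < e"
  have "uniformly_continuous_on {p..q} w" using cont by (intro compact_uniformly_continuous) auto
  then obtain d where d: "d > 0" "\<And>x y. x \<in> {p..q} \<Longrightarrow> y \<in> {p..q} \<Longrightarrow> dist y x < d \<Longrightarrow> dist (w y) (w x) < e"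
    using e unfolding uniformly_continuous_on_def by metis
  have "eventually (\<lambda>n. (q - p) / real (Suc n) < d) sequentially"
    using order_tendstoD(2)[OF grid_mesh d(1)] .
  with grid_hits[OF assms(1-4)]
  have "eventually (\<lambda>n. norm (w (grid p q n (LEAST k. w (grid p q n k) > \<beta>)) - \<beta>) < e) sequentially"
  proof eventually_elim
    case (elim n)
    let ?P = "\<lambda>k. w (grid p q n k) > \<beta>"
    let ?K = "LEAST k. ?P k"
    obtain k where k: "k \<le> Suc n" "?P k" using elim by blast
    have K: "?P ?K" using k(2) by (rule LeastI)
    have Kn: "?K \<le> Suc n" using Least_le[of ?P, OF k(2)] k(1) by simp
    have K0: "?K \<noteq> 0"
    proof
      assume "?K = 0" then show False using K wp by (simp add: grid_def)
    qed
    then have "\<not> ?P (?K - 1)" using not_less_Least[of "?K - 1" ?P] by simp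
    moreover have "dist (w (grid p q n ?K)) (w (grid p q n (?K - 1))) < e"
    proof (rule d(2))
      define h where "h = (q - p) / real (Suc n)"
      have h: "0 < h" "h < d" using pq elim(2) by (simp_all add: h_def)
      have "real ?K = real (?K - 1) + 1" using K0 by simp
      then have "grid p q n ?K = grid p q n (?K - 1) + h"
        unfolding grid_def h_def[symmetric] by (simp only: distrib_right mult_1 add.assoc)
      then show "dist (grid p q n ?K) (grid p q n (?K - 1)) < d" using h by (simp add: dist_real_def)
    qed (use grid_mem[OF pq] Kn in auto)
    ultimately show ?case using K by (auto simp: dist_real_def)
  qed
  then show "\<exists>no. \<forall>n\<ge>no. norm (w (grid p q n (LEAST k. w (grid p q n k) > \<beta>)) - \<beta>) < e"
    unfolding eventually_sequentially .
qed

text \<open>Collects the contributions of the disjoint events that the first exceedance happens at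
  index \<open>k\<close>.\<close>

lemma sum_first:
  fixes g :: "nat \<Rightarrow> real"
  shows "(\<Sum>k\<le>N. of_bool ((\<forall>j<k. \<not> P j) \<and> P k) * g k) = (if \<exists>k\<le>N. P k then g (LEAST k. P k) else 0)"
proof (cases "\<exists>k. P k")
  case True
  have "((\<forall>j<k. \<not> P j) \<and> P k) \<longleftrightarrow> k = (LEAST k. P k)" for k
    using LeastI_ex[OF True] not_less_Least[of _ P] Least_le[of P] by (metis linorder_neqE_nat not_le)
  then have "(\<Sum>k\<le>N. of_bool ((\<forall>j<k. \<not> P j) \<and> P k) * g k) = (\<Sum>k\<le>N. if k = (LEAST k. P k) then g k else 0)"
    by (intro sum.cong) auto
  also have "\<dots> = (if (LEAST k. P k) \<le> N then g (LEAST k. P k) else 0)" by (simp add: sum.delta)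
  also have "(LEAST k. P k) \<le> N \<longleftrightarrow> (\<exists>k\<le>N. P k)"
    using LeastI_ex[OF True] Least_le[of P] order_trans by blast
  finally show ?thesis .
qed (auto intro: sum.neutral)

section \<open>Measurability of path events and the reflection identity\<close>

context brownian
begin

lemma W_continuous_Icc: "\<omega> \<in> space M \<Longrightarrow> 0 \<le> p \<Longrightarrow> continuous_on {p..q} (\<lambda>t. W t \<omega>)"
  by (rule continuous_on_subset[OF W_continuous]) auto

lemma below_past:
  assumes p: "0 \<le> p"
  shows "{\<omega>\<in>space M. below (\<lambda>t. W t \<omega>) b p q} \<in> sets (past q)"
proof -
  have "{\<omega>\<in>space (past q). \<forall>n::nat. \<exists>m::nat. \<forall>r\<in>{r\<in>\<rat>. p + 1 / (real n + 1) \<le> r \<and> r \<le> q - 1 / (real n + 1)}. W r \<omega> \<le> b - 1 / (real m + 1)} \<in> sets (past q)"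
  proof (intro sets.sets_Collect_countable_All sets.sets_Collect_countable_Ex sets.sets_Collect_countable_All')
    fix n m :: nat and r assume r: "r \<in> {r\<in>\<rat>. p + 1 / (real n + 1) \<le> r \<and> r \<le> q - 1 / (real n + 1)}"
    have "0 < 1 / (real n + 1)" by simp
    moreover have "p + 1 / (real n + 1) \<le> r" "r \<le> q - 1 / (real n + 1)" using r by auto
    ultimately have "0 \<le> r" "r \<le> q" using p by linarith+
    note [measurable] = W_past[OF this]
    show "{\<omega>\<in>space (past q). W r \<omega> \<le> b - 1 / (real m + 1)} \<in> sets (past q)" by measurable
  qed (auto intro: countable_subset[OF _ countable_rat])
  moreover have "below (\<lambda>t. W t \<omega>) b p q \<longleftrightarrow> (\<forall>n::nat. \<exists>m::nat. \<forall>r\<in>{r\<in>\<rat>. p + 1 / (real n + 1) \<le> r \<and> r \<le> q - 1 / (real n + 1)}. W r \<omega> \<le> b - 1 / (real m + 1))"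
    if "\<omega> \<in> space M" for \<omega>
    unfolding below_iff_rational[OF W_continuous[OF that] p] by (simp add: Ball_def imp_conjL)
  then have "{\<omega>\<in>space M. below (\<lambda>t. W t \<omega>) b p q} = {\<omega>\<in>space (past q). \<forall>n::nat. \<exists>m::nat. \<forall>r\<in>{r\<in>\<rat>. p + 1 / (real n + 1) \<le> r \<and> r \<le> q - 1 / (real n + 1)}. W r \<omega> \<le> b - 1 / (real m + 1)}"
    by (intro Collect_cong) auto
  ultimately show ?thesis by (simp only:)
qed

lemma stopped_past: "{\<omega>\<in>space M. stopped (\<lambda>t. W t \<omega>) b u} \<in> sets (past u)"
proof (cases "1 \<le> u")
  case True
  have "{\<omega>\<in>space (past u). \<forall>n::nat. \<exists>\<theta>\<in>\<rat> \<inter> {0..1}. below (\<lambda>t. W t \<omega>) b (\<theta> * (u - 1) + 1 / (real n + 1)) (\<theta> * (u - 1) + 1 - 1 / (real n + 1))} \<in> sets (past u)"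
  proof (intro sets.sets_Collect_countable_All sets.sets_Collect_countable_Ex')
    fix n :: nat and \<theta> assume t: "\<theta> \<in> \<rat> \<inter> {0..1::real}"
    have "\<theta> * (u - 1) \<le> 1 * (u - 1)" using t True by (intro mult_right_mono) auto
    then have "\<theta> * (u - 1) + 1 - 1 / (real n + 1) \<le> u - 1 / (real n + 1)" by simp
    also have "\<dots> \<le> u" by simp
    finally show "{\<omega>\<in>space (past u). below (\<lambda>t. W t \<omega>) b (\<theta> * (u - 1) + 1 / (real n + 1)) (\<theta> * (u - 1) + 1 - 1 / (real n + 1))} \<in> sets (past u)"
      using below_past[of "\<theta> * (u - 1) + 1 / (real n + 1)" b "\<theta> * (u - 1) + 1 - 1 / (real n + 1)"] sets_past_mono t True by fastforce
  qed (auto intro: countable_subset[OF _ countable_rat])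
  then show ?thesis by (simp add: stopped_iff_rational[OF True])
next
  case False
  then have *: "{\<omega>\<in>space M. stopped (\<lambda>t. W t \<omega>) b u} = {}" by (auto simp: stopped_def)
  show ?thesis unfolding * by (rule sets.empty_sets)
qed

text \<open>Requiring \<open>0 < fst x\<close> keeps all times that occur nonnegative, where the
  paths are continuous and measurable; the rational times are restricted accordingly.\<close>

lemma below_joint:
  assumes c: "0 \<le> c"
  shows "{x\<in>space (borel \<Otimes>\<^sub>M M). 0 < fst x \<and> below (\<lambda>t. W t (snd x)) b (fst x + c) (fst x + d)} \<in> sets (borel \<Otimes>\<^sub>M M)"
proof -
  let ?N = "borel \<Otimes>\<^sub>M M"
  let ?Q = "\<lambda>x. 0 < fst x \<and> (\<forall>n::nat. \<exists>m::nat. \<forall>r\<in>\<rat> \<inter> {0..}. fst x + c + 1 / (real n + 1) \<le> r \<and> r \<le> fst x + d - 1 / (real n + 1) \<longrightarrow> W r (snd x) \<le> b - 1 / (real m + 1))"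
  have "{x\<in>space ?N. ?Q x} \<in> sets ?N"
  proof (intro sets.sets_Collect_conj sets.sets_Collect_countable_All sets.sets_Collect_countable_Ex sets.sets_Collect_countable_All')
    fix n m :: nat and r :: real assume r: "r \<in> \<rat> \<inter> {0..}"
    then have "0 \<le> r" by simp
    note [measurable] = W_measurable[OF this]
    show "{x\<in>space ?N. fst x + c + 1 / (real n + 1) \<le> r \<and> r \<le> fst x + d - 1 / (real n + 1) \<longrightarrow> W r (snd x) \<le> b - 1 / (real m + 1)} \<in> sets ?N"
      by measurable
  qed (auto intro: countable_subset[OF _ countable_rat])
  moreover have "?Q x \<longleftrightarrow> 0 < fst x \<and> below (\<lambda>t. W t (snd x)) b (fst x + c) (fst x + d)" if x: "x \<in> space ?N" for x
  proof (cases "0 < fst x")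
    case True
    have "0 \<le> r" if "fst x + c + 1 / (real n + 1) \<le> r" for r and n :: nat
    proof -
      have "0 \<le> fst x + c + 1 / (real n + 1)" using True c by simp
      then show ?thesis using that by linarith
    qed
    then have "?Q x \<longleftrightarrow> 0 < fst x \<and> (\<forall>n::nat. \<exists>m::nat. \<forall>r\<in>\<rat>. fst x + c + 1 / (real n + 1) \<le> r \<and> r \<le> fst x + d - 1 / (real n + 1) \<longrightarrow> W r (snd x) \<le> b - 1 / (real m + 1))"
      by (intro arg_cong2[where f="(\<and>)"] iff_allI iff_exI refl) auto
    also have "\<dots> \<longleftrightarrow> 0 < fst x \<and> below (\<lambda>t. W t (snd x)) b (fst x + c) (fst x + d)"
      using True c x by (subst below_iff_rational[OF W_continuous]) (auto simp: space_pair_measure)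
    finally show ?thesis .
  qed simp
  ultimately show ?thesis by (simp cong: conj_cong)
qed

lemma stopped_joint: "{x\<in>space (borel \<Otimes>\<^sub>M M). stopped (\<lambda>t. W t (snd x)) b (fst x)} \<in> sets (borel \<Otimes>\<^sub>M M)"
proof -
  have "{x\<in>space (borel \<Otimes>\<^sub>M M). \<forall>r\<in>\<rat>. fst x < r \<longrightarrow> stopped (\<lambda>t. W t (snd x)) b r} \<in> sets (borel \<Otimes>\<^sub>M M)"
  proof (intro sets.sets_Collect_countable_All' countable_rat)
    fix r :: real
    have s: "{\<omega>\<in>space M. stopped (\<lambda>t. W t \<omega>) b r} \<in> sets M" using stopped_past sets_past_subset by blast
    then have [measurable]: "Measurable.pred M (\<lambda>\<omega>. stopped (\<lambda>t. W t \<omega>) b r)" by (simp add: pred_def)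
    show "{x\<in>space (borel \<Otimes>\<^sub>M M). fst x < r \<longrightarrow> stopped (\<lambda>t. W t (snd x)) b r} \<in> sets (borel \<Otimes>\<^sub>M M)" by measurable
  qed
  then show ?thesis by (subst stopped_iff_rational_gt)
qed

lemma hit_past:
  assumes pq: "0 \<le> p" "p < q"
  shows "{\<omega>\<in>space M. \<exists>v\<in>{p..q}. W v \<omega> > \<beta>} \<in> sets (past q)"
proof -
  have "{\<omega>\<in>space (past q). \<exists>n. \<exists>k\<in>{..Suc n}. W (grid p q n k) \<omega> > \<beta>} \<in> sets (past q)"
  proof (intro sets.sets_Collect_countable_Ex sets.sets_Collect_countable_Ex')
    fix n k assume "k \<in> {..Suc n}"
    then have "0 \<le> grid p q n k" "grid p q n k \<le> q" using grid_mem[OF pq(2), of k n] pq by auto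
    note [measurable] = W_past[OF this]
    show "{\<omega>\<in>space (past q). W (grid p q n k) \<omega> > \<beta>} \<in> sets (past q)" by measurable
  qed auto
  moreover have "(\<exists>v\<in>{p..q}. W v \<omega> > \<beta>) \<longleftrightarrow> (\<exists>n. \<exists>k\<in>{..Suc n}. W (grid p q n k) \<omega> > \<beta>)" if "\<omega> \<in> space M" for \<omega>
  proof
    assume "\<exists>v\<in>{p..q}. W v \<omega> > \<beta>"
    then obtain v where "v \<in> {p..q}" "W v \<omega> > \<beta>" by blast
    from grid_hits[OF pq(2) W_continuous_Icc[OF that pq(1)] this]
    have "\<exists>n. \<exists>k\<le>Suc n. W (grid p q n k) \<omega> > \<beta>" by (rule eventually_happens'[OF sequentially_bot])
    then show "\<exists>n. \<exists>k\<in>{..Suc n}. W (grid p q n k) \<omega> > \<beta>" by auto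
  qed (use grid_mem[OF pq(2)] in blast)
  ultimately show ?thesis by (simp cong: conj_cong)
qed

text \<open>Reflection at the first passage time itself would call for the strong Markov property.
  Instead the path is reflected at the first grid time above \<open>\<beta>\<close>: for each grid
  index this is an event of the past of a deterministic time, and \<open>reflect_increment\<close>
  applies. As the grid gets finer, the reflection point tends to \<open>\<beta>\<close>, and almost
  sure continuity of \<open>f\<close> at the reflected endpoint permits the limit.\<close>

lemma reflection:
  fixes f :: "real \<Rightarrow> real"
  assumes pq: "0 \<le> p" "p < q" and E: "E \<in> sets (past p)" and [measurable]: "f \<in> borel_measurable borel"
    and B: "\<And>x. \<bar>f x\<bar> \<le> B" and below: "\<And>\<omega>. \<omega> \<in> E \<Longrightarrow> W p \<omega> \<le> \<beta>"
    and cont: "AE \<omega> in M. isCont f (2 * \<beta> - W q \<omega>)"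
  shows "(\<integral>\<omega>. indicator E \<omega> * (of_bool (\<exists>v\<in>{p..q}. W v \<omega> > \<beta>) * f (W q \<omega>)) \<partial>M)
     = (\<integral>\<omega>. indicator E \<omega> * (of_bool (\<exists>v\<in>{p..q}. W v \<omega> > \<beta>) * f (2 * \<beta> - W q \<omega>)) \<partial>M)"
proof -
  have EM [measurable]: "E \<in> sets M" using E sets_past_subset by blast
  have [measurable]: "W q \<in> borel_measurable M" using pq by (intro W_measurable) simp
  have hit [measurable]: "Measurable.pred M (\<lambda>\<omega>. \<exists>v\<in>{p..q}. W v \<omega> > \<beta>)"
    using hit_past[OF pq] sets_past_subset by (auto simp: pred_def)
  have B0: "0 \<le> B" using abs_ge_zero[of "f 0"] B[of 0] by linarith
  let ?t = "grid p q" and ?P = "\<lambda>n \<omega> k. W (grid p q n k) \<omega> > \<beta>"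
  have t: "0 \<le> ?t n k" "?t n k \<le> q" "p \<le> ?t n k" if "k \<le> Suc n" for n k
    using grid_mem[OF pq(2) that] pq by auto
  \<comment> \<open>First exceedance of \<open>\<beta>\<close> at grid index \<open>k\<close>; for
    fixed \<open>n\<close> these events are disjoint, and the past of the grid time decides
    them.\<close>
  define S where "S n k = {\<omega>\<in>space M. (\<forall>j\<in>{..<k}. \<not> ?P n \<omega> j) \<and> ?P n \<omega> k}" for n k
  have S: "S n k \<in> sets (past (?t n k))" if k: "k \<le> Suc n" for n k
  proof -
    have j: "W (?t n j) \<in> borel_measurable (past (?t n k))" if "j \<le> k" for j
    proof (rule W_past)
      show "0 \<le> ?t n j" using t[of j n] k that by simp
      show "?t n j \<le> ?t n k" using that pq unfolding grid_def by (intro add_left_mono mult_right_mono) auto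
    qed
    have "{\<omega>\<in>space (past (?t n k)). (\<forall>j\<in>{..<k}. \<not> ?P n \<omega> j) \<and> ?P n \<omega> k} \<in> sets (past (?t n k))"
    proof (intro sets.sets_Collect_conj sets.sets_Collect_finite_All)
      fix i assume "i \<in> {..<k}"
      then have [measurable]: "W (?t n i) \<in> borel_measurable (past (?t n k))" by (intro j) simp
      show "{\<omega>\<in>space (past (?t n k)). \<not> ?P n \<omega> i} \<in> sets (past (?t n k))" by measurable
    next
      have [measurable]: "W (?t n k) \<in> borel_measurable (past (?t n k))" by (intro j) simp
      show "{\<omega>\<in>space (past (?t n k)). ?P n \<omega> k} \<in> sets (past (?t n k))" by measurable
    qed simp
    then show ?thesis by (simp add: S_def)
  qed
  have SM: "S n k \<in> sets M" if "k \<le> Suc n" for n k using S[OF that] sets_past_subset by blast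
  have step: "(\<integral>\<omega>. indicator (E \<inter> S n k) \<omega> * f (W q \<omega>) \<partial>M) = (\<integral>\<omega>. indicator (E \<inter> S n k) \<omega> * f (2 * W (?t n k) \<omega> - W q \<omega>) \<partial>M)"
    if k: "k \<le> Suc n" for n k
    using S[OF k] E sets_past_mono[OF t(3)[OF k]] t[OF k] by (intro reflect_increment[where B=B] B) auto
  have sum_eq: "(\<Sum>k\<le>Suc n. indicator (E \<inter> S n k) \<omega> * h k) = indicator E \<omega> * (if \<exists>k\<le>Suc n. ?P n \<omega> k then h (LEAST k. ?P n \<omega> k) else 0)"
    if "\<omega> \<in> space M" for n \<omega> and h :: "nat \<Rightarrow> real"
  proof -
    have "(\<Sum>k\<le>Suc n. indicator (E \<inter> S n k) \<omega> * h k) = indicator E \<omega> * (\<Sum>k\<le>Suc n. of_bool ((\<forall>j<k. \<not> ?P n \<omega> j) \<and> ?P n \<omega> k) * h k)"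
      unfolding sum_distrib_left using that by (intro sum.cong) (auto simp: S_def indicator_def)
    then show ?thesis unfolding sum_first .
  qed
  let ?L = "\<lambda>n \<omega>. indicator E \<omega> * (if \<exists>k\<le>Suc n. ?P n \<omega> k then f (W q \<omega>) else 0)"
  let ?R = "\<lambda>n \<omega>. indicator E \<omega> * (if \<exists>k\<le>Suc n. ?P n \<omega> k then f (2 * W (?t n (LEAST k. ?P n \<omega> k)) \<omega> - W q \<omega>) else 0)"
  have int1: "integrable M (\<lambda>\<omega>. indicator (E \<inter> S n k) \<omega> * f (W q \<omega>))" if "k \<le> Suc n" for n k
    using SM[OF that] B B0 by (intro integrable_const_bound[where B=B]) (auto simp: indicator_def)
  have int2: "integrable M (\<lambda>\<omega>. indicator (E \<inter> S n k) \<omega> * f (2 * W (?t n k) \<omega> - W q \<omega>))" if k: "k \<le> Suc n" for n k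
  proof -
    have [measurable]: "W (?t n k) \<in> borel_measurable M" using t[OF k] by (intro W_measurable)
    show ?thesis using SM[OF k] B B0 by (intro integrable_const_bound[where B=B]) (auto simp: indicator_def)
  qed
  have Lm: "?L n \<in> borel_measurable M" for n
  proof -
    have "(\<lambda>\<omega>. \<Sum>k\<le>Suc n. indicator (E \<inter> S n k) \<omega> * f (W q \<omega>)) \<in> borel_measurable M"
      by (intro borel_measurable_sum borel_measurable_integrable[OF int1]) simp
    then show ?thesis by (rule measurable_cong[THEN iffD1, rotated]) (rule sum_eq)
  qed
  have Rm: "?R n \<in> borel_measurable M" for n
  proof -
    have "(\<lambda>\<omega>. \<Sum>k\<le>Suc n. indicator (E \<inter> S n k) \<omega> * f (2 * W (?t n k) \<omega> - W q \<omega>)) \<in> borel_measurable M"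
      by (intro borel_measurable_sum borel_measurable_integrable[OF int2]) simp
    then show ?thesis by (rule measurable_cong[THEN iffD1, rotated]) (rule sum_eq)
  qed
  have eq: "integral\<^sup>L M (?L n) = integral\<^sup>L M (?R n)" for n
  proof -
    have "integral\<^sup>L M (?L n) = (\<integral>\<omega>. (\<Sum>k\<le>Suc n. indicator (E \<inter> S n k) \<omega> * f (W q \<omega>)) \<partial>M)"
      by (intro Bochner_Integration.integral_cong refl sum_eq[symmetric])
    also have "\<dots> = (\<Sum>k\<le>Suc n. \<integral>\<omega>. indicator (E \<inter> S n k) \<omega> * f (W q \<omega>) \<partial>M)"
      by (intro Bochner_Integration.integral_sum int1) auto
    also have "\<dots> = (\<Sum>k\<le>Suc n. \<integral>\<omega>. indicator (E \<inter> S n k) \<omega> * f (2 * W (?t n k) \<omega> - W q \<omega>) \<partial>M)"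
      by (intro sum.cong refl step) auto
    also have "\<dots> = (\<integral>\<omega>. (\<Sum>k\<le>Suc n. indicator (E \<inter> S n k) \<omega> * f (2 * W (?t n k) \<omega> - W q \<omega>)) \<partial>M)"
      by (intro Bochner_Integration.integral_sum[symmetric] int2) auto
    also have "\<dots> = integral\<^sup>L M (?R n)"
      by (intro Bochner_Integration.integral_cong refl sum_eq)
    finally show ?thesis .
  qed
  have "(\<lambda>n. integral\<^sup>L M (?L n)) \<longlonglongrightarrow> (\<integral>\<omega>. indicator E \<omega> * (of_bool (\<exists>v\<in>{p..q}. W v \<omega> > \<beta>) * f (W q \<omega>)) \<partial>M)"
  proof (rule integral_dominated_convergence[where w="\<lambda>_. B"])
    show "AE \<omega> in M. (\<lambda>n. ?L n \<omega>) \<longlonglongrightarrow> indicator E \<omega> * (of_bool (\<exists>v\<in>{p..q}. W v \<omega> > \<beta>) * f (W q \<omega>))"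
    proof (rule AE_I2)
      fix \<omega> assume w: "\<omega> \<in> space M"
      show "(\<lambda>n. ?L n \<omega>) \<longlonglongrightarrow> indicator E \<omega> * (of_bool (\<exists>v\<in>{p..q}. W v \<omega> > \<beta>) * f (W q \<omega>))"
      proof (cases "\<exists>v\<in>{p..q}. W v \<omega> > \<beta>")
        case True
        then obtain v where "v \<in> {p..q}" "W v \<omega> > \<beta>" by blast
        from grid_hits[OF pq(2) W_continuous_Icc[OF w pq(1)] this]
        have "eventually (\<lambda>n. indicator E \<omega> * (of_bool (\<exists>v\<in>{p..q}. W v \<omega> > \<beta>) * f (W q \<omega>)) = ?L n \<omega>) sequentially"
          by eventually_elim (use True in auto)
        then show ?thesis by (rule Lim_transform_eventually[OF tendsto_const])
      next
        case False
        then have "?L n \<omega> = 0" for n using grid_mem[OF pq(2)] by auto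
        then have z: "(\<lambda>n. ?L n \<omega>) = (\<lambda>_. 0)" by (rule ext)
        show ?thesis unfolding z using False by simp
      qed
    qed
    show "(\<lambda>\<omega>. indicator E \<omega> * (of_bool (\<exists>v\<in>{p..q}. W v \<omega> > \<beta>) * f (W q \<omega>))) \<in> borel_measurable M"
      by measurable
    show "AE \<omega> in M. norm (?L n \<omega>) \<le> B" for n
      using B B0 by (intro AE_I2) (simp add: indicator_def)
  qed (use Lm in \<open>simp_all only: integrable_const\<close>)
  moreover have "(\<lambda>n. integral\<^sup>L M (?R n)) \<longlonglongrightarrow> (\<integral>\<omega>. indicator E \<omega> * (of_bool (\<exists>v\<in>{p..q}. W v \<omega> > \<beta>) * f (2 * \<beta> - W q \<omega>)) \<partial>M)"
  proof (rule integral_dominated_convergence[where w="\<lambda>_. B"])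
    show "AE \<omega> in M. (\<lambda>n. ?R n \<omega>) \<longlonglongrightarrow> indicator E \<omega> * (of_bool (\<exists>v\<in>{p..q}. W v \<omega> > \<beta>) * f (2 * \<beta> - W q \<omega>))"
      using cont AE_space
    proof eventually_elim
      case (elim \<omega>)
      then have w: "\<omega> \<in> space M" and c: "isCont f (2 * \<beta> - W q \<omega>)" by auto
      show ?case
      proof (cases "\<omega> \<in> E \<and> (\<exists>v\<in>{p..q}. W v \<omega> > \<beta>)")
        case True
        then obtain v where v: "v \<in> {p..q}" "W v \<omega> > \<beta>" by blast
        have lim: "(\<lambda>n. W (?t n (LEAST k. ?P n \<omega> k)) \<omega>) \<longlonglongrightarrow> \<beta>"
          using True by (intro grid_first_passage[OF pq(2) W_continuous_Icc[OF w pq(1)] v] below) auto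
        have "(\<lambda>n. f (2 * W (?t n (LEAST k. ?P n \<omega> k)) \<omega> - W q \<omega>)) \<longlonglongrightarrow> f (2 * \<beta> - W q \<omega>)"
          by (intro isCont_tendsto_compose[OF c] tendsto_intros lim)
        moreover have "eventually (\<lambda>n. f (2 * W (?t n (LEAST k. ?P n \<omega> k)) \<omega> - W q \<omega>) = ?R n \<omega>) sequentially"
          using grid_hits[OF pq(2) W_continuous_Icc[OF w pq(1)] v] by eventually_elim (use True in auto)
        ultimately have "(\<lambda>n. ?R n \<omega>) \<longlonglongrightarrow> f (2 * \<beta> - W q \<omega>)" by (rule Lim_transform_eventually)
        then show ?thesis using True by simp
      next
        case False
        then have "?R n \<omega> = 0" for n using grid_mem[OF pq(2)] by (auto simp: indicator_def)
        then have z: "(\<lambda>n. ?R n \<omega>) = (\<lambda>_. 0)" by (rule ext)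
        show ?thesis unfolding z using False by auto
      qed
    qed
    show "(\<lambda>\<omega>. indicator E \<omega> * (of_bool (\<exists>v\<in>{p..q}. W v \<omega> > \<beta>) * f (2 * \<beta> - W q \<omega>))) \<in> borel_measurable M"
      by measurable
    show "AE \<omega> in M. norm (?R n \<omega>) \<le> B" for n
      using B B0 by (intro AE_I2) (simp add: indicator_def)
  qed (use Rm in \<open>simp_all only: integrable_const\<close>)
  ultimately show ?thesis unfolding eq by (rule LIMSEQ_unique)
qed

end

section \<open>The killed Markov property and null events\<close>

lemma below_endpoints:
  assumes cont: "continuous_on {p..q} w" and pq: "p < q" and b: "below w b p q"
  shows "w p \<le> b" "w q \<le> b"
proof -
  have c: "closure {p<..<q} = {p..q}" using pq by simp
  have "w x \<le> b" if "x \<in> closure {p<..<q}" for x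
    by (rule continuous_le_on_closure[OF _ that]) (use cont c b in \<open>auto simp: below_def\<close>)
  then show "w p \<le> b" "w q \<le> b" using pq c by auto
qed

lemma heat_reflect: "heat t (\<lambda>y. f (2 * b - y)) x = heat t f (2 * b - x)"
proof -
  have "gk t (2 * b - y - x) = gk t (y - (2 * b - x))" for y
    using gk_minus[of t "y - (2 * b - x)"] by (simp add: algebra_simps)
  then show ?thesis
    unfolding heat_def using lborel_integral_real_affine[of "-1" "\<lambda>y. f (2 * b - y) * gk t (y - x)" "2 * b"]
    by simp
qed

definition normal_cdf :: "real \<Rightarrow> real \<Rightarrow> real" where
  "normal_cdf t a = (\<integral>z. of_bool (z < a) * gk t z \<partial>lborel)"

lemma isCont_normal_cdf: "t > 0 \<Longrightarrow> isCont (normal_cdf t) a"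
  unfolding normal_cdf_def
proof (rule isCont_integral_dominated[where d=1 and w="gk t"])
  show "AE z in lborel. isCont (\<lambda>a. of_bool (z < a) * gk t z) a"
    using AE_lborel_singleton[of a]
  proof eventually_elim
    case (elim z)
    have "eventually (\<lambda>a'. (z < a') = (z < a)) (nhds a)"
    proof (cases "z < a")
      case True
      then show ?thesis using eventually_nhds_in_open[of "{z<..}" a] by (auto elim!: eventually_mono)
    next
      case False
      then show ?thesis using eventually_nhds_in_open[of "{..<z}" a] elim by (auto elim!: eventually_mono)
    qed
    then have "eventually (\<lambda>a'. of_bool (z < a') * gk t z = of_bool (z < a) * gk t z) (nhds a)"
      by eventually_elim simp
    from isCont_cong[OF this] show ?case by simp
  qed
qed (auto simp: of_bool_def)

lemma killed_one:
  assumes "x < c"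
  shows "killed c t (\<lambda>_. 1) x = normal_cdf t (c - x) - normal_cdf t (x - c)"
proof -
  have h: "heat t (\<lambda>y. 1 * indicator {..<c} y) \<xi> = normal_cdf t (c - \<xi>)" for \<xi>
    unfolding heat_def normal_cdf_def
    using lborel_integral_real_affine[of 1 "\<lambda>y. 1 * indicator {..<c} y * gk t (y - \<xi>)" \<xi>]
    by (simp add: indicator_def of_bool_def less_diff_eq add.commute)
  show ?thesis unfolding killed_def h using assms by (simp add: algebra_simps)
qed

text \<open>This is \<open>killed_scaled_bound\<close> at \<open>a = 1/4\<close> and
  \<open>\<eta> = 2 * (b - x)\<close>, for which \<open>sqrt a * \<eta> = b - x\<close> and the
  remaining time is 3/4. It records that the survival probability vanishes at least linearly at the
  level.\<close>

lemma killed_one_bound: "\<bar>killed b (3/4) (\<lambda>_. 1) x\<bar> \<le> 6 * max 0 (b - x) * exp ((b - x)\<^sup>2 / 2)"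
proof -
  have s: "sqrt (1/4 :: real) = 1/2" by (simp add: real_sqrt_divide)
  have e: "b - sqrt (1/4) * (2 * (b - x)) = x" unfolding s by (simp add: field_simps)
  have q: "(2 * (b - x))\<^sup>2 / 8 = (b - x)\<^sup>2 / 2" by (simp only: power_mult_distrib) simp
  have "\<bar>killed b (1 - 1/4) (\<lambda>_. 1) (b - sqrt (1/4) * (2 * (b - x))) / sqrt (1/4)\<bar> \<le>
     6 * 1 * (indicator {0<..} (2 * (b - x)) * (2 * (b - x) * exp ((2 * (b - x))\<^sup>2 / 8)))"
    by (rule killed_scaled_bound) auto
  then have "\<bar>killed b (3/4) (\<lambda>_. 1) x\<bar> * 2 \<le> 6 * (indicator {0<..} (2 * (b - x)) * (2 * (b - x) * exp ((b - x)\<^sup>2 / 2)))"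
    unfolding e unfolding s q by (simp add: abs_mult mult_ac)
  moreover have "K \<le> 6 * (i * (y * e))" if "K * 2 \<le> 6 * (i * (2 * y * e))" for K i y e :: real
    using that by (simp add: mult_ac)
  ultimately have "\<bar>killed b (3/4) (\<lambda>_. 1) x\<bar> \<le> 6 * (indicator {0<..} (2 * (b - x)) * ((b - x) * exp ((b - x)\<^sup>2 / 2)))"
    by blast
  moreover have "indicator {0<..} (2 * (b - x)) * ((b - x) * exp ((b - x)\<^sup>2 / 2)) = max 0 (b - x) * exp ((b - x)\<^sup>2 / 2)"
    by (auto simp: indicator_def max_def)
  ultimately show ?thesis by (simp only: mult.assoc)
qed

context brownian
begin

lemma below_pred: "0 \<le> p \<Longrightarrow> Measurable.pred M (\<lambda>\<omega>. below (\<lambda>t. W t \<omega>) b p q)"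
  using subsetD[OF sets_past_subset below_past[of p b q]] by (simp add: pred_def)

lemma below_iff_AE:
  assumes "0 \<le> p" "p < q" "\<omega> \<in> space M" "W p \<omega> \<noteq> b" "W q \<omega> \<noteq> b"
  shows "below (\<lambda>t. W t \<omega>) b p q \<longleftrightarrow> W p \<omega> < b \<and> W q \<omega> < b \<and> \<not> (\<exists>v\<in>{p..q}. W v \<omega> \<ge> b)"
proof
  assume H: "below (\<lambda>t. W t \<omega>) b p q"
  have e: "W p \<omega> < b" "W q \<omega> < b"
    using below_endpoints[OF W_continuous_Icc[OF assms(3,1)] assms(2) H] assms(4,5) by auto
  moreover have "W v \<omega> < b" if "v \<in> {p..q}" for v
    using that e H by (cases "v = p \<or> v = q") (auto simp: below_def)
  ultimately show "W p \<omega> < b \<and> W q \<omega> < b \<and> \<not> (\<exists>v\<in>{p..q}. W v \<omega> \<ge> b)" by (auto simp: not_le)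
qed (auto simp: below_def not_le)

text \<open>The path attains its maximum on [p, q], and a maximum below \<open>b\<close> lies below
  \<open>\<beta> n\<close> for large \<open>n\<close>. So passing strictly above levels that tend to
  \<open>b\<close> from below detects reaching \<open>b\<close>.\<close>

lemma eventually_hit:
  assumes "0 \<le> p" "p < q" "\<omega> \<in> space M" "\<beta> \<longlonglongrightarrow> b" "\<And>n. \<beta> n < b"
  shows "eventually (\<lambda>n. (\<exists>v\<in>{p..q}. W v \<omega> > \<beta> n) \<longleftrightarrow> (\<exists>v\<in>{p..q}. W v \<omega> \<ge> b)) sequentially"
proof (cases "\<exists>v\<in>{p..q}. W v \<omega> \<ge> b")
  case True
  then have "\<exists>v\<in>{p..q}. W v \<omega> > \<beta> n" for n using assms(5) by (meson less_le_trans)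
  then show ?thesis using True by simp
next
  case False
  obtain x where x: "x \<in> {p..q}" "\<And>v. v \<in> {p..q} \<Longrightarrow> W v \<omega> \<le> W x \<omega>"
    using continuous_attains_sup[OF _ _ W_continuous_Icc[OF assms(3,1)], of q] assms(2) by auto
  have "W x \<omega> < b" using False x(1) by (auto simp: not_le)
  from order_tendstoD(1)[OF assms(4) this] show ?thesis
    by eventually_elim (use False x in force)
qed

text \<open>The reflection identity concerns strict passage of a level, whereas \<open>below\<close>
  already fails when \<open>b\<close> is reached. Levels \<open>\<beta> n\<close> increasing to
  \<open>b\<close> reconcile the two, by \<open>eventually_hit\<close>. Removing from the free
  motion the paths that reach \<open>b\<close>, and counting these through their mirror images,
  produces the two terms of \<open>killed\<close>.\<close>

lemma killed_markov:
  fixes \<psi> :: "real \<Rightarrow> real"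
  assumes p: "0 < p" "p < q" and E: "E \<in> sets (past p)" and [measurable]: "\<psi> \<in> borel_measurable borel"
    and B: "\<And>x. \<bar>\<psi> x\<bar> \<le> B" and cont: "\<And>x. x < b \<Longrightarrow> isCont \<psi> x"
  shows "(\<integral>\<omega>. indicator E \<omega> * (of_bool (below (\<lambda>t. W t \<omega>) b p q) * \<psi> (W q \<omega>)) \<partial>M)
     = (\<integral>\<omega>. indicator E \<omega> * killed b (q - p) \<psi> (W p \<omega>) \<partial>M)"
proof -
  have p0: "0 \<le> p" "0 \<le> q" "0 < q" using p by auto
  have [measurable]: "E \<in> sets M" using E sets_past_subset by blast
  note [measurable] = W_measurable[OF p0(1)] W_measurable[OF p0(2)]
  have B0: "0 \<le> B" using abs_ge_zero[of "\<psi> 0"] B[of 0] by linarith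
  define \<beta> where "\<beta> n = b - 1 / (real n + 1)" for n :: nat
  have \<beta>b: "\<beta> n < b" for n by (simp add: \<beta>_def)
  have "(\<lambda>n. b - 1 / (real n + 1)) \<longlonglongrightarrow> b - 0"
    using LIMSEQ_inverse_real_of_nat by (intro tendsto_diff tendsto_const) (simp add: inverse_eq_divide add.commute)
  then have \<beta>lim: "\<beta> \<longlonglongrightarrow> b" by (simp add: \<beta>_def[abs_def])
  define En where "En n = E \<inter> {\<omega>\<in>space M. W p \<omega> \<le> \<beta> n}" for n
  have En: "En n \<in> sets (past p)" for n
  proof -
    note [measurable] = W_past[OF p0(1) order_refl]
    have "{\<omega>\<in>space (past p). W p \<omega> \<le> \<beta> n} \<in> sets (past p)" by measurable
    then show ?thesis using E by (auto simp: En_def)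
  qed
  have [measurable]: "En n \<in> sets M" for n using En sets_past_subset by blast
  \<comment> \<open>Cut off at \<open>\<beta> n\<close>, the function can be discontinuous below
    \<open>b\<close> only at \<open>\<beta> n\<close>, and the reflected endpoint almost surely
    avoids that value.\<close>
  define f where "f n x = of_bool (x < \<beta> n) * \<psi> x" for n x
  have [measurable]: "f n \<in> borel_measurable borel" for n unfolding f_def by measurable
  have fB: "\<bar>f n x\<bar> \<le> B" for n x using B B0 by (auto simp: f_def)
  have fcont: "isCont (f n) y" if "y \<noteq> \<beta> n" for n y
  proof (cases "y < \<beta> n")
    case True
    have "eventually (\<lambda>x. f n x = \<psi> x) (nhds y)"
      using eventually_nhds_in_open[of "{..<\<beta> n}" y] True by (auto elim!: eventually_mono simp: f_def)
    then show ?thesis using cont[of y] True \<beta>b[of n] by (simp add: isCont_cong)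
  next
    case False
    have "eventually (\<lambda>x. f n x = 0) (nhds y)"
      using eventually_nhds_in_open[of "{\<beta> n<..}" y] False that by (auto elim!: eventually_mono simp: f_def)
    then show ?thesis by (simp add: isCont_cong)
  qed
  have hit [measurable]: "Measurable.pred M (\<lambda>\<omega>. \<exists>v\<in>{p..q}. W v \<omega> > \<beta> n)" for n
    using hit_past[OF p0(1) p(2)] sets_past_subset by (auto simp: pred_def)
  have hit' [measurable]: "Measurable.pred M (\<lambda>\<omega>. \<exists>v\<in>{p..q}. W v \<omega> \<ge> b)"
  proof (rule measurable_cong[THEN iffD2])
    fix \<omega> assume "\<omega> \<in> space M"
    have "eventually (\<lambda>n. (\<exists>v\<in>{p..q}. W v \<omega> > \<beta> n) \<longleftrightarrow> (\<exists>v\<in>{p..q}. W v \<omega> \<ge> b)) sequentially"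
      by (rule eventually_hit) (use p0 p \<open>\<omega> \<in> space M\<close> \<beta>lim \<beta>b in auto)
    from eventually_subst[OF this] have "eventually (\<lambda>n. \<exists>v\<in>{p..q}. W v \<omega> > \<beta> n) sequentially \<longleftrightarrow> (\<exists>v\<in>{p..q}. W v \<omega> \<ge> b)"
      by simp
    then show "(\<exists>v\<in>{p..q}. W v \<omega> \<ge> b) \<longleftrightarrow> (\<exists>N. \<forall>n. N \<le> n \<longrightarrow> (\<exists>v\<in>{p..q}. W v \<omega> > \<beta> n))"
      unfolding eventually_sequentially by blast
  qed measurable
  let ?L = "\<lambda>n \<omega>. indicator (En n) \<omega> * (of_bool (\<exists>v\<in>{p..q}. W v \<omega> > \<beta> n) * f n (W q \<omega>))"
  let ?R = "\<lambda>n \<omega>. indicator (En n) \<omega> * (of_bool (\<exists>v\<in>{p..q}. W v \<omega> > \<beta> n) * f n (2 * \<beta> n - W q \<omega>))"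
  \<comment> \<open>\<open>?g\<close> counts the paths that start and end below \<open>b\<close> but
    reach it in between; \<open>?h\<close> counts their mirror images, for which ending above
    \<open>b\<close> already entails the passage.\<close>
  let ?g = "\<lambda>\<omega>. of_bool (\<omega> \<in> E \<and> W p \<omega> < b \<and> W q \<omega> < b \<and> (\<exists>v\<in>{p..q}. W v \<omega> \<ge> b)) * \<psi> (W q \<omega>)"
  let ?h = "\<lambda>\<omega>. of_bool (\<omega> \<in> E \<and> W p \<omega> < b \<and> W q \<omega> > b) * \<psi> (2 * b - W q \<omega>)"
  have LR: "integral\<^sup>L M (?L n) = integral\<^sup>L M (?R n)" for n
  proof (rule reflection[OF p0(1) p(2) En _ fB])
    show "AE \<omega> in M. isCont (f n) (2 * \<beta> n - W q \<omega>)"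
      using W_neq[OF p0(3), of "\<beta> n"] by eventually_elim (rule fcont, simp)
  qed (auto simp: En_def)
  have ev: "eventually (\<lambda>n. (x \<le> \<beta> n) = (x < b) \<and> (x < \<beta> n) = (x < b)) sequentially" for x
  proof (cases "x < b")
    case True from order_tendstoD(1)[OF \<beta>lim this] show ?thesis by eventually_elim (use True in auto)
  next
    case False then show ?thesis using \<beta>b by (intro always_eventually) (metis less_le_not_le less_le_trans order.trans not_less)
  qed
  have "(\<lambda>n. integral\<^sup>L M (?L n)) \<longlonglongrightarrow> integral\<^sup>L M ?g"
  proof (rule integral_dominated_convergence[where w="\<lambda>_. B"])
    show "AE \<omega> in M. (\<lambda>n. ?L n \<omega>) \<longlonglongrightarrow> ?g \<omega>"
    proof (rule AE_I2)
      fix \<omega> assume w: "\<omega> \<in> space M"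
      have "eventually (\<lambda>n. (\<exists>v\<in>{p..q}. W v \<omega> > \<beta> n) \<longleftrightarrow> (\<exists>v\<in>{p..q}. W v \<omega> \<ge> b)) sequentially"
        by (rule eventually_hit) (use p0 p w \<beta>lim \<beta>b in auto)
      then have "eventually (\<lambda>n. ?g \<omega> = ?L n \<omega>) sequentially"
        using ev[of "W p \<omega>"] ev[of "W q \<omega>"]
        by eventually_elim (use w in \<open>simp add: En_def f_def indicator_def, blast\<close>)
      then show "(\<lambda>n. ?L n \<omega>) \<longlonglongrightarrow> ?g \<omega>" by (rule Lim_transform_eventually[OF tendsto_const])
    qed
    show "AE \<omega> in M. norm (?L n \<omega>) \<le> B" for n using fB B0 by (intro AE_I2) (simp add: indicator_def)
  qed measurable
  moreover have "(\<lambda>n. integral\<^sup>L M (?R n)) \<longlonglongrightarrow> integral\<^sup>L M ?h"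
  proof (rule integral_dominated_convergence[where w="\<lambda>_. B"])
    show "AE \<omega> in M. (\<lambda>n. ?R n \<omega>) \<longlonglongrightarrow> ?h \<omega>"
      using W_neq[OF p0(3), of b] AE_space
    proof eventually_elim
      case (elim \<omega>)
      show ?case
      proof (cases "W q \<omega> < b")
        case True
        from order_tendstoD(1)[OF \<beta>lim this] have "eventually (\<lambda>n. ?h \<omega> = ?R n \<omega>) sequentially"
          by eventually_elim (use True in \<open>auto simp: f_def\<close>)
        then show ?thesis by (rule Lim_transform_eventually[OF tendsto_const])
      next
        case False
        then have q: "W q \<omega> > b" using elim by auto
        have "(\<lambda>n. \<psi> (2 * \<beta> n - W q \<omega>)) \<longlonglongrightarrow> \<psi> (2 * b - W q \<omega>)"
          using q by (intro isCont_tendsto_compose[OF cont] tendsto_intros \<beta>lim) simp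
        then have "(\<lambda>n. of_bool (\<omega> \<in> E \<and> W p \<omega> < b \<and> W q \<omega> > b) * \<psi> (2 * \<beta> n - W q \<omega>)) \<longlonglongrightarrow> ?h \<omega>"
          by (intro tendsto_mult tendsto_const)
        moreover have "eventually (\<lambda>n. of_bool (\<omega> \<in> E \<and> W p \<omega> < b \<and> W q \<omega> > b) * \<psi> (2 * \<beta> n - W q \<omega>) = ?R n \<omega>) sequentially"
          using ev[of "W p \<omega>"]
        proof eventually_elim
          case (elim n)
          have "W q \<omega> > \<beta> n" using q \<beta>b[of n] by simp
          moreover have "\<exists>v\<in>{p..q}. W v \<omega> > \<beta> n" using p(2) \<open>W q \<omega> > \<beta> n\<close> by (intro bexI[of _ q]) auto
          ultimately show ?case using elim q \<open>\<omega> \<in> space M\<close> by (simp add: En_def f_def indicator_def)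
        qed
        ultimately show ?thesis by (rule Lim_transform_eventually)
      qed
    qed
    show "AE \<omega> in M. norm (?R n \<omega>) \<le> B" for n using fB B0 by (intro AE_I2) (simp add: indicator_def)
  qed measurable
  ultimately have gh: "integral\<^sup>L M ?g = integral\<^sup>L M ?h" unfolding LR by (rule LIMSEQ_unique)
  let ?E = "E \<inter> {\<omega>\<in>space M. W p \<omega> < b}"
  have E': "?E \<in> sets (past p)"
  proof -
    note [measurable] = W_past[OF p0(1) order_refl]
    have "{\<omega>\<in>space (past p). W p \<omega> < b} \<in> sets (past p)" by measurable
    then show ?thesis using E by auto
  qed
  let ?f = "\<lambda>y. \<psi> y * indicator {..<b} y"
  have ib: "integrable M F" if "F \<in> borel_measurable M" "\<And>\<omega>. \<bar>F \<omega>\<bar> \<le> B" for F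
    using that by (intro integrable_const_bound[where B=B]) auto
  have [measurable]: "?E \<in> sets M" using E' sets_past_subset by blast
  have fb: "\<bar>?f y\<bar> \<le> B" for y using B B0 by (simp add: indicator_def)
  have "(\<integral>\<omega>. indicator E \<omega> * (of_bool (below (\<lambda>t. W t \<omega>) b p q) * \<psi> (W q \<omega>)) \<partial>M)
     = (\<integral>\<omega>. indicator ?E \<omega> * ?f (W q \<omega>) - ?g \<omega> \<partial>M)"
  proof (rule integral_cong_AE)
    show "AE \<omega> in M. indicator E \<omega> * (of_bool (below (\<lambda>t. W t \<omega>) b p q) * \<psi> (W q \<omega>)) = indicator ?E \<omega> * ?f (W q \<omega>) - ?g \<omega>"
      using W_neq[OF p(1), of b] W_neq[OF p0(3), of b] AE_space
      by eventually_elim (subst below_iff_AE, use p0 p in \<open>auto simp: indicator_def\<close>)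
    show "(\<lambda>\<omega>. indicator E \<omega> * (of_bool (below (\<lambda>t. W t \<omega>) b p q) * \<psi> (W q \<omega>))) \<in> borel_measurable M"
      using below_pred[OF p0(1)] by measurable
  qed measurable
  also have "\<dots> = (\<integral>\<omega>. indicator ?E \<omega> * ?f (W q \<omega>) \<partial>M) - integral\<^sup>L M ?g"
    using fb B B0 by (intro Bochner_Integration.integral_diff ib) (auto simp: indicator_def)
  also have "(\<integral>\<omega>. indicator ?E \<omega> * ?f (W q \<omega>) \<partial>M) = (\<integral>\<omega>. indicator ?E \<omega> * heat (q - p) ?f (W p \<omega>) \<partial>M)"
    by (rule markov[OF p0(1) p(2) E' _ fb]) simp
  also have "integral\<^sup>L M ?g = (\<integral>\<omega>. indicator ?E \<omega> * ?f (2 * b - W q \<omega>) \<partial>M)"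
    unfolding gh by (intro Bochner_Integration.integral_cong) (auto simp: indicator_def)
  also have "\<dots> = (\<integral>\<omega>. indicator ?E \<omega> * heat (q - p) (\<lambda>y. ?f (2 * b - y)) (W p \<omega>) \<partial>M)"
    by (rule markov[OF p0(1) p(2) E' _ fb]) simp
  also have "(\<integral>\<omega>. indicator ?E \<omega> * heat (q - p) ?f (W p \<omega>) \<partial>M) - \<dots> =
     (\<integral>\<omega>. indicator ?E \<omega> * heat (q - p) ?f (W p \<omega>) - indicator ?E \<omega> * heat (q - p) (\<lambda>y. ?f (2 * b - y)) (W p \<omega>) \<partial>M)"
  proof (rule Bochner_Integration.integral_diff[symmetric])
    show "integrable M (\<lambda>\<omega>. indicator ?E \<omega> * heat (q - p) ?f (W p \<omega>))"
      using heat_bound[where t="q - p", OF _ fb] p B0 by (intro ib) (auto simp: indicator_def)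
    show "integrable M (\<lambda>\<omega>. indicator ?E \<omega> * heat (q - p) (\<lambda>y. ?f (2 * b - y)) (W p \<omega>))"
      using heat_bound[where t="q - p", OF _ fb] p B0 unfolding heat_reflect[where f="?f"]
      by (intro ib) (auto simp: indicator_def)
  qed
  also have "\<dots> = (\<integral>\<omega>. indicator E \<omega> * killed b (q - p) \<psi> (W p \<omega>) \<partial>M)"
    unfolding heat_reflect[where f="?f"] by (intro Bochner_Integration.integral_cong) (auto simp: indicator_def killed_def)
  finally show ?thesis .
qed

section \<open>Null events of the path\<close>

lemma prob_below:
  assumes p: "0 < p" "p < q"
  shows "prob {\<omega>\<in>space M. below (\<lambda>t. W t \<omega>) b p q} = (\<integral>\<omega>. killed b (q - p) (\<lambda>_. 1) (W p \<omega>) \<partial>M)"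
proof -
  have "(\<integral>\<omega>. indicator (space M) \<omega> * (of_bool (below (\<lambda>t. W t \<omega>) b p q) * 1) \<partial>M)
     = (\<integral>\<omega>. indicator (space M) \<omega> * killed b (q - p) (\<lambda>_. 1) (W p \<omega>) \<partial>M)"
    by (rule killed_markov[OF p, where B=1]) (use sets.top[of "past p"] in auto)
  moreover have "(\<integral>\<omega>. indicator (space M) \<omega> * killed b (q - p) (\<lambda>_. 1) (W p \<omega>) \<partial>M) = (\<integral>\<omega>. killed b (q - p) (\<lambda>_. 1) (W p \<omega>) \<partial>M)"
    by (intro Bochner_Integration.integral_cong) auto
  moreover have "(\<integral>\<omega>. indicator (space M) \<omega> * (of_bool (below (\<lambda>t. W t \<omega>) b p q) * 1) \<partial>M) = (\<integral>\<omega>. indicator {\<omega>\<in>space M. below (\<lambda>t. W t \<omega>) b p q} \<omega> \<partial>M :: real)"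
    by (intro Bochner_Integration.integral_cong) (auto simp: indicator_def)
  moreover have "(\<integral>\<omega>. indicator {\<omega>\<in>space M. below (\<lambda>t. W t \<omega>) b p q} \<omega> \<partial>M) = prob {\<omega>\<in>space M. below (\<lambda>t. W t \<omega>) b p q}"
    by (subst Bochner_Integration.integral_indicator) (auto intro: arg_cong[where f=prob])
  ultimately show ?thesis by simp
qed

text \<open>For small \<open>p\<close> the event is contained in survival over (p, p + 3/4), whose
  probability is the mean of \<open>killed\<close> at \<open>W p\<close>. As \<open>p\<close> tends
  to 0 so does \<open>W p\<close>, and 0 is not below \<open>b\<close>;
  \<open>killed_one_bound\<close> then sends the mean to 0. This includes \<open>b = 0\<close>,
  where the path starts at the level.\<close>

lemma AE_not_below_start:
  assumes b: "b \<le> 0"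
  shows "AE \<omega> in M. \<not> below (\<lambda>t. W t \<omega>) b 0 1"
proof -
  let ?k = "killed b (3/4) (\<lambda>_. 1)"
  let ?p = "\<lambda>n::nat. 1 / (real n + 4)"
  have [measurable]: "Measurable.pred M (\<lambda>\<omega>. below (\<lambda>t. W t \<omega>) b 0 1)" by (rule below_pred) simp
  have pos: "0 < ?p n" "?p n \<le> 1/4" for n by (auto simp: field_simps)
  have le: "prob {\<omega>\<in>space M. below (\<lambda>t. W t \<omega>) b 0 1} \<le> (\<integral>\<omega>. ?k (W (?p n) \<omega>) \<partial>M)" for n
  proof -
    have [measurable]: "Measurable.pred M (\<lambda>\<omega>. below (\<lambda>t. W t \<omega>) b (?p n) (?p n + 3/4))" by (rule below_pred) simp
    have "prob {\<omega>\<in>space M. below (\<lambda>t. W t \<omega>) b 0 1} \<le> prob {\<omega>\<in>space M. below (\<lambda>t. W t \<omega>) b (?p n) (?p n + 3/4)}"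
    proof (rule finite_measure_mono)
      have "0 \<le> ?p n" "?p n + 3/4 \<le> 1" using pos[of n] by linarith+
      then show "{\<omega>\<in>space M. below (\<lambda>t. W t \<omega>) b 0 1} \<subseteq> {\<omega>\<in>space M. below (\<lambda>t. W t \<omega>) b (?p n) (?p n + 3/4)}"
        using below_mono by blast
    qed measurable
    then show ?thesis using prob_below[OF pos(1)[of n], of "?p n + 3/4" b] by simp
  qed
  have p0: "?p \<longlonglongrightarrow> 0" by real_asymp
  have "(\<lambda>n. \<integral>\<omega>. ?k (W (?p n) \<omega>) \<partial>M) \<longlonglongrightarrow> (\<integral>\<omega>. 0 \<partial>M)"
  proof (rule integral_dominated_convergence[where w="\<lambda>_. 2"])
    show "AE \<omega> in M. (\<lambda>n. ?k (W (?p n) \<omega>)) \<longlonglongrightarrow> 0"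
    proof (rule AE_I2)
      fix \<omega> assume w: "\<omega> \<in> space M"
      have "(\<lambda>n. W (?p n) \<omega>) \<longlonglongrightarrow> W 0 \<omega>"
        by (rule continuous_on_tendsto_compose[OF W_continuous[OF w] p0]) (auto intro!: always_eventually)
      then have W0: "(\<lambda>n. W (?p n) \<omega>) \<longlonglongrightarrow> 0" using W_zero[OF w] by simp
      have "(\<lambda>n. 6 * max 0 (b - W (?p n) \<omega>) * exp ((b - W (?p n) \<omega>)\<^sup>2 / 2)) \<longlonglongrightarrow> 6 * max 0 (b - 0) * exp ((b - 0)\<^sup>2 / 2)"
        by (intro tendsto_intros W0) auto
      then have "(\<lambda>n. 6 * max 0 (b - W (?p n) \<omega>) * exp ((b - W (?p n) \<omega>)\<^sup>2 / 2)) \<longlonglongrightarrow> 0" using b by simp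
      then show "(\<lambda>n. ?k (W (?p n) \<omega>)) \<longlonglongrightarrow> 0"
        by (rule Lim_null_comparison[rotated]) (use killed_one_bound in \<open>auto intro!: always_eventually\<close>)
    qed
    show "(\<lambda>\<omega>. ?k (W (?p n) \<omega>)) \<in> borel_measurable M" for n
    proof -
      have [measurable]: "W (?p n) \<in> borel_measurable M" by (rule W_measurable) simp
      show ?thesis by measurable
    qed
    show "AE \<omega> in M. norm (?k (W (?p n) \<omega>)) \<le> 2" for n
      using killed_bound[of "\<lambda>_. 1" 1 "3/4" b] by (intro AE_I2) auto
  qed auto
  then have "prob {\<omega>\<in>space M. below (\<lambda>t. W t \<omega>) b 0 1} \<le> (\<integral>\<omega>. 0 \<partial>M)"
    by (rule LIMSEQ_le_const) (use le in auto)
  then have "prob {\<omega>\<in>space M. below (\<lambda>t. W t \<omega>) b 0 1} = 0" by (simp add: antisym)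
  then show ?thesis by (subst AE_iff_measurable[OF _ refl]) (auto simp: emeasure_eq_measure)
qed

text \<open>The survival probability is continuous from above in the level. So the event that the
  path stays below every \<open>c > b\<close> but not below \<open>b\<close>, which means touching
  \<open>b\<close> without crossing it, has probability 0.\<close>

lemma AE_not_touching:
  assumes p: "0 < p" "p < q"
  shows "AE \<omega> in M. (\<forall>c>b. below (\<lambda>t. W t \<omega>) c p q) \<longrightarrow> below (\<lambda>t. W t \<omega>) b p q"
proof -
  let ?c = "\<lambda>n::nat. b + 1 / (real n + 1)"
  let ?A = "\<lambda>c. {\<omega>\<in>space M. below (\<lambda>t. W t \<omega>) c p q}"
  have [measurable]: "Measurable.pred M (\<lambda>\<omega>. below (\<lambda>t. W t \<omega>) c p q)" for c using p by (intro below_pred) simp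
  have [measurable]: "W p \<in> borel_measurable M" using p by (intro W_measurable) simp
  have c0: "?c \<longlonglongrightarrow> b" by real_asymp
  have "(\<lambda>n. \<integral>\<omega>. killed (?c n) (q - p) (\<lambda>_. 1) (W p \<omega>) \<partial>M) \<longlonglongrightarrow> (\<integral>\<omega>. killed b (q - p) (\<lambda>_. 1) (W p \<omega>) \<partial>M)"
  proof (rule integral_dominated_convergence[where w="\<lambda>_. 2"])
    show "AE \<omega> in M. (\<lambda>n. killed (?c n) (q - p) (\<lambda>_. 1) (W p \<omega>)) \<longlonglongrightarrow> killed b (q - p) (\<lambda>_. 1) (W p \<omega>)"
      using W_neq[OF p(1), of b]
    proof eventually_elim
      case (elim \<omega>)
      let ?x = "W p \<omega>"
      show ?case
      proof (cases "?x < b")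
        case True
        have lt: "?x < ?c n" for n
        proof -
          have "0 < 1 / (real n + 1)" by simp
          then show ?thesis using True by linarith
        qed
        have "(\<lambda>n. normal_cdf (q - p) (?c n - ?x) - normal_cdf (q - p) (?x - ?c n)) \<longlonglongrightarrow> normal_cdf (q - p) (b - ?x) - normal_cdf (q - p) (?x - b)"
          using p by (intro tendsto_diff isCont_tendsto_compose[OF isCont_normal_cdf] tendsto_const c0) auto
        then show ?thesis using True lt by (simp add: killed_one)
      next
        case False
        then have "b < ?x" using elim by simp
        from order_tendstoD(2)[OF c0 this]
        have "eventually (\<lambda>n. 0 = killed (?c n) (q - p) (\<lambda>_. 1) ?x) sequentially"
          by eventually_elim (simp add: killed_def)
        then have "(\<lambda>n. killed (?c n) (q - p) (\<lambda>_. 1) ?x) \<longlonglongrightarrow> 0" by (rule Lim_transform_eventually[OF tendsto_const])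
        moreover have "killed b (q - p) (\<lambda>_. 1) ?x = 0" using False by (simp add: killed_def)
        ultimately show ?thesis by (simp only:)
      qed
    qed
    show "AE \<omega> in M. norm (killed (?c n) (q - p) (\<lambda>_. 1) (W p \<omega>)) \<le> 2" for n
      using killed_bound[of "\<lambda>_. 1" 1 "q - p" "?c n"] p by (intro AE_I2) auto
  qed auto
  then have lim: "(\<lambda>n. prob (?A (?c n)) - prob (?A b)) \<longlonglongrightarrow> prob (?A b) - prob (?A b)"
    unfolding prob_below[OF p] by (intro tendsto_diff tendsto_const)
  let ?N = "(\<Inter>n. ?A (?c n)) - ?A b"
  have N [measurable]: "?N \<in> sets M" by measurable
  have "prob ?N \<le> prob (?A (?c n)) - prob (?A b)" for n
  proof -
    have "?A b \<subseteq> ?A (?c n)" by (auto simp: below_def intro: less_le_trans)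
    then have "prob (?A (?c n) - ?A b) = prob (?A (?c n)) - prob (?A b)" by (intro finite_measure_Diff) auto
    moreover have "prob ?N \<le> prob (?A (?c n) - ?A b)" by (intro finite_measure_mono) auto
    ultimately show ?thesis by simp
  qed
  then have "prob ?N \<le> 0" using LIMSEQ_le_const[OF lim] by auto
  then have "prob ?N = 0" by (simp add: antisym)
  then have "AE \<omega> in M. \<omega> \<notin> ?N" by (intro AE_not_in) (auto simp: null_sets_def emeasure_eq_measure)
  then show ?thesis using AE_space by eventually_elim auto
qed

text \<open>Two unit excursions that meet at \<open>g + 1\<close>, with a value at least
  \<open>b\<close> there, make the path touch \<open>b\<close> from below inside an interval with
  rational endpoints around \<open>g + 1\<close>. There are countably many such intervals.\<close>

lemma AE_no_adjacent:
  "AE \<omega> in M. \<forall>g\<ge>0. below (\<lambda>t. W t \<omega>) b g (g + 1) \<longrightarrow> W (g + 1) \<omega> \<ge> b \<longrightarrow> below (\<lambda>t. W t \<omega>) b (g + 1) (g + 2) \<longrightarrow> False"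
proof -
  have "AE \<omega> in M. \<forall>p\<in>\<rat>. \<forall>q\<in>\<rat>. 0 < p \<and> p < q \<longrightarrow> ((\<forall>c>b. below (\<lambda>t. W t \<omega>) c p q) \<longrightarrow> below (\<lambda>t. W t \<omega>) b p q)"
    using AE_not_touching by (intro AE_ball_countable' countable_rat) (auto intro!: AE_impI)
  then show ?thesis using AE_space
  proof eventually_elim
    case (elim \<omega>)
    show ?case
    proof (intro allI impI)
      fix g :: real assume g: "0 \<le> g" and b1: "below (\<lambda>t. W t \<omega>) b g (g + 1)" and t: "W (g + 1) \<omega> \<ge> b"
        and b2: "below (\<lambda>t. W t \<omega>) b (g + 1) (g + 2)"
      obtain p where p: "p \<in> \<rat>" "g < p" "p < g + 1" using Rats_dense_in_real[of g "g + 1"] by auto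
      obtain q where q: "q \<in> \<rat>" "g + 1 < q" "q < g + 2" using Rats_dense_in_real[of "g + 1" "g + 2"] by auto
      have "W (g + 1) \<omega> \<le> b"
        using below_endpoints(2)[OF W_continuous_Icc[OF elim(2) g] _ b1] by simp
      then have "W v \<omega> \<le> b" if "p < v" "v < q" for v
        using that b1 b2 p q by (cases v "g + 1" rule: linorder_cases) (auto simp: below_def intro: less_imp_le)
      then have "\<forall>c>b. below (\<lambda>t. W t \<omega>) c p q" by (auto simp: below_def intro: le_less_trans)
      then have "below (\<lambda>t. W t \<omega>) b p q" using elim(1) p q g by auto
      then show False using t p q by (auto simp: below_def dest!: spec[of _ "g + 1"])
    qed
  qed
qed

end

section \<open>Convolution kernels on the half-line\<close>

lemma FTC_Ioo:
  fixes F f :: "real \<Rightarrow> real"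
  assumes "a < b" and "\<And>x. a < x \<Longrightarrow> x < b \<Longrightarrow> DERIV F x :> f x" and "\<And>x. a < x \<Longrightarrow> x < b \<Longrightarrow> isCont f x"
    and "\<And>x. a < x \<Longrightarrow> x < b \<Longrightarrow> 0 \<le> f x" and "(F \<longlongrightarrow> A) (at_right a)" and "(F \<longlongrightarrow> B) (at_left b)"
  shows "has_bochner_integral lborel (\<lambda>x. indicator {a<..<b} x * f x) (B - A)"
proof -
  have "set_integrable lborel (einterval (ereal a) (ereal b)) f" "(LBINT x=ereal a..ereal b. f x) = B - A"
    by (rule interval_integral_FTC_nonneg[where F=F and A=A and B=B and f=f], use assms in \<open>auto simp: ereal_tendsto_simps1\<close>)+
  then show ?thesis using assms(1)
    by (simp add: has_bochner_integral_iff interval_integral_Ioo set_integrable_def set_lebesgue_integral_def)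
qed

lemma has_bochner_integral_inverse_sqrt:
  assumes "0 < t"
  shows "has_bochner_integral lborel (\<lambda>s. indicator {0<..<t} s * (1 / sqrt s)) (2 * sqrt t)"
proof -
  have "has_bochner_integral lborel (\<lambda>s. indicator {0<..<t} s * (1 / sqrt s)) (2 * sqrt t - 2 * sqrt 0)"
  proof (rule FTC_Ioo[OF assms, where F="\<lambda>s. 2 * sqrt s"])
    fix x :: real assume "0 < x" "x < t"
    then show "DERIV (\<lambda>s. 2 * sqrt s) x :> 1 / sqrt x" "isCont (\<lambda>s. 1 / sqrt s) x"
      by (auto intro!: derivative_eq_intros continuous_intros simp: field_simps)
  qed (use assms in \<open>auto intro!: tendsto_eq_intros\<close>)
  then show ?thesis by simp
qed

lemma has_bochner_integral_inverse_sqrt_reflect: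
  assumes "0 < t"
  shows "has_bochner_integral lborel (\<lambda>s. indicator {0<..<t} s * (1 / sqrt (t - s))) (2 * sqrt t)"
proof -
  have e: "(\<lambda>s. indicator {0<..<t} (t + (-1) * s) * (1 / sqrt (t + (-1) * s))) = (\<lambda>s. indicator {0<..<t} s * (1 / sqrt (t - s)))"
    by (auto simp: fun_eq_iff indicator_def)
  show ?thesis
    using has_bochner_integral_inverse_sqrt[OF assms]
    by (subst (asm) lborel_has_bochner_integral_real_affine_iff[of "-1" _ _ t]) (simp_all only: e, simp_all)
qed

text \<open>One of \<open>s\<close> and \<open>t - s\<close> is at least t / 2, so one of the
  factors is bounded by \<open>sqrt (2 / t)\<close> and the other stands alone.\<close>

lemma inverse_sqrt_mult_le:
  assumes "0 < s" "s < t"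
  shows "1 / sqrt s * (1 / sqrt (t - s)) \<le> sqrt (2 / t) * (1 / sqrt s + 1 / sqrt (t - s))"
proof (cases "s \<le> t / 2")
  case True
  have "1 / sqrt (t - s) \<le> 1 / sqrt (t / 2)" using True assms by (intro divide_left_mono) auto
  also have "\<dots> = sqrt (2 / t)" by (simp add: real_sqrt_divide)
  finally have "1 / sqrt s * (1 / sqrt (t - s)) \<le> 1 / sqrt s * sqrt (2 / t)"
    using assms by (intro mult_left_mono) auto
  also have "\<dots> \<le> (1 / sqrt s + 1 / sqrt (t - s)) * sqrt (2 / t)" using assms by (intro mult_right_mono) auto
  finally show ?thesis by (simp add: mult.commute)
next
  case False
  have "1 / sqrt s \<le> 1 / sqrt (t / 2)" using False assms by (intro divide_left_mono) auto
  also have "\<dots> = sqrt (2 / t)" by (simp add: real_sqrt_divide)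
  finally have "1 / sqrt s * (1 / sqrt (t - s)) \<le> sqrt (2 / t) * (1 / sqrt (t - s))"
    using assms by (intro mult_right_mono) auto
  also have "\<dots> \<le> sqrt (2 / t) * (1 / sqrt s + 1 / sqrt (t - s))" using assms by (intro mult_left_mono) auto
  finally show ?thesis .
qed

text \<open>The class in which the convolution algebra takes place: a singularity at 0 of order at
  most 1 / sqrt t, with a constant that may depend on the time horizon. It is closed under
  \<open>conv\<close> and contains \<open>chi\<close>, \<open>nu\<close>, \<open>g_fun\<close> and,
  for a positive level, \<open>passage\<close>. Values at times that are not positive are left
  free.\<close>

definition kern :: "(real \<Rightarrow> real) \<Rightarrow> bool" where
  "kern f \<longleftrightarrow> f \<in> borel_measurable borel \<and> (\<forall>t>0. 0 \<le> f t) \<and>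
     (\<forall>T. \<exists>C\<ge>0. \<forall>t. 0 < t \<and> t \<le> T \<longrightarrow> f t \<le> C / sqrt t)"

lemma kern_measurable: "kern f \<Longrightarrow> f \<in> borel_measurable borel"
  by (simp add: kern_def)

lemma kern_nonneg: "kern f \<Longrightarrow> 0 < t \<Longrightarrow> 0 \<le> f t"
  by (simp add: kern_def)

lemma kern_bound:
  assumes "kern f"
  obtains C where "0 \<le> C" "\<And>t. 0 < t \<Longrightarrow> t \<le> T \<Longrightarrow> f t \<le> C / sqrt t"
  using assms unfolding kern_def by meson

lemma kern_uniform: "f \<in> borel_measurable borel \<Longrightarrow> (\<And>t. 0 < t \<Longrightarrow> 0 \<le> f t) \<Longrightarrow>
    (\<And>t. 0 < t \<Longrightarrow> f t \<le> C / sqrt t) \<Longrightarrow> 0 \<le> C \<Longrightarrow> kern f"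
  unfolding kern_def by auto

text \<open>Lets a sum over the \<open>n\<close> below \<open>u\<close> be extended to a longer
  range: the added terms are evaluated at times that are not positive.\<close>

lemma conv_nonpos: "t \<le> 0 \<Longrightarrow> conv f g t = 0"
proof -
  assume t: "t \<le> 0"
  have "AE s in lborel. indicator {0..t} s *\<^sub>R (f s * g (t - s)) = 0"
    using AE_lborel_singleton[of 0] by eventually_elim (use t in \<open>auto simp: indicator_def\<close>)
  then show ?thesis unfolding conv_def set_lebesgue_integral_def by (rule integral_eq_zero_AE)
qed

lemma conv_Ioo: "conv f g t = (\<integral>s. indicator {0<..<t} s * (f s * g (t - s)) \<partial>lborel)"
  if [measurable]: "f \<in> borel_measurable borel" "g \<in> borel_measurable borel"
  unfolding conv_def set_lebesgue_integral_def
proof (rule integral_cong_AE)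
  show "AE s in lborel. indicator {0..t} s *\<^sub>R (f s * g (t - s)) = indicator {0<..<t} s * (f s * g (t - s))"
    using AE_lborel_singleton[of 0] AE_lborel_singleton[of t] by eventually_elim (auto simp: indicator_def)
qed measurable

lemma indicator_Ioo: "indicator {a<..<b} x = (if a < x \<and> x < b then 1 else 0)"
  by (simp add: indicator_def)

lemma conv_measurable [measurable]:
  assumes [measurable]: "f \<in> borel_measurable borel" "g \<in> borel_measurable borel"
  shows "conv f g \<in> borel_measurable borel"
  unfolding conv_Ioo[OF assms] indicator_Ioo by measurable

lemma conv_kern_majorant:
  assumes t: "0 < t"
  shows "has_bochner_integral lborel (\<lambda>s. C * sqrt (2 / t) * (indicator {0<..<t} s * (1 / sqrt s) + indicator {0<..<t} s * (1 / sqrt (t - s)))) (C * 4 * sqrt 2)"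
proof -
  have "has_bochner_integral lborel (\<lambda>s. C * sqrt (2 / t) * (indicator {0<..<t} s * (1 / sqrt s) + indicator {0<..<t} s * (1 / sqrt (t - s)))) (C * sqrt (2 / t) * (2 * sqrt t + 2 * sqrt t))"
    by (intro has_bochner_integral_mult_right has_bochner_integral_add has_bochner_integral_inverse_sqrt has_bochner_integral_inverse_sqrt_reflect t)
  moreover have "C * sqrt (2 / t) * (2 * sqrt t + 2 * sqrt t) = C * 4 * sqrt 2"
    using t by (simp add: real_sqrt_divide)
  ultimately show ?thesis by (simp only:)
qed

lemma conv_integrand_le:
  assumes s: "\<And>s. 0 < s \<Longrightarrow> s < t \<Longrightarrow> \<bar>f s\<bar> \<le> C1 / sqrt s" and g: "\<And>s. 0 < s \<Longrightarrow> s < t \<Longrightarrow> \<bar>g s\<bar> \<le> C2 / sqrt s" and C: "0 \<le> C1" "0 \<le> C2"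
  shows "\<bar>indicator {0<..<t} s * (f s * g (t - s))\<bar>
     \<le> (C1 * C2) * sqrt (2 / t) * (indicator {0<..<t} s * (1 / sqrt s) + indicator {0<..<t} s * (1 / sqrt (t - s)))"
proof (cases "0 < s \<and> s < t")
  case True
  have "\<bar>f s * g (t - s)\<bar> \<le> (C1 / sqrt s) * (C2 / sqrt (t - s))"
    unfolding abs_mult using True C by (intro mult_mono s g) auto
  also have "\<dots> = (C1 * C2) * (1 / sqrt s * (1 / sqrt (t - s)))" by simp
  also have "\<dots> \<le> (C1 * C2) * (sqrt (2 / t) * (1 / sqrt s + 1 / sqrt (t - s)))"
    using True C by (intro mult_left_mono inverse_sqrt_mult_le) auto
  finally show ?thesis using True by (simp add: mult.assoc)
qed (auto simp: indicator_def)

text \<open>Two singularities of order 1 / sqrt t convolve to a bounded function: the factor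
  \<open>sqrt (2 / t)\<close> of the majorant cancels the sqrt t of its integral, leaving
  \<open>4 * sqrt 2\<close>.\<close>

lemma conv_bound:
  assumes [measurable]: "f \<in> borel_measurable borel" "g \<in> borel_measurable borel" and t: "0 < t"
    and b: "\<And>s. 0 < s \<Longrightarrow> s < t \<Longrightarrow> \<bar>f s\<bar> \<le> C1 / sqrt s" "\<And>s. 0 < s \<Longrightarrow> s < t \<Longrightarrow> \<bar>g s\<bar> \<le> C2 / sqrt s" "0 \<le> C1" "0 \<le> C2"
  shows "integrable lborel (\<lambda>s. indicator {0<..<t} s * (f s * g (t - s)))"
    and "\<bar>conv f g t\<bar> \<le> C1 * C2 * 4 * sqrt 2"
proof -
  note w = conv_kern_majorant[OF t, of "C1 * C2"]
  show "integrable lborel (\<lambda>s. indicator {0<..<t} s * (f s * g (t - s)))"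
    by (rule abs_integral_le(1)[OF _ integrable.intros[OF w] conv_integrand_le[OF b]]) measurable
  have "\<bar>conv f g t\<bar> \<le> (\<integral>s. (C1 * C2) * sqrt (2 / t) * (indicator {0<..<t} s * (1 / sqrt s) + indicator {0<..<t} s * (1 / sqrt (t - s))) \<partial>lborel)"
    unfolding conv_Ioo[OF assms(1,2)]
    by (rule abs_integral_le(2)[OF _ integrable.intros[OF w] conv_integrand_le[OF b]]) measurable
  then show "\<bar>conv f g t\<bar> \<le> C1 * C2 * 4 * sqrt 2"
    unfolding has_bochner_integral_integral_eq[OF w] .
qed

lemma kern_abs_bound:
  assumes "kern f"
  obtains C where "0 \<le> C" "\<And>t. 0 < t \<Longrightarrow> t < T \<Longrightarrow> \<bar>f t\<bar> \<le> C / sqrt t"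
proof -
  obtain C where C: "0 \<le> C" "\<And>t. 0 < t \<Longrightarrow> t \<le> T \<Longrightarrow> f t \<le> C / sqrt t" using kern_bound[OF assms] by blast
  then show ?thesis using kern_nonneg[OF assms] that[of C] by auto
qed

lemma kern_conv_bounded:
  assumes f: "kern f" and g: "kern g"
  shows "\<exists>C\<ge>0. \<forall>t. 0 < t \<and> t \<le> T \<longrightarrow> \<bar>conv f g t\<bar> \<le> C"
proof -
  obtain C1 where C1: "0 \<le> C1" "\<And>t. 0 < t \<Longrightarrow> t < T \<Longrightarrow> \<bar>f t\<bar> \<le> C1 / sqrt t" using kern_abs_bound[OF f] by blast
  obtain C2 where C2: "0 \<le> C2" "\<And>t. 0 < t \<Longrightarrow> t < T \<Longrightarrow> \<bar>g t\<bar> \<le> C2 / sqrt t" using kern_abs_bound[OF g] by blast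
  have "\<bar>conv f g t\<bar> \<le> C1 * C2 * 4 * sqrt 2" if "0 < t" "t \<le> T" for t
    using that C1 C2 by (intro conv_bound kern_measurable f g) auto
  moreover have "0 \<le> C1 * C2 * 4 * sqrt 2" using C1 C2 by simp
  ultimately show ?thesis by blast
qed

lemma kern_conv_integrable:
  assumes f: "kern f" and g: "kern g" and t: "0 < t"
  shows "integrable lborel (\<lambda>s. indicator {0<..<t} s * (f s * g (t - s)))"
proof -
  obtain C1 where C1: "0 \<le> C1" "\<And>s. 0 < s \<Longrightarrow> s < t \<Longrightarrow> \<bar>f s\<bar> \<le> C1 / sqrt s" using kern_abs_bound[OF f] by blast
  obtain C2 where C2: "0 \<le> C2" "\<And>s. 0 < s \<Longrightarrow> s < t \<Longrightarrow> \<bar>g s\<bar> \<le> C2 / sqrt s" using kern_abs_bound[OF g] by blast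
  show ?thesis by (rule conv_bound(1)[OF kern_measurable[OF f] kern_measurable[OF g] t C1(2) C2(2) C1(1) C2(1)])
qed

lemma conv_nonneg:
  assumes f: "kern f" and g: "kern g"
  shows "0 \<le> conv f g t"
  unfolding conv_Ioo[OF kern_measurable[OF f] kern_measurable[OF g]]
  using kern_nonneg[OF f] kern_nonneg[OF g] by (intro integral_nonneg_AE AE_I2) (auto simp: indicator_def)

lemma kern_conv:
  assumes f: "kern f" and g: "kern g"
  shows "kern (conv f g)"
  unfolding kern_def
proof (intro conjI allI impI)
  show "conv f g \<in> borel_measurable borel" using f g by (intro conv_measurable kern_measurable)
  show "0 \<le> conv f g t" for t by (rule conv_nonneg[OF f g])
  fix T
  obtain C where C: "0 \<le> C" "\<And>t. 0 < t \<Longrightarrow> t \<le> T \<Longrightarrow> \<bar>conv f g t\<bar> \<le> C" using kern_conv_bounded[OF f g, of T] by blast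
  have "conv f g t \<le> C * sqrt \<bar>T\<bar> / sqrt t" if "0 < t" "t \<le> T" for t
  proof -
    have "conv f g t \<le> C" using C(2)[OF that] by simp
    moreover have "sqrt t \<le> sqrt \<bar>T\<bar>" using that by simp
    then have "C * sqrt t \<le> C * sqrt \<bar>T\<bar>" using C(1) by (rule mult_left_mono)
    then have "C \<le> C * sqrt \<bar>T\<bar> / sqrt t" using that by (simp add: pos_le_divide_eq)
    ultimately show ?thesis by linarith
  qed
  then show "\<exists>C\<ge>0. \<forall>t. 0 < t \<and> t \<le> T \<longrightarrow> conv f g t \<le> C / sqrt t"
    using C(1) by (intro exI[of _ "C * sqrt \<bar>T\<bar>"]) auto
qed

text \<open>Convolution with extended nonnegative values, where Tonelli applies without
  integrability conditions. Commutativity and associativity are proved here and carried back to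
  \<open>conv\<close> by \<open>ennreal_conv\<close>.\<close>

definition convn :: "(real \<Rightarrow> ennreal) \<Rightarrow> (real \<Rightarrow> ennreal) \<Rightarrow> real \<Rightarrow> ennreal" where
  "convn f g t = (\<integral>\<^sup>+s. f s * g (t - s) * indicator {0<..<t} s \<partial>lborel)"

lemma ennreal_conv:
  assumes f: "kern f" and g: "kern g"
  shows "ennreal (conv f g t) = convn (\<lambda>s. ennreal (f s)) (\<lambda>s. ennreal (g s)) t"
proof (cases "0 < t")
  case True
  have nn: "0 \<le> indicator {0<..<t} s * (f s * g (t - s))" for s
    using kern_nonneg[OF f] kern_nonneg[OF g] by (auto simp: indicator_def)
  have "ennreal (conv f g t) = (\<integral>\<^sup>+s. ennreal (indicator {0<..<t} s * (f s * g (t - s))) \<partial>lborel)"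
    unfolding conv_Ioo[OF kern_measurable[OF f] kern_measurable[OF g]]
    by (intro nn_integral_eq_integral[symmetric] kern_conv_integrable f g True AE_I2 nn)
  also have "\<dots> = convn (\<lambda>s. ennreal (f s)) (\<lambda>s. ennreal (g s)) t"
    unfolding convn_def using kern_nonneg[OF f] kern_nonneg[OF g]
    by (intro nn_integral_cong) (auto simp: indicator_def ennreal_mult)
  finally show ?thesis .
next
  case False
  then show ?thesis by (simp add: conv_nonpos convn_def)
qed

lemma convn_measurable [measurable]:
  assumes [measurable]: "f \<in> borel_measurable borel" "g \<in> borel_measurable borel"
  shows "convn f g \<in> borel_measurable borel"
  unfolding convn_def indicator_Ioo by measurable

lemma convn_commute:
  assumes [measurable]: "f \<in> borel_measurable borel" "g \<in> borel_measurable borel"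
  shows "convn f g t = convn g f t"
  unfolding convn_def
  by (subst nn_integral_real_affine[where c="-1" and t=t])
    (auto intro!: nn_integral_cong simp: indicator_def mult.commute)

lemma convn_assoc:
  assumes [measurable]: "f \<in> borel_measurable borel" "g \<in> borel_measurable borel" "k \<in> borel_measurable borel"
  shows "convn (convn f g) k t = convn f (convn g k) t"
proof -
  have "convn (convn f g) k t = (\<integral>\<^sup>+s. (\<integral>\<^sup>+r. f r * g (s - r) * k (t - s) * (indicator {0<..<t} s * indicator {0<..<s} r) \<partial>lborel) \<partial>lborel)"
    unfolding convn_def
  proof (rule nn_integral_cong)
    fix s
    have "(\<integral>\<^sup>+r. f r * g (s - r) * indicator {0<..<s} r \<partial>lborel) * (k (t - s) * indicator {0<..<t} s)
      = (\<integral>\<^sup>+r. (f r * g (s - r) * indicator {0<..<s} r) * (k (t - s) * indicator {0<..<t} s) \<partial>lborel)"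
      by (rule nn_integral_multc[symmetric]) measurable
    then show "(\<integral>\<^sup>+r. f r * g (s - r) * indicator {0<..<s} r \<partial>lborel) * k (t - s) * indicator {0<..<t} s =
      (\<integral>\<^sup>+r. f r * g (s - r) * k (t - s) * (indicator {0<..<t} s * indicator {0<..<s} r) \<partial>lborel)"
      by (simp add: mult_ac)
  qed
  also have "\<dots> = (\<integral>\<^sup>+r. (\<integral>\<^sup>+s. f r * g (s - r) * k (t - s) * (indicator {0<..<t} s * indicator {0<..<s} r) \<partial>lborel) \<partial>lborel)"
    unfolding indicator_Ioo by (rule lborel_pair.Fubini') measurable
  also have "\<dots> = convn f (convn g k) t"
    unfolding convn_def
  proof (rule nn_integral_cong)
    fix r
    have m: "(\<lambda>s. f r * g (s - r) * k (t - s) * (indicator {0<..<t} s * indicator {0<..<s} r)) \<in> borel_measurable borel"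
      unfolding indicator_Ioo by measurable
    have "(\<integral>\<^sup>+s. f r * g (s - r) * k (t - s) * (indicator {0<..<t} s * indicator {0<..<s} r) \<partial>lborel)
      = (\<integral>\<^sup>+s. f r * g s * k (t - r - s) * (indicator {0<..<t} (r + s) * indicator {0<..<r + s} r) \<partial>lborel)"
      by (subst nn_integral_real_affine[OF m, where c=1 and t=r]) (simp_all add: diff_diff_eq)
    also have "\<dots> = (\<integral>\<^sup>+s. (f r * indicator {0<..<t} r) * (g s * k (t - r - s) * indicator {0<..<t - r} s) \<partial>lborel)"
      by (intro nn_integral_cong) (auto simp: indicator_def mult.assoc)
    also have "\<dots> = (f r * indicator {0<..<t} r) * (\<integral>\<^sup>+s. g s * k (t - r - s) * indicator {0<..<t - r} s \<partial>lborel)"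
      by (rule nn_integral_cmult) measurable
    finally show "(\<integral>\<^sup>+s. f r * g (s - r) * k (t - s) * (indicator {0<..<t} s * indicator {0<..<s} r) \<partial>lborel) =
      f r * (\<integral>\<^sup>+s. g s * k (t - r - s) * indicator {0<..<t - r} s \<partial>lborel) * indicator {0<..<t} r"
      by (simp add: mult_ac)
  qed
  finally show ?thesis .
qed

lemma conv_commute: "kern f \<Longrightarrow> kern g \<Longrightarrow> conv f g = conv g f"
proof
  fix t assume f: "kern f" and g: "kern g"
  note [measurable] = kern_measurable[OF f] kern_measurable[OF g]
  have "ennreal (conv f g t) = ennreal (conv g f t)"
    unfolding ennreal_conv[OF f g] ennreal_conv[OF g f] by (rule convn_commute) auto
  then show "conv f g t = conv g f t" using conv_nonneg f g by simp
qed

lemma conv_assoc: "kern f \<Longrightarrow> kern g \<Longrightarrow> kern k \<Longrightarrow> conv (conv f g) k = conv f (conv g k)"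
proof
  fix t assume f: "kern f" and g: "kern g" and k: "kern k"
  note [measurable] = kern_measurable[OF f] kern_measurable[OF g] kern_measurable[OF k]
  have "ennreal (conv (conv f g) k t) = ennreal (conv f (conv g k) t)"
    unfolding ennreal_conv[OF kern_conv[OF f g] k] ennreal_conv[OF f kern_conv[OF g k]] ennreal_conv[OF f g] ennreal_conv[OF g k]
    by (rule convn_assoc) auto
  then show "conv (conv f g) k t = conv f (conv g k) t" using conv_nonneg kern_conv f g k by simp
qed

lemma conv_right_commute: "kern f \<Longrightarrow> kern g \<Longrightarrow> kern k \<Longrightarrow> conv (conv f g) k = conv (conv f k) g"
  by (simp add: conv_assoc conv_commute[of g k])

lemma conv_cong: "(\<And>s. 0 < s \<Longrightarrow> f s = f' s) \<Longrightarrow> (\<And>s. 0 < s \<Longrightarrow> g s = g' s) \<Longrightarrow>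
   f \<in> borel_measurable borel \<Longrightarrow> g \<in> borel_measurable borel \<Longrightarrow>
   f' \<in> borel_measurable borel \<Longrightarrow> g' \<in> borel_measurable borel \<Longrightarrow> conv f g = conv f' g'"
  unfolding fun_eq_iff by (auto simp: conv_Ioo indicator_def intro!: Bochner_Integration.integral_cong)

section \<open>The kernels of the statement\<close>

lemma normal_cdf_reflect: "t > 0 \<Longrightarrow> normal_cdf t (- a) = 1 - normal_cdf t a"
proof -
  assume t: "t > 0"
  have i: "integrable lborel (\<lambda>z. of_bool (P z) * gk t z)" if [measurable]: "Measurable.pred borel P" for P
    using t by (intro Bochner_Integration.integrable_bound[OF integrable_gk]) auto
  have "normal_cdf t (- a) = (\<integral>z. of_bool (a < z) * gk t z \<partial>lborel)"
    unfolding normal_cdf_def using lborel_integral_real_affine[of "-1" "\<lambda>z. of_bool (z < - a) * gk t z" 0] by simp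
  moreover have "(\<integral>z. of_bool (a < z) * gk t z \<partial>lborel) + (\<integral>z. of_bool (z < a) * gk t z \<partial>lborel)
     = (\<integral>z. of_bool (a < z) * gk t z + of_bool (z < a) * gk t z \<partial>lborel)"
    by (intro Bochner_Integration.integral_add[symmetric] i) auto
  moreover have "\<dots> = (\<integral>z. gk t z \<partial>lborel)"
  proof (rule integral_cong_AE)
    show "AE z in lborel. of_bool (a < z) * gk t z + of_bool (z < a) * gk t z = gk t z"
      using AE_lborel_singleton[of a] by eventually_elim auto
  qed measurable
  ultimately show ?thesis using t by (simp add: normal_cdf_def)
qed

lemma normal_cdf_zero: "t > 0 \<Longrightarrow> normal_cdf t 0 = 1 / 2"
  using normal_cdf_reflect[of t 0] by simp

lemma normal_cdf_at_top: "t > 0 \<Longrightarrow> (normal_cdf t \<longlongrightarrow> 1) at_top"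
proof -
  assume t: "t > 0"
  have "((\<lambda>a. \<integral>z. of_bool (z < a) * gk t z \<partial>lborel) \<longlongrightarrow> (\<integral>z. gk t z \<partial>lborel)) at_top"
  proof (rule integral_dominated_convergence_at_top[where w="gk t"])
    show "AE z in lborel. ((\<lambda>a. of_bool (z < a) * gk t z) \<longlongrightarrow> gk t z) at_top"
    proof (rule AE_I2)
      fix z :: real
      have "eventually (\<lambda>a. gk t z = of_bool (z < a) * gk t z) at_top"
        using eventually_gt_at_top[of z] by eventually_elim simp
      then show "((\<lambda>a. of_bool (z < a) * gk t z) \<longlongrightarrow> gk t z) at_top"
        by (rule Lim_transform_eventually[OF tendsto_const])
    qed
  qed (use t in \<open>auto intro!: always_eventually\<close>)
  then show ?thesis using t by (simp add: normal_cdf_def[abs_def])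
qed

lemma normal_cdf_at_bot: "t > 0 \<Longrightarrow> (normal_cdf t \<longlongrightarrow> 0) at_bot"
proof -
  assume t: "t > 0"
  have "((\<lambda>a. 1 - normal_cdf t a) \<longlongrightarrow> 1 - 1) at_top"
    by (intro tendsto_diff tendsto_const normal_cdf_at_top t)
  then show ?thesis
    unfolding at_bot_mirror using normal_cdf_reflect[OF t] by (simp add: filterlim_filtermap)
qed

lemma DERIV_normal_cdf:
  assumes t: "t > 0"
  shows "DERIV (normal_cdf t) a :> gk t a"
proof -
  have i: "integrable lborel (\<lambda>z. of_bool (P z) * gk t z)" if [measurable]: "Measurable.pred borel P" for P
    using t by (intro Bochner_Integration.integrable_bound[OF integrable_gk]) auto
  have cont: "continuous_on A (gk t)" for A
    using t unfolding gk_def normal_density_def by (intro continuous_intros) auto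
  have eq: "normal_cdf t u = normal_cdf t (a - 1) + integral {a - 1..u} (gk t)" if "u \<in> {a - 1..a + 1}" for u
  proof -
    have "(\<integral>z. of_bool (z < a - 1) * gk t z \<partial>lborel) + (\<integral>z. of_bool (a - 1 \<le> z \<and> z < u) * gk t z \<partial>lborel)
      = (\<integral>z. of_bool (z < a - 1) * gk t z + of_bool (a - 1 \<le> z \<and> z < u) * gk t z \<partial>lborel)"
      by (intro Bochner_Integration.integral_add[symmetric] i) auto
    also have "\<dots> = normal_cdf t u" unfolding normal_cdf_def
      using that by (intro Bochner_Integration.integral_cong) auto
    also have "(\<integral>z. of_bool (a - 1 \<le> z \<and> z < u) * gk t z \<partial>lborel) = (LBINT z:{a - 1..u}. gk t z)"
      unfolding set_lebesgue_integral_def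
    proof (rule integral_cong_AE)
      show "AE z in lborel. of_bool (a - 1 \<le> z \<and> z < u) * gk t z = indicator {a - 1..u} z *\<^sub>R gk t z"
        using AE_lborel_singleton[of u] by eventually_elim (auto simp: indicator_def)
    qed measurable
    also have "\<dots> = integral {a - 1..u} (gk t)"
      by (intro set_borel_integral_eq_integral borel_integrable_compact[unfolded set_integrable_def[symmetric]] cont)
        (auto simp: set_integrable_def intro!: borel_integrable_compact cont)
    finally show ?thesis by (simp add: normal_cdf_def)
  qed
  have "((\<lambda>u. integral {a - 1..u} (gk t)) has_real_derivative gk t a) (at a within {a - 1..a + 1})"
    by (rule integral_has_real_derivative) (auto intro: cont)
  then have "((\<lambda>u. normal_cdf t (a - 1) + integral {a - 1..u} (gk t)) has_real_derivative gk t a) (at a within {a - 1..a + 1})"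
    by (auto intro!: derivative_eq_intros)
  moreover have "a \<in> {a - 1..a + 1}" by simp
  ultimately have "(normal_cdf t has_real_derivative gk t a) (at a within {a - 1..a + 1})"
    unfolding has_field_derivative_def by (intro has_derivative_transform[OF _ eq])
  then show ?thesis by (simp add: at_within_Icc_at)
qed

section \<open>The Gaussian kernels and the first passage kernel\<close>

lemma chi_nonneg: "0 < t \<Longrightarrow> 0 \<le> chi a t"
  by (simp add: chi_def)

lemma chi_measurable [measurable]:
  assumes [measurable]: "f \<in> borel_measurable M" "g \<in> borel_measurable M"
  shows "(\<lambda>x. chi (f x) (g x)) \<in> borel_measurable M"
  unfolding chi_def by measurable

lemma chi_abs [simp]: "chi \<bar>a\<bar> = chi a"
  by (simp add: chi_def fun_eq_iff)

lemma chi_le: "0 < t \<Longrightarrow> chi a t \<le> (1 / sqrt pi) / sqrt t"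
  using divide_right_mono[of "exp (- a\<^sup>2 / (4 * t))" 1 "sqrt pi * sqrt t"] by (simp add: chi_def real_sqrt_mult)

lemma kern_chi: "kern (chi a)"
  by (rule kern_uniform[where C="1 / sqrt pi"]) (simp_all add: chi_nonneg, rule chi_le[simplified])

text \<open>With time halved, the density of the first passage time to level G.\<close>

definition passage :: "real \<Rightarrow> real \<Rightarrow> real" where
  "passage G s = G / (2 * s) * chi G s"

text \<open>The singularity of order 3/2 at 0 is lowered to order 1/2 by
  \<open>exp (- z) \<le> 1 / z\<close> with \<open>z = G\<^sup>2 / (4 * s)\<close>, which supplies a
  factor \<open>s\<close>.\<close>

lemma kern_passage:
  assumes G: "0 < G"
  shows "kern (passage G)"
proof (rule kern_uniform[where C="2 / G * (1 / sqrt pi)"])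
  show "passage G \<in> borel_measurable borel" unfolding passage_def by measurable
  fix t :: real assume t: "0 < t"
  show "0 \<le> passage G t" using G t by (simp add: passage_def chi_nonneg)
  have "G\<^sup>2 / (4 * t) \<le> exp (G\<^sup>2 / (4 * t))" using exp_ge_add_one_self[of "G\<^sup>2 / (4 * t)"] by linarith
  then have "exp (- (G\<^sup>2 / (4 * t))) \<le> 1 / (G\<^sup>2 / (4 * t))"
    unfolding exp_minus inverse_eq_divide using G t by (intro divide_left_mono) auto
  then have "G / (2 * t) * (1 / sqrt (pi * t) * exp (- (G\<^sup>2 / (4 * t)))) \<le> G / (2 * t) * (1 / sqrt (pi * t) * (1 / (G\<^sup>2 / (4 * t))))"
    using G t by (intro mult_left_mono) auto
  also have "\<dots> = 2 / G * (1 / sqrt pi) / sqrt t"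
    using G t by (simp add: real_sqrt_mult field_simps power2_eq_square)
  finally show "passage G t \<le> 2 / G * (1 / sqrt pi) / sqrt t" by (simp add: passage_def chi_def)
qed (use G in auto)

text \<open>
  With w = sqrt ((t - s) / s), the exponents satisfy G^2 / s + x^2 / (t - s) =
  ((G + x)^2 + (G w - x / w)^2) / t = ((G - x)^2 + (G w + x / w)^2) / t, so the integrand is the average
  of two exact Gaussian differentials.
\<close>

lemma passage_chi_antiderivative:
  assumes G: "0 < G" and x: "0 \<le> x" and s: "0 < s" "s < t"
  defines "w \<equiv> \<lambda>s. sqrt ((t - s) / s)"
  shows "DERIV (\<lambda>s. - (1 / sqrt (pi * t)) * (exp (- (G + x)\<^sup>2 / (4 * t)) * normal_cdf (2 * t) (G * w s - x / w s)
      + exp (- (G - x)\<^sup>2 / (4 * t)) * normal_cdf (2 * t) (G * w s + x / w s))) s :> passage G s * chi x (t - s)"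
proof -
  have t: "0 < t" using s by simp
  have wp: "w s > 0" and w2: "(w s)\<^sup>2 = (t - s) / s" using s by (auto simp: w_def)
  define w' where "w' = inverse (w s) / 2 * (- t / s\<^sup>2)"
  have dq: "DERIV (\<lambda>s. (t - s) / s) s :> - t / s\<^sup>2"
    using s by (auto intro!: derivative_eq_intros simp: field_simps power2_eq_square)
  have dw: "DERIV w s :> w'"
    unfolding w_def w'_def using s by (intro DERIV_chain2[OF DERIV_real_sqrt dq]) auto
  have dv: "DERIV (\<lambda>s. G * w s - x / w s) s :> (G + x / (w s)\<^sup>2) * w'"
    using wp by (auto intro!: derivative_eq_intros dw simp: power2_eq_square field_simps)
  have dv': "DERIV (\<lambda>s. G * w s + x / w s) s :> (G - x / (w s)\<^sup>2) * w'"
    using wp by (auto intro!: derivative_eq_intros dw simp: power2_eq_square field_simps)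
  let ?J = "exp (- (G\<^sup>2 / (4 * s) + x\<^sup>2 / (4 * (t - s))))"
  have iw: "1 + (w s)\<^sup>2 = t / s" "1 + 1 / (w s)\<^sup>2 = t / (t - s)" unfolding w2 using s by (auto simp: field_simps)
  have key: "G\<^sup>2 * (1 + (w s)\<^sup>2) + x\<^sup>2 * (1 + 1 / (w s)\<^sup>2) = 4 * t * (G\<^sup>2 / (4 * s) + x\<^sup>2 / (4 * (t - s)))"
    unfolding iw using s t by (simp add: field_simps)
  have e1: "(G + x)\<^sup>2 + (G * w s - x / w s)\<^sup>2 = G\<^sup>2 * (1 + (w s)\<^sup>2) + x\<^sup>2 * (1 + 1 / (w s)\<^sup>2)"
    using wp by (simp add: power2_eq_square field_simps)
  have e2: "(G - x)\<^sup>2 + (G * w s + x / w s)\<^sup>2 = G\<^sup>2 * (1 + (w s)\<^sup>2) + x\<^sup>2 * (1 + 1 / (w s)\<^sup>2)"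
    using wp by (simp add: power2_eq_square field_simps)
  \<comment> \<open>Both completed squares have the same total exponent, so the two summands share
    one Gaussian factor and differ only in the derivative of the argument.\<close>
  have ex: "exp (- A / (4 * t)) * gk (2 * t) v = ?J / sqrt (4 * pi * t)"
    if "A + v\<^sup>2 = 4 * t * (G\<^sup>2 / (4 * s) + x\<^sup>2 / (4 * (t - s)))" for A v
  proof -
    have "exp (- A / (4 * t)) * gk (2 * t) v = exp (- A / (4 * t) + - v\<^sup>2 / (4 * t)) / sqrt (4 * pi * t)"
      using t by (subst exp_add) (simp add: gk_eq mult_ac)
    also have "- A / (4 * t) + - v\<^sup>2 / (4 * t) = - (A + v\<^sup>2) / (4 * t)" unfolding add_divide_distrib[symmetric] by simp
    also have "\<dots> = - (G\<^sup>2 / (4 * s) + x\<^sup>2 / (4 * (t - s)))" unfolding that using t by simp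
    finally show ?thesis .
  qed
  \<comment> \<open>The contributions of \<open>x\<close> cancel between the two summands, and only
    the multiple of \<open>G\<close> is left.\<close>
  have collect: "- K * (J * (H + X) * v + J * (H - X) * v) = - K * J * (2 * H * v)" for K J H X v :: real
    by (simp add: algebra_simps)
  have "DERIV (\<lambda>s. - (1 / sqrt (pi * t)) * (exp (- (G + x)\<^sup>2 / (4 * t)) * normal_cdf (2 * t) (G * w s - x / w s)
      + exp (- (G - x)\<^sup>2 / (4 * t)) * normal_cdf (2 * t) (G * w s + x / w s))) s :>
      - (1 / sqrt (pi * t)) * (exp (- (G + x)\<^sup>2 / (4 * t)) * (gk (2 * t) (G * w s - x / w s) * ((G + x / (w s)\<^sup>2) * w'))
      + exp (- (G - x)\<^sup>2 / (4 * t)) * (gk (2 * t) (G * w s + x / w s) * ((G - x / (w s)\<^sup>2) * w')))"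
    using t by (intro DERIV_cmult DERIV_add DERIV_chain2[OF DERIV_normal_cdf dv] DERIV_chain2[OF DERIV_normal_cdf dv']) auto
  also have "- (1 / sqrt (pi * t)) * (exp (- (G + x)\<^sup>2 / (4 * t)) * (gk (2 * t) (G * w s - x / w s) * ((G + x / (w s)\<^sup>2) * w'))
      + exp (- (G - x)\<^sup>2 / (4 * t)) * (gk (2 * t) (G * w s + x / w s) * ((G - x / (w s)\<^sup>2) * w')))
    = - (1 / sqrt (pi * t)) * (?J / sqrt (4 * pi * t)) * (2 * G * w')"
    unfolding mult.assoc[symmetric] ex[OF e1[unfolded key]] ex[OF e2[unfolded key]]
    by (subst collect) (simp only: mult.assoc)
  also have "\<dots> = passage G s * chi x (t - s)"
  proof -
    have "sqrt (pi * t) * sqrt (4 * pi * t) = sqrt ((2 * pi * t)\<^sup>2)"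
      unfolding real_sqrt_mult[symmetric] by (simp add: power2_eq_square mult_ac)
    then have "sqrt (pi * t) * sqrt (4 * pi * t) = 2 * pi * t" using t by simp
    then have 1: "- (1 / sqrt (pi * t)) * (?J / sqrt (4 * pi * t)) * (2 * G * w') = - (?J * (2 * G * w')) / (2 * pi * t)"
      by simp
    have sw: "sqrt (t - s) = w s * sqrt s" using s by (simp add: w_def real_sqrt_divide)
    have 2: "passage G s * chi x (t - s) = G / (2 * s) * (?J / (pi * (sqrt s * sqrt (t - s))))"
    proof -
      have g: "A * (1 / (p * q) * e1) * (1 / (p * r) * e2) = A * ((e1 * e2) / ((p * p) * (q * r)))" for A p q r e1 e2 :: real
        by (simp add: mult_ac)
      have "exp (- G\<^sup>2 / (4 * s)) * exp (- x\<^sup>2 / (4 * (t - s))) = ?J"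
        unfolding exp_add[symmetric] by simp
      then show ?thesis unfolding passage_def chi_def real_sqrt_mult g by simp
    qed
    have ss: "sqrt s * (w s * sqrt s) = w s * s" using s by (simp add: mult.left_commute)
    have fin: "- (J * (2 * G * (inverse v / 2 * (- t / s\<^sup>2)))) / (2 * pi * t) = G / (2 * s) * (J / (pi * (v * s)))"
      if "v > 0" for J v
      using s t that by (simp add: divide_simps power2_eq_square)
    show ?thesis unfolding 1 2 unfolding sw w'_def ss by (rule fin[OF wp])
  qed
  finally show ?thesis .
qed

text \<open>A motion that is to reach height G + x must first pass \<open>G\<close>, and restarts
  there. Analytically, the antiderivative is evaluated at its limits: as s tends to 0 both arguments
  of the distribution function tend to infinity; as s tends to t they tend to opposite infinities,
  or to 0 if \<open>x = 0\<close>. For \<open>x > 0\<close> the terms with \<open>G - x\<close>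
  cancel and the one with \<open>G + x\<close> remains; for \<open>x = 0\<close> the two terms
  coincide and half of each remains.\<close>

lemma passage_conv_chi:
  assumes G: "0 < G" and x: "0 \<le> x" and t: "0 < t"
  shows "conv (passage G) (chi x) t = chi (G + x) t"
proof -
  define w where "w s = sqrt ((t - s) / s)" for s
  let ?E = "\<lambda>y. exp (- y\<^sup>2 / (4 * t))" and ?\<Phi> = "normal_cdf (2 * t)"
  define F where "F s = - (1 / sqrt (pi * t)) * (?E (G + x) * ?\<Phi> (G * w s - x / w s) + ?E (G - x) * ?\<Phi> (G * w s + x / w s))" for s
  have t2: "0 < 2 * t" using t by simp
  have "filterlim (\<lambda>s. G * w s - x / w s) at_top (at_right 0)" "filterlim (\<lambda>s. G * w s + x / w s) at_top (at_right 0)"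
    unfolding w_def using G x t by real_asymp+
  then have A: "(F \<longlongrightarrow> - (1 / sqrt (pi * t)) * (?E (G + x) * 1 + ?E (G - x) * 1)) (at_right 0)"
    unfolding F_def by (intro tendsto_mult tendsto_add tendsto_const filterlim_compose[OF normal_cdf_at_top[OF t2]])
  have w0: "filterlim w (at_right 0) (at_left t)"
    unfolding w_def using t by real_asymp
  define L where "L = (if x = 0 then - (1 / sqrt (pi * t)) * (?E (G + x) * (1/2) + ?E (G - x) * (1/2))
      else - (1 / sqrt (pi * t)) * (?E (G + x) * 0 + ?E (G - x) * 1))"
  have B: "(F \<longlongrightarrow> L) (at_left t)"
  proof (cases "x = 0")
    case True
    have "((\<lambda>w. G * w) \<longlongrightarrow> G * 0) (at_right 0)" by (intro tendsto_intros)
    from filterlim_compose[OF this w0] have gw: "((\<lambda>s. G * w s) \<longlongrightarrow> 0) (at_left t)" by simp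
    have "((\<lambda>s. ?\<Phi> (G * w s)) \<longlongrightarrow> 1/2) (at_left t)"
      using isCont_tendsto_compose[OF isCont_normal_cdf[OF t2] gw] normal_cdf_zero[OF t2] by simp
    then have "((\<lambda>s. - (1 / sqrt (pi * t)) * (?E (G + x) * ?\<Phi> (G * w s) + ?E (G - x) * ?\<Phi> (G * w s))) \<longlongrightarrow>
       - (1 / sqrt (pi * t)) * (?E (G + x) * (1/2) + ?E (G - x) * (1/2))) (at_left t)"
      by (intro tendsto_mult tendsto_add tendsto_const)
    then show ?thesis unfolding F_def L_def by (simp only: True div_0 diff_0_right add_0_right if_True refl)
  next
    case False
    then have "x > 0" using x by simp
    then have "filterlim (\<lambda>w. G * w - x / w) at_bot (at_right 0)" "filterlim (\<lambda>w. G * w + x / w) at_top (at_right 0)"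
      using G by real_asymp+
    note this[THEN filterlim_compose, OF w0]
    then have "((\<lambda>s. ?\<Phi> (G * w s - x / w s)) \<longlongrightarrow> 0) (at_left t)" "((\<lambda>s. ?\<Phi> (G * w s + x / w s)) \<longlongrightarrow> 1) (at_left t)"
      using filterlim_compose[OF normal_cdf_at_bot[OF t2]] filterlim_compose[OF normal_cdf_at_top[OF t2]] by blast+
    then show ?thesis unfolding F_def L_def using False by (simp only: if_False) (intro tendsto_intros)
  qed
  have "has_bochner_integral lborel (\<lambda>s. indicator {0<..<t} s * (passage G s * chi x (t - s)))
     (L - (- (1 / sqrt (pi * t)) * (?E (G + x) * 1 + ?E (G - x) * 1)))"
  proof (rule FTC_Ioo[OF t _ _ _ A B])
    fix s assume s: "0 < s" "s < t"
    show "DERIV F s :> passage G s * chi x (t - s)"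
      using passage_chi_antiderivative[OF G x s] unfolding F_def w_def .
    show "isCont (\<lambda>s. passage G s * chi x (t - s)) s"
      unfolding passage_def chi_def using s by (intro continuous_intros) auto
    show "0 \<le> passage G s * chi x (t - s)"
      using s G by (auto simp: passage_def chi_nonneg intro!: mult_nonneg_nonneg)
  qed
  moreover have "L - (- (1 / sqrt (pi * t)) * (?E (G + x) * 1 + ?E (G - x) * 1)) = chi (G + x) t"
    by (simp add: L_def chi_def algebra_simps)
  ultimately show ?thesis
    by (subst conv_Ioo) (auto simp: passage_def[abs_def] dest: has_bochner_integral_integral_eq)
qed

text \<open>A mixture of the kernels \<open>chi (x - c)\<close> over a Rayleigh distributed
  \<open>x\<close>, from which sign, bounds and convolution identities of \<open>g_fun\<close> are
  inherited.\<close>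

lemma g_fun_eq:
  assumes "0 < u"
  shows "g_fun c u = (\<integral>x. indicator {0<..} x * (x * exp (- (1/2 * x\<^sup>2))) * chi (x - c) u \<partial>lborel)"
proof -
  have "g_fun c u = (\<integral>x. 1 / sqrt (pi * u) * (indicator {0..} x *\<^sub>R (x * exp (- (x\<^sup>2) / 2 - (c - x)\<^sup>2 / (4 * u)))) \<partial>lborel)"
    unfolding g_fun_def set_lebesgue_integral_def by (rule integral_mult_right_zero[symmetric])
  also have "\<dots> = (\<integral>x. indicator {0<..} x * (x * exp (- (1/2 * x\<^sup>2))) * chi (x - c) u \<partial>lborel)"
  proof (rule Bochner_Integration.integral_cong[OF refl])
    fix x :: real
    have "exp (- (x\<^sup>2) / 2 - (c - x)\<^sup>2 / (4 * u)) = exp (- (1/2 * x\<^sup>2)) * exp (- (x - c)\<^sup>2 / (4 * u))"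
      unfolding exp_add[symmetric] by (simp add: power2_commute)
    then show "1 / sqrt (pi * u) * (indicator {0..} x *\<^sub>R (x * exp (- (x\<^sup>2) / 2 - (c - x)\<^sup>2 / (4 * u))))
      = indicator {0<..} x * (x * exp (- (1/2 * x\<^sup>2))) * chi (x - c) u"
      by (cases "x = 0") (auto simp: indicator_def chi_def)
  qed
  finally show ?thesis .
qed

lemma g_fun_integrand_le:
  assumes "0 < u"
  shows "\<bar>indicator {0<..} x * (x * exp (- (1/2 * x\<^sup>2))) * chi (x - c) u\<bar>
    \<le> ((1 / sqrt pi) / sqrt u) * (indicator {0<..} x * (x * exp (- (1/2 * x\<^sup>2))))"
proof -
  have "\<bar>indicator {0<..} x * (x * exp (- (1/2 * x\<^sup>2))) * chi (x - c) u\<bar>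
    = indicator {0<..} x * (x * exp (- (1/2 * x\<^sup>2))) * chi (x - c) u"
    using chi_nonneg[OF assms] by (auto simp: indicator_def)
  also have "\<dots> \<le> indicator {0<..} x * (x * exp (- (1/2 * x\<^sup>2))) * ((1 / sqrt pi) / sqrt u)"
    using chi_le[OF assms, of "x - c"] by (intro mult_left_mono) (auto simp: indicator_def)
  finally show ?thesis by (simp add: mult_ac)
qed

lemma has_bochner_integral_rayleigh:
  "has_bochner_integral lborel (\<lambda>x::real. C * (indicator {0<..} x * (x * exp (- (1/2 * x\<^sup>2))))) C"
  using has_bochner_integral_mult_right[of C, OF has_bochner_integral_xexp[of "1/2"]] by simp

lemma g_fun_integrable:
  assumes "0 < u"
  shows "integrable lborel (\<lambda>x. indicator {0<..} x * (x * exp (- (1/2 * x\<^sup>2))) * chi (x - c) u)"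
  by (rule abs_integral_le(1)[OF _ integrable.intros[OF has_bochner_integral_rayleigh] g_fun_integrand_le[OF assms]]) measurable

lemma g_fun_measurable2 [measurable]:
  assumes [measurable]: "f \<in> borel_measurable M" "g \<in> borel_measurable M"
  shows "(\<lambda>x. g_fun (f x) (g x)) \<in> borel_measurable M"
  unfolding g_fun_def set_lebesgue_integral_def by measurable

lemma g_fun_nonneg: "0 < u \<Longrightarrow> 0 \<le> g_fun c u"
  unfolding g_fun_eq by (intro integral_nonneg_AE AE_I2) (auto simp: indicator_def chi_nonneg)

lemma g_fun_le:
  assumes "0 < u"
  shows "g_fun c u \<le> (1 / sqrt pi) / sqrt u"
proof -
  have "\<bar>g_fun c u\<bar> \<le> (\<integral>x. ((1 / sqrt pi) / sqrt u) * (indicator {0<..} x * (x * exp (- (1/2 * x\<^sup>2)))) \<partial>lborel)"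
    unfolding g_fun_eq[OF assms]
    by (rule abs_integral_le(2)[OF _ integrable.intros[OF has_bochner_integral_rayleigh] g_fun_integrand_le[OF assms]]) measurable
  also have "\<dots> = (1 / sqrt pi) / sqrt u"
    by (rule has_bochner_integral_integral_eq[OF has_bochner_integral_rayleigh])
  finally show ?thesis by simp
qed

lemma kern_g_fun: "kern (g_fun c)"
  by (rule kern_uniform[where C="1 / sqrt pi", OF _ g_fun_nonneg g_fun_le]) auto

lemma isCont_g_fun: "0 < u \<Longrightarrow> isCont (\<lambda>c. g_fun c u) c"
  unfolding g_fun_eq
proof (rule isCont_integral_dominated[where d=1])
  assume u: "0 < u"
  show "integrable lborel (\<lambda>x. ((1 / sqrt pi) / sqrt u) * (indicator {0<..} x * (x * exp (- (1/2 * x\<^sup>2)))))"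
    by (rule integrable.intros[OF has_bochner_integral_rayleigh])
  show "AE x in lborel. isCont (\<lambda>c. indicator {0<..} x * (x * exp (- (1/2 * x\<^sup>2))) * chi (x - c) u) c"
    using u unfolding chi_def by (intro AE_I2 continuous_intros) auto
  show "\<bar>indicator {0<..} x * (x * exp (- (1/2 * x\<^sup>2))) * chi (x - c') u\<bar>
    \<le> ((1 / sqrt pi) / sqrt u) * (indicator {0<..} x * (x * exp (- (1/2 * x\<^sup>2))))" for c' x
    by (rule g_fun_integrand_le[OF u])
qed auto

lemma ennreal_g_fun:
  assumes "0 < u"
  shows "ennreal (g_fun c u) = (\<integral>\<^sup>+x. ennreal (indicator {0<..} x * (x * exp (- (1/2 * x\<^sup>2)))) * ennreal (chi (x - c) u) \<partial>lborel)"
proof -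
  have "ennreal (g_fun c u) = (\<integral>\<^sup>+x. ennreal (indicator {0<..} x * (x * exp (- (1/2 * x\<^sup>2))) * chi (x - c) u) \<partial>lborel)"
    unfolding g_fun_eq[OF assms] using chi_nonneg[OF assms]
    by (intro nn_integral_eq_integral[symmetric] g_fun_integrable assms AE_I2) (auto simp: indicator_def)
  also have "\<dots> = (\<integral>\<^sup>+x. ennreal (indicator {0<..} x * (x * exp (- (1/2 * x\<^sup>2)))) * ennreal (chi (x - c) u) \<partial>lborel)"
    using chi_nonneg[OF assms] by (intro nn_integral_cong ennreal_mult) (auto simp: indicator_def)
  finally show ?thesis .
qed

lemma conv_g_fun:
  assumes f: "kern f" and t: "0 < t"
  shows "ennreal (conv f (g_fun c) t) = (\<integral>\<^sup>+x. ennreal (indicator {0<..} x * (x * exp (- (1/2 * x\<^sup>2)))) * ennreal (conv f (chi (x - c)) t) \<partial>lborel)"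
proof -
  note [measurable] = kern_measurable[OF f]
  let ?r = "\<lambda>x::real. ennreal (indicator {0<..} x * (x * exp (- (1/2 * x\<^sup>2))))"
  have "ennreal (conv f (g_fun c) t) = (\<integral>\<^sup>+s. (\<integral>\<^sup>+x. ?r x * (ennreal (f s) * ennreal (chi (x - c) (t - s)) * indicator {0<..<t} s) \<partial>lborel) \<partial>lborel)"
    unfolding ennreal_conv[OF f kern_g_fun] convn_def
  proof (rule nn_integral_cong)
    fix s
    show "ennreal (f s) * ennreal (g_fun c (t - s)) * indicator {0<..<t} s =
      (\<integral>\<^sup>+x. ?r x * (ennreal (f s) * ennreal (chi (x - c) (t - s)) * indicator {0<..<t} s) \<partial>lborel)"
    proof (cases "0 < s \<and> s < t")
      case True
      have "ennreal (f s) * ennreal (g_fun c (t - s)) = (\<integral>\<^sup>+x. ennreal (f s) * (?r x * ennreal (chi (x - c) (t - s))) \<partial>lborel)"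
        using True by (subst ennreal_g_fun) (simp, rule nn_integral_cmult[symmetric], measurable)
      then show ?thesis using True by (simp add: mult_ac)
    qed (auto simp: indicator_def)
  qed
  also have "\<dots> = (\<integral>\<^sup>+x. (\<integral>\<^sup>+s. ?r x * (ennreal (f s) * ennreal (chi (x - c) (t - s)) * indicator {0<..<t} s) \<partial>lborel) \<partial>lborel)"
    by (rule lborel_pair.Fubini') measurable
  also have "\<dots> = (\<integral>\<^sup>+x. ?r x * ennreal (conv f (chi (x - c)) t) \<partial>lborel)"
    unfolding ennreal_conv[OF f kern_chi] convn_def by (intro nn_integral_cong nn_integral_cmult) measurable
  finally show ?thesis .
qed

text \<open>For \<open>c = 0\<close> the two exponents combine to a single Gaussian in
  \<open>x\<close> with rate \<open>1/2 + 1/(4*u)\<close>, and the integral is elementary. This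
  makes \<open>nu\<close> a member of the family \<open>g_fun\<close>.\<close>

lemma nu_eq_g_fun:
  assumes "0 < u"
  shows "nu u = g_fun 0 u"
proof -
  let ?k = "1/2 + 1/(4*u)"
  have k: "?k > 0" using assms by (simp add: add_pos_pos)
  have "g_fun 0 u = (\<integral>x. 1 / sqrt (pi * u) * (indicator {0<..} x * (x * exp (- (?k * x\<^sup>2)))) \<partial>lborel)"
    unfolding g_fun_eq[OF assms]
  proof (rule Bochner_Integration.integral_cong[OF refl])
    fix x :: real
    have "exp (- (?k * x\<^sup>2)) = exp (- (1/2 * x\<^sup>2)) * exp (- x\<^sup>2 / (4 * u))"
      unfolding exp_add[symmetric] by (simp add: distrib_right)
    then show "indicator {0<..} x * (x * exp (- (1/2 * x\<^sup>2))) * chi (x - 0) u = 1 / sqrt (pi * u) * (indicator {0<..} x * (x * exp (- (?k * x\<^sup>2))))"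
      by (simp add: chi_def)
  qed
  also have "\<dots> = 1 / sqrt (pi * u) * (1 / (2 * ?k))"
    by (rule has_bochner_integral_integral_eq[OF has_bochner_integral_mult_right[OF has_bochner_integral_xexp[OF k]]])
  also have "1 / (2 * ?k) = 2 * u / (2 * u + 1)" using assms by (simp add: field_simps)
  also have "1 / sqrt (pi * u) * (2 * u / (2 * u + 1)) = 2 / sqrt pi * (u / sqrt u) / (2 * u + 1)"
    by (simp add: real_sqrt_mult)
  also have "u / sqrt u = sqrt u" using assms by (simp add: real_div_sqrt)
  finally show ?thesis by (simp add: nu_def)
qed

lemma nu_measurable [measurable]: "nu \<in> borel_measurable borel"
  unfolding nu_def[abs_def] by measurable

lemma kern_nu: "kern nu"
  using kern_g_fun[of 0] nu_eq_g_fun unfolding kern_def by (auto simp: nu_def)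

text \<open>For every \<open>x > 0\<close>, \<open>passage_conv_chi\<close> turns
  \<open>chi x\<close> into \<open>chi (G + x)\<close>; averaging over a Rayleigh distributed
  \<open>x\<close> turns \<open>nu\<close>, which is \<open>g_fun 0\<close>, into
  \<open>g_fun (- G)\<close>.\<close>

lemma g_fun_neg:
  assumes G: "0 < G"
  shows "0 < t \<Longrightarrow> conv (passage G) nu t = g_fun (- G) t"
proof -
  assume t: "0 < t"
  have "conv (passage G) nu = conv (passage G) (g_fun 0)"
    by (rule conv_cong) (auto simp: nu_eq_g_fun kern_measurable[OF kern_passage[OF G]])
  moreover have "ennreal (conv (passage G) (g_fun 0) t) = ennreal (g_fun (- G) t)"
    unfolding conv_g_fun[OF kern_passage[OF G] t] ennreal_g_fun[OF t]
  proof (rule nn_integral_cong)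
    fix x
    show "ennreal (indicator {0<..} x * (x * exp (- (1/2 * x\<^sup>2)))) * ennreal (conv (passage G) (chi (x - 0)) t) =
      ennreal (indicator {0<..} x * (x * exp (- (1/2 * x\<^sup>2)))) * ennreal (chi (x - - G) t)"
      using passage_conv_chi[OF G _ t, of x] by (cases "x > 0") (auto simp: add.commute)
  qed
  ultimately show ?thesis using conv_nonneg[OF kern_passage[OF G] kern_g_fun] g_fun_nonneg[OF t] by simp
qed

text \<open>The case distinction in \<open>rho\<close> disappears. For \<open>c < 0\<close> and
  \<open>a \<le> 0\<close> the distances add up, so \<open>chi \<bar>a + c\<bar>\<close> is
  \<open>chi a\<close> convolved with the passage kernel of level \<open>- c\<close>, and moving
  that kernel over to \<open>nu\<close> gives \<open>g_fun c\<close>.\<close>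

lemma rho_eq:
  assumes "a \<le> 0"
  shows "rho 1 a c = conv (chi a) (g_fun c)"
proof (cases "c < 0")
  case True
  let ?G = "- c"
  have G: "0 < ?G" using True by simp
  note m = kern_measurable[OF kern_passage[OF G]] kern_measurable[OF kern_chi]
  have "conv (chi a) (g_fun c) = conv (chi a) (conv (passage ?G) nu)"
    using g_fun_neg[OF G] by (intro conv_cong conv_measurable m) auto
  also have "\<dots> = conv (conv (passage ?G) (chi \<bar>a\<bar>)) nu"
    unfolding chi_abs by (simp add: conv_assoc[symmetric] conv_commute[of "chi a"] kern_chi kern_passage[OF G] kern_nu)
  also have "\<dots> = conv (chi (?G + \<bar>a\<bar>)) nu"
    using passage_conv_chi[OF G abs_ge_zero] by (intro conv_cong conv_measurable m) (auto simp del: chi_abs)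
  also have "?G + \<bar>a\<bar> = \<bar>a + c\<bar>" using True assms by simp
  finally show ?thesis using True by (simp add: rho_def fun_eq_iff)
next
  case False
  show ?thesis
  proof (cases "c = 0")
    case True
    have "conv (chi a) nu = conv (chi a) (g_fun c)"
      using True nu_eq_g_fun by (intro conv_cong) (auto intro: kern_measurable[OF kern_chi])
    then show ?thesis using True by (simp add: rho_def fun_eq_iff)
  qed (use False in \<open>simp add: rho_def fun_eq_iff\<close>)
qed

section \<open>The renewal equation for the formula\<close>

lemma kern_conv_nu_pow: "kern f \<Longrightarrow> kern (conv_nu_pow f n)"
  by (induction n) (auto intro: kern_conv kern_nu)

text \<open>Lets the factor that carries \<open>y\<close> stand last, with the powers of
  \<open>nu\<close> collected on \<open>chi\<close>.\<close>

lemma conv_nu_pow_conv: "kern f \<Longrightarrow> kern g \<Longrightarrow> conv_nu_pow (conv f g) n = conv (conv_nu_pow f n) g"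
proof (induction n)
  case (Suc n)
  then show ?case by (simp add: conv_right_commute[OF kern_conv_nu_pow kern_nu])
qed simp

definition weight :: "nat \<Rightarrow> real" where
  "weight n = (- 1) ^ n / sqrt (2 * pi) ^ n"

lemma weight_Suc: "weight (Suc n) = - weight n / sqrt (2 * pi)"
  by (simp add: weight_def)

lemma powr_half_real: "(2 * pi) powr (real n / 2) = sqrt (2 * pi) ^ n"
proof -
  have "(2 * pi) powr (real n / 2) = ((2 * pi) powr (1 / 2)) powr real n" by (simp add: powr_powr)
  then show ?thesis by (simp add: powr_half_sqrt powr_realpow)
qed

text \<open>The index is shifted by one, \<open>rho\<close> is replaced by its unified form, and the
  range is enlarged to any \<open>N \<ge> u\<close> since the added terms are convolutions at times
  that are not positive. A range that does not depend on \<open>u\<close> makes integration and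
  continuity termwise.\<close>

lemma h_formula_one_eq:
  assumes b: "b \<le> 0" and u: "u \<le> real N"
  shows "h_formula 1 b u y = 1 / 2 * (\<Sum>n<N. weight n / sqrt (2 * pi) * conv (conv_nu_pow (chi b) n) (g_fun (b - y)) ((u - real (Suc n)) / 2))"
proof -
  let ?c = "\<lambda>n. conv (conv_nu_pow (chi b) n) (g_fun (b - y))"
  let ?A = "{n\<in>{..<N}. real (Suc n) < u}"
  have S: "{n::nat. 1 \<le> n \<and> real n < u / 1} = Suc ` ?A"
  proof safe
    fix n :: nat assume n: "1 \<le> n" "real n < u / 1"
    then have "n - 1 \<in> ?A" "n = Suc (n - 1)" using u by auto
    then show "n \<in> Suc ` ?A" by blast
  qed auto
  have "h_formula 1 b u y = 1 / 2 * (\<Sum>n\<in>?A. (-1) ^ n / sqrt (2 * pi) ^ Suc n * ?c n ((u - real (Suc n)) / 2))"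
    unfolding h_formula_def S
    by (subst sum.reindex) (auto simp: powr_half_real rho_eq[OF b] conv_nu_pow_conv[OF kern_chi kern_g_fun] simp del: power_Suc of_nat_Suc)
  also have "(\<Sum>n\<in>?A. (-1) ^ n / sqrt (2 * pi) ^ Suc n * ?c n ((u - real (Suc n)) / 2))
    = (\<Sum>n<N. weight n / sqrt (2 * pi) * ?c n ((u - real (Suc n)) / 2))"
  proof (rule sum.mono_neutral_cong_left)
    show "\<forall>n\<in>{..<N} - ?A. weight n / sqrt (2 * pi) * ?c n ((u - real (Suc n)) / 2) = 0"
      by (auto intro!: conv_nonpos simp del: of_nat_Suc)
  qed (auto simp: weight_def mult.commute)
  finally show ?thesis .
qed

text \<open>The density at the level of the part of the path that has not been stopped yet.\<close>

definition level_density :: "real \<Rightarrow> real \<Rightarrow> real" where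
  "level_density b s = gk s b - h_formula 1 b s b"

lemma gk_chi: "0 < s \<Longrightarrow> gk s x = chi x (s / 2) / 2"
proof -
  assume s: "0 < s"
  have "sqrt (pi * s) * sqrt 2 * sqrt 2 = 2 * sqrt (pi * s)" by simp
  then show ?thesis using s by (simp add: gk_eq chi_def real_sqrt_mult real_sqrt_divide field_simps)
qed

text \<open>At \<open>y = b\<close> the last factor is \<open>g_fun 0\<close>, that is
  \<open>nu\<close>, so each term of the formula is a further power of \<open>nu\<close> applied to
  \<open>chi b\<close>. The free density \<open>gk s b\<close> is the missing term of index 0, and
  the minus sign makes the rest continue the same alternating sum.\<close>

lemma level_density_eq:
  assumes b: "b \<le> 0" and s: "0 < s" "s \<le> real N"
  shows "level_density b s = 1 / 2 * (\<Sum>n<N. weight n * (of_bool (real n < s) * conv_nu_pow (chi b) n ((s - real n) / 2)))"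
proof -
  let ?T = "\<lambda>n. weight n * (of_bool (real n < s) * conv_nu_pow (chi b) n ((s - real n) / 2))"
  have c: "conv (conv_nu_pow (chi b) n) (g_fun (b - b)) = conv_nu_pow (chi b) (Suc n)" for n
    using nu_eq_g_fun by (simp, intro conv_cong kern_measurable kern_conv_nu_pow kern_chi kern_nu kern_g_fun) auto
  have "h_formula 1 b s b = 1 / 2 * (\<Sum>n<N. - ?T (Suc n))"
    unfolding h_formula_one_eq[OF b s(2)] c
  proof (rule arg_cong2[where f="(*)"], rule refl, rule sum.cong[OF refl])
    fix n
    show "weight n / sqrt (2 * pi) * conv_nu_pow (chi b) (Suc n) ((s - real (Suc n)) / 2) = - ?T (Suc n)"
      by (cases "real (Suc n) < s") (auto simp: weight_Suc conv_nonpos)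
  qed
  moreover have "gk s b = 1 / 2 * ?T 0" using s by (simp add: gk_chi weight_def)
  moreover have "?T 0 + (\<Sum>n<N. ?T (Suc n)) = (\<Sum>n<Suc N. ?T n)" by (rule sum.lessThan_Suc_shift[symmetric])
  moreover have "?T N = 0" using s by simp
  ultimately show ?thesis by (simp add: level_density_def sum_negf distrib_left[symmetric])
qed

text \<open>
  The density at y, at time r, of a path that at time 0 enters an excursion below b surviving
  for unit time, up to a factor: a Rayleigh distance from b at time 1, then a free Gaussian motion.
\<close>

definition exit_density :: "real \<Rightarrow> real \<Rightarrow> real \<Rightarrow> real" where
  "exit_density b r y = g_fun (b - y) ((r - 1) / 2) / (2 * sqrt (2 * pi))"

text \<open>The kernels run in half the time of the motion; the substitution s = n + 2 r gives the
  factor 2 and moves the delay \<open>n\<close> into the argument.\<close>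

lemma conv_rescaled:
  assumes f: "kern f" and g: "kern g"
  shows "integrable lborel (\<lambda>s. indicator {0<..<T} s * (of_bool (real n < s) * f ((s - real n) / 2) * g ((T - s) / 2)))"
    and "(\<integral>s. indicator {0<..<T} s * (of_bool (real n < s) * f ((s - real n) / 2) * g ((T - s) / 2)) \<partial>lborel) = 2 * conv f g ((T - real n) / 2)"
proof -
  let ?F = "\<lambda>s. indicator {0<..<T} s * (of_bool (real n < s) * f ((s - real n) / 2) * g ((T - s) / 2))"
  let ?t = "(T - real n) / 2"
  have e: "(\<lambda>s. ?F (real n + 2 * s)) = (\<lambda>s. indicator {0<..<?t} s * (f s * g (?t - s)))"
  proof
    fix s
    have "(T - (real n + 2 * s)) / 2 = ?t - s" by (simp add: field_simps)
    then show "?F (real n + 2 * s) = indicator {0<..<?t} s * (f s * g (?t - s))"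
      by (auto simp: indicator_def field_simps)
  qed
  have "integrable lborel (\<lambda>s. ?F (real n + 2 * s))"
  proof (cases "0 < ?t")
    case True then show ?thesis unfolding e by (rule kern_conv_integrable[OF f g])
  next
    case False
    then have z: "(\<lambda>s. indicator {0<..<?t} s * (f s * g (?t - s))) = (\<lambda>_. 0)" by (auto simp: fun_eq_iff indicator_def)
    show ?thesis unfolding e z by simp
  qed
  then show "integrable lborel ?F" by (subst (asm) lborel_integrable_real_affine_iff) auto
  show "integral\<^sup>L lborel ?F = 2 * conv f g ?t"
    using lborel_integral_real_affine[of 2 ?F "real n"]
    unfolding e conv_Ioo[OF kern_measurable[OF f] kern_measurable[OF g]] by simp
qed

text \<open>Convolving the sum for \<open>level_density\<close> with the last factor produces the
  terms of the formula one delay later. The constants agree because 1/2 times 1 / (2 sqrt (2 pi)),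
  times the 2 from the halved time, is 1/2 times 1 / sqrt (2 pi).\<close>

lemma h_formula_renewal:
  assumes b: "b \<le> 0"
  shows "h_formula 1 b u y = (\<integral>s. indicator {0<..<u - 1} s * (level_density b s * exit_density b (u - s) y) \<partial>lborel)"
proof -
  define N where "N = nat \<lceil>u\<rceil>"
  have N: "u \<le> real N" unfolding N_def by linarith
  let ?X = "conv_nu_pow (chi b)"
  let ?g = "g_fun (b - y)"
  let ?F = "\<lambda>n s. indicator {0<..<u - 1} s * (of_bool (real n < s) * ?X n ((s - real n) / 2) * ?g ((u - 1 - s) / 2))"
  have X: "kern (?X n)" for n by (intro kern_conv_nu_pow kern_chi)
  have "(\<integral>s. indicator {0<..<u - 1} s * (level_density b s * exit_density b (u - s) y) \<partial>lborel)
    = (\<integral>s. (\<Sum>n<N. (1 / 2 * weight n / (2 * sqrt (2 * pi))) * ?F n s) \<partial>lborel)"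
  proof (rule Bochner_Integration.integral_cong[OF refl])
    fix s
    show "indicator {0<..<u - 1} s * (level_density b s * exit_density b (u - s) y) = (\<Sum>n<N. (1 / 2 * weight n / (2 * sqrt (2 * pi))) * ?F n s)"
    proof (cases "0 < s \<and> s < u - 1")
      case True
      then have "s \<le> real N" using N by simp
      have "level_density b s * exit_density b (u - s) y =
        1 / 2 * (\<Sum>n<N. weight n * (of_bool (real n < s) * ?X n ((s - real n) / 2))) * (?g ((u - 1 - s) / 2) / (2 * sqrt (2 * pi)))"
        unfolding level_density_eq[OF b conjunct1[OF True] \<open>s \<le> real N\<close>] exit_density_def by (simp add: algebra_simps)
      then show ?thesis using True
        by (simp add: sum_distrib_left sum_distrib_right mult_ac)
    qed (auto simp: indicator_def)
  qed
  also have "\<dots> = (\<Sum>n<N. \<integral>s. (1 / 2 * weight n / (2 * sqrt (2 * pi))) * ?F n s \<partial>lborel)"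
    by (intro Bochner_Integration.integral_sum integrable_mult_right conv_rescaled X kern_g_fun)
  also have "\<dots> = (\<Sum>n<N. (1 / 2 * weight n / (2 * sqrt (2 * pi))) * (2 * conv (?X n) ?g ((u - 1 - real n) / 2)))"
    by (simp only: integral_mult_right_zero conv_rescaled(2)[OF X kern_g_fun])
  also have "\<dots> = h_formula 1 b u y"
    unfolding h_formula_one_eq[OF b N] by (simp add: sum_distrib_left algebra_simps)
  finally show ?thesis by simp
qed

section \<open>Bounds and regularity of the formula\<close>

lemma conv_g_fun_bound:
  assumes f: "kern f"
  obtains K where "0 \<le> K" "\<And>t c. t \<le> T \<Longrightarrow> \<bar>conv f (g_fun c) t\<bar> \<le> K"
proof -
  obtain C where C: "0 \<le> C" "\<And>t. 0 < t \<Longrightarrow> t < T \<Longrightarrow> \<bar>f t\<bar> \<le> C / sqrt t" using kern_abs_bound[OF f] by blast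
  have g: "\<bar>g_fun c s\<bar> \<le> (1 / sqrt pi) / sqrt s" if "0 < s" for c s
    using g_fun_le[OF that] g_fun_nonneg[OF that] by simp
  have "\<bar>conv f (g_fun c) t\<bar> \<le> C * (1 / sqrt pi) * 4 * sqrt 2" if t: "t \<le> T" for t c
  proof (cases "0 < t")
    case True
    show ?thesis
      by (rule conv_bound(2)[OF kern_measurable[OF f] kern_measurable[OF kern_g_fun] True]) (use C t g in auto)
  next
    case False then show ?thesis using C by (simp add: conv_nonpos)
  qed
  then show ?thesis using C by (intro that[of "C * (1 / sqrt pi) * 4 * sqrt 2"]) auto
qed

lemma isCont_conv_g_fun:
  assumes f: "kern f"
  shows "isCont (\<lambda>c. conv f (g_fun c) t) c"
proof (cases "0 < t")
  case True
  note [measurable] = kern_measurable[OF f]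
  obtain C where C: "0 \<le> C" "\<And>s. 0 < s \<Longrightarrow> s < t \<Longrightarrow> \<bar>f s\<bar> \<le> C / sqrt s" using kern_abs_bound[OF f] by blast
  have g: "\<bar>g_fun c s\<bar> \<le> (1 / sqrt pi) / sqrt s" if "0 < s" for c s
    using g_fun_le[OF that] g_fun_nonneg[OF that] by simp
  show ?thesis unfolding conv_Ioo[OF kern_measurable[OF f] kern_measurable[OF kern_g_fun]]
  proof (rule isCont_integral_dominated[where d=1])
    show "integrable lborel (\<lambda>s. (C * (1 / sqrt pi)) * sqrt (2 / t) * (indicator {0<..<t} s * (1 / sqrt s) + indicator {0<..<t} s * (1 / sqrt (t - s))))"
      by (rule integrable.intros[OF conv_kern_majorant[OF True]])
    show "\<bar>indicator {0<..<t} s * (f s * g_fun c' (t - s))\<bar> \<le>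
       (C * (1 / sqrt pi)) * sqrt (2 / t) * (indicator {0<..<t} s * (1 / sqrt s) + indicator {0<..<t} s * (1 / sqrt (t - s)))" for c' s
      by (rule conv_integrand_le) (use C g in auto)
    show "AE s in lborel. isCont (\<lambda>c. indicator {0<..<t} s * (f s * g_fun c (t - s))) c"
    proof (rule AE_I2)
      fix s
      show "isCont (\<lambda>c. indicator {0<..<t} s * (f s * g_fun c (t - s))) c"
        by (cases "0 < s \<and> s < t") (auto simp: indicator_def intro!: continuous_intros isCont_g_fun)
    qed
  qed auto
next
  case False then show ?thesis by (simp add: conv_nonpos)
qed

lemma h_formula_isCont:
  assumes b: "b \<le> 0"
  shows "isCont (\<lambda>y. h_formula 1 b u y) y"
proof -
  have N: "u \<le> real (nat \<lceil>u\<rceil>)" by linarith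
  have "isCont (\<lambda>y. conv (conv_nu_pow (chi b) n) (g_fun (b - y)) t) y" for n t
    by (rule isCont_o2[OF _ isCont_conv_g_fun[OF kern_conv_nu_pow[OF kern_chi]]]) (intro continuous_intros)
  then show ?thesis unfolding h_formula_one_eq[OF b N] by (intro continuous_intros)
qed

lemma h_formula_measurable: "b \<le> 0 \<Longrightarrow> h_formula 1 b u \<in> borel_measurable borel"
  by (intro borel_measurable_continuous_onI continuous_at_imp_continuous_on ballI h_formula_isCont)

lemma h_formula_bounded:
  assumes b: "b \<le> 0"
  shows "\<exists>H\<ge>0. \<forall>u y. u \<le> T \<longrightarrow> \<bar>h_formula 1 b u y\<bar> \<le> H"
proof -
  define N where "N = nat \<lceil>T\<rceil>"
  have "\<exists>K. 0 \<le> K \<and> (\<forall>t c. t \<le> \<bar>T\<bar> \<longrightarrow> \<bar>conv (conv_nu_pow (chi b) n) (g_fun c) t\<bar> \<le> K)" for n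
    by (rule conv_g_fun_bound[OF kern_conv_nu_pow[OF kern_chi], where T="\<bar>T\<bar>"]) blast
  then have "\<exists>K. \<forall>n. 0 \<le> K n \<and> (\<forall>t c. t \<le> \<bar>T\<bar> \<longrightarrow> \<bar>conv (conv_nu_pow (chi b) n) (g_fun c) t\<bar> \<le> K n)"
    by (intro choice allI)
  then obtain K where K: "\<And>n. 0 \<le> K n" "\<And>n t c. t \<le> \<bar>T\<bar> \<Longrightarrow> \<bar>conv (conv_nu_pow (chi b) n) (g_fun c) t\<bar> \<le> K n"
    by blast
  have "\<bar>h_formula 1 b u y\<bar> \<le> 1 / 2 * (\<Sum>n<N. \<bar>weight n / sqrt (2 * pi)\<bar> * K n)" if "u \<le> T" for u y
  proof -
    have N: "u \<le> real N" using that unfolding N_def by linarith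
    let ?a = "\<lambda>n. weight n / sqrt (2 * pi) * conv (conv_nu_pow (chi b) n) (g_fun (b - y)) ((u - real (Suc n)) / 2)"
    have "(u - real (Suc n)) / 2 \<le> \<bar>T\<bar>" for n using that by simp
    then have "\<bar>?a n\<bar> \<le> \<bar>weight n / sqrt (2 * pi)\<bar> * K n" for n
      unfolding abs_mult by (rule mult_left_mono[OF K(2)]) simp
    then have "\<bar>\<Sum>n<N. ?a n\<bar> \<le> (\<Sum>n<N. \<bar>weight n / sqrt (2 * pi)\<bar> * K n)"
      by (intro order_trans[OF sum_abs] sum_mono)
    then show ?thesis unfolding h_formula_one_eq[OF b N] by simp
  qed
  moreover have "0 \<le> 1 / 2 * (\<Sum>n<N. \<bar>weight n / sqrt (2 * pi)\<bar> * K n)" using K by (auto intro!: sum_nonneg)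
  ultimately show ?thesis by blast
qed

lemma level_density_measurable:
  assumes b: "b \<le> 0"
  shows "(\<lambda>s. indicator {0<..<T} s * level_density b s) \<in> borel_measurable borel"
proof -
  define N where "N = nat \<lceil>T\<rceil>"
  have N: "T \<le> real N" unfolding N_def by linarith
  have [measurable]: "conv_nu_pow (chi b) n \<in> borel_measurable borel" for n by (intro kern_measurable kern_conv_nu_pow kern_chi)
  have "(\<lambda>s. indicator {0<..<T} s * (1 / 2 * (\<Sum>n<N. weight n * (of_bool (real n < s) * conv_nu_pow (chi b) n ((s - real n) / 2))))) \<in> borel_measurable borel"
    by measurable
  also have "(\<lambda>s. indicator {0<..<T} s * (1 / 2 * (\<Sum>n<N. weight n * (of_bool (real n < s) * conv_nu_pow (chi b) n ((s - real n) / 2))))) = (\<lambda>s. indicator {0<..<T} s * level_density b s)"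
    using level_density_eq[OF b, of _ N] N by (intro ext) (auto simp: indicator_def)
  finally show ?thesis .
qed

section \<open>Entrances into long excursions\<close>

lemma gk_one_eq: "gk 1 x = exp (- (1/2 * x\<^sup>2)) / sqrt (2 * pi)"
  by (simp add: gk_eq)

lemma exit_density_eq:
  assumes r: "1 < r"
  shows "exit_density b r y = (\<integral>x. indicator {0<..} x * (x * gk 1 x) * gk (r - 1) (y - (b - x)) \<partial>lborel)"
proof -
  have r1: "0 < r - 1" using r by simp
  have "exit_density b r y = (\<integral>x. (indicator {0<..} x * (x * exp (- (1/2 * x\<^sup>2))) * chi (x - (b - y)) ((r - 1) / 2)) / (2 * sqrt (2 * pi)) \<partial>lborel)"
    unfolding exit_density_def using r by (subst g_fun_eq) auto
  also have "\<dots> = (\<integral>x. indicator {0<..} x * (x * gk 1 x) * gk (r - 1) (y - (b - x)) \<partial>lborel)"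
  proof (rule Bochner_Integration.integral_cong[OF refl])
    fix x
    have e: "y - (b - x) = x - (b - y)" by simp
    show "(indicator {0<..} x * (x * exp (- (1/2 * x\<^sup>2))) * chi (x - (b - y)) ((r - 1) / 2)) / (2 * sqrt (2 * pi)) =
      indicator {0<..} x * (x * gk 1 x) * gk (r - 1) (y - (b - x))"
      unfolding e gk_one_eq gk_chi[OF r1] by simp
  qed
  finally show ?thesis .
qed

lemma exit_density_measurable [measurable]:
  assumes [measurable]: "f \<in> borel_measurable M" "g \<in> borel_measurable M"
  shows "(\<lambda>x. exit_density b (f x) (g x)) \<in> borel_measurable M"
  unfolding exit_density_def by measurable

lemma exit_density_nonneg: "1 < r \<Longrightarrow> 0 \<le> exit_density b r y"
  unfolding exit_density_def by (simp add: g_fun_nonneg)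

lemma rayleigh_integrable: "integrable lborel (\<lambda>x. indicator {0<..} x * (x * gk 1 x))"
  using integrable.intros[OF has_bochner_integral_rayleigh[of "1 / sqrt (2 * pi)"]] by (simp add: gk_one_eq mult_ac)

text \<open>Fubini matches the two descriptions of the exit: the boundary limit comes out as a
  Rayleigh average of the free semigroup, the formula as an integral against a density in
  \<open>y\<close>.\<close>

lemma exit_density_integral:
  fixes \<phi> :: "real \<Rightarrow> real"
  assumes r: "1 < r" and [measurable]: "\<phi> \<in> borel_measurable borel" and B: "\<And>x. \<bar>\<phi> x\<bar> \<le> B"
  shows "integrable lborel (\<lambda>y. \<phi> y * exit_density b r y)"
    and "(\<integral>y. \<phi> y * exit_density b r y \<partial>lborel) = (\<integral>x. indicator {0<..} x * (x * gk 1 x) * heat (r - 1) \<phi> (b - x) \<partial>lborel)"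
proof -
  have r1: "0 < r - 1" using r by simp
  let ?F = "\<lambda>x y. (indicator {0<..} x * (x * gk 1 x)) * (\<phi> y * gk (r - 1) (y - (b - x)))"
  have i1: "integrable lborel (\<lambda>y. \<phi> y * gk (r - 1) (y - x))" for x by (rule integrable_heat[OF _ B r1]) simp
  have F: "integrable (lborel \<Otimes>\<^sub>M lborel) (\<lambda>(x, y). ?F x y)"
  proof (rule lborel_pair.Fubini_integrable)
    show "AE x in lborel. integrable lborel (\<lambda>y. case (x, y) of (x, y) \<Rightarrow> ?F x y)"
      by (intro AE_I2) (simp add: i1)
    have "\<bar>\<integral>y. norm (?F x y) \<partial>lborel\<bar> \<le> B * (indicator {0<..} x * (x * gk 1 x))" for x
    proof -
      have "(\<integral>y. norm (?F x y) \<partial>lborel) = (\<integral>y. (indicator {0<..} x * (x * gk 1 x)) * \<bar>\<phi> y * gk (r - 1) (y - (b - x))\<bar> \<partial>lborel)"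
        by (intro Bochner_Integration.integral_cong) (auto simp: abs_mult indicator_def)
      also have "\<dots> = (indicator {0<..} x * (x * gk 1 x)) * (\<integral>y. \<bar>\<phi> y\<bar> * gk (r - 1) (y - (b - x)) \<partial>lborel)"
        by (simp add: abs_mult)
      also have "(\<integral>y. \<bar>\<phi> y\<bar> * gk (r - 1) (y - (b - x)) \<partial>lborel) = heat (r - 1) (\<lambda>y. \<bar>\<phi> y\<bar>) (b - x)"
        by (simp add: heat_def)
      finally have e: "(\<integral>y. norm (?F x y) \<partial>lborel) = (indicator {0<..} x * (x * gk 1 x)) * heat (r - 1) (\<lambda>y. \<bar>\<phi> y\<bar>) (b - x)" .
      have hb: "\<bar>heat (r - 1) (\<lambda>y. \<bar>\<phi> y\<bar>) (b - x)\<bar> \<le> B" using B by (intro heat_bound r1) auto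
      have n: "0 \<le> indicator {0<..} x * (x * gk 1 x)" by (simp add: indicator_def)
      show ?thesis unfolding e abs_mult[of "indicator {0<..} x * (x * gk 1 x)"]
        using mult_right_mono[OF hb n] n by (simp add: mult.commute)
    qed
    then show "integrable lborel (\<lambda>x. \<integral>y. norm (case (x, y) of (x, y) \<Rightarrow> ?F x y) \<partial>lborel)"
      unfolding prod.case by (intro abs_integral_le(1)[OF _ integrable_mult_right[OF rayleigh_integrable]]) auto
  qed measurable
  have e: "(\<integral>x. ?F x y \<partial>lborel) = \<phi> y * exit_density b r y" for y
    unfolding exit_density_eq[OF r] by (subst integral_mult_right_zero[symmetric]) (simp add: mult_ac)
  show "integrable lborel (\<lambda>y. \<phi> y * exit_density b r y)"
    using lborel_pair.integrable_snd[OF F] unfolding e .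
  show "(\<integral>y. \<phi> y * exit_density b r y \<partial>lborel) = (\<integral>x. indicator {0<..} x * (x * gk 1 x) * heat (r - 1) \<phi> (b - x) \<partial>lborel)"
    using lborel_pair.Fubini_integral[OF F] unfolding e by (simp add: heat_def)
qed

lemma killed_zero: "b \<le> x \<Longrightarrow> killed b t f x = 0"
  by (simp add: killed_def)

text \<open>The killed function is supported below \<open>b\<close>, so for \<open>x < b\<close> the
  difference is the image term at \<open>2 * b - x\<close>; for \<open>x \<ge> b\<close> the
  subtracted term vanishes and \<open>x\<close> itself remains. Both points are
  \<open>b + \<bar>x - b\<bar>\<close>.\<close>

lemma heat_minus_killed: "heat a (killed b t f) x - killed b a (killed b t f) x = heat a (killed b t f) (b + \<bar>x - b\<bar>)"
proof -
  have "(\<lambda>y. killed b t f y * indicator {..<b} y) = killed b t f"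
    by (auto simp: fun_eq_iff indicator_def killed_zero)
  then show ?thesis by (auto simp: killed_def[of b a] abs_if)
qed

context brownian
begin

text \<open>The event is a difference of two: below on (s + a, s + 1), which is free motion for time
  \<open>a\<close> and then killed motion for time 1 - a, and below on (s, s + 1), which is killed
  motion in both pieces. The same inner function enters both, and \<open>heat_minus_killed\<close>
  merges them.\<close>

lemma entrance_step:
  fixes \<phi> :: "real \<Rightarrow> real"
  assumes s: "0 < s" "s < u - 1" and a: "0 < a" "a \<le> 1/4" and E: "E \<in> sets (past s)"
    and \<phi>: "\<phi> \<in> borel_measurable borel" and B: "\<And>x. \<bar>\<phi> x\<bar> \<le> B"
  shows "(\<integral>\<omega>. indicator E \<omega> * (of_bool (below (\<lambda>t. W t \<omega>) b (s + a) (s + 1) \<and> \<not> below (\<lambda>t. W t \<omega>) b s (s + 1)) * \<phi> (W u \<omega>)) \<partial>M)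
    = (\<integral>\<omega>. indicator E \<omega> * heat a (killed b (1 - a) (heat (u - s - 1) \<phi>)) (b + \<bar>W s \<omega> - b\<bar>) \<partial>M)"
proof -
  note [measurable] = \<phi>
  define \<psi> where "\<psi> = heat (u - s - 1) \<phi>"
  define w where "w = killed b (1 - a) \<psi>"
  have \<psi>m [measurable]: "\<psi> \<in> borel_measurable borel" unfolding \<psi>_def by measurable
  have \<psi>B: "\<bar>\<psi> x\<bar> \<le> B" for x unfolding \<psi>_def using s by (intro heat_bound \<phi> B) auto
  have \<psi>c: "isCont \<psi> x" for x unfolding \<psi>_def using s by (intro heat_isCont[OF \<phi> B]) auto
  have wm [measurable]: "w \<in> borel_measurable borel" unfolding w_def by measurable
  have wB: "\<bar>w x\<bar> \<le> 2 * B" for x unfolding w_def using a by (intro killed_bound \<psi>m \<psi>B) auto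
  have wc: "isCont w x" if "x < b" for x unfolding w_def using a that by (intro killed_isCont[OF \<psi>m \<psi>B]) auto
  have B0: "0 \<le> B" using abs_ge_zero[of "\<phi> 0"] B[of 0] by linarith
  have pos: "0 < s + a" "s + a < s + 1" "0 \<le> s + 1" "s + 1 < u" "0 \<le> s" "s < s + a" "0 \<le> s + a" "0 \<le> u" using s a by auto
  note [measurable] = W_measurable[OF pos(8)] W_measurable[OF pos(3)] W_measurable[OF pos(7)] W_measurable[OF pos(5)]
  note [measurable] = below_pred[OF pos(5)] below_pred[OF pos(7)]
  have EM [measurable]: "E \<in> sets M" using E sets_past_subset by blast
  have E1: "E \<in> sets (past (s + a))" using E sets_past_mono[of s "s + a"] a by auto
  let ?b1 = "\<lambda>\<omega>. below (\<lambda>t. W t \<omega>) b (s + a) (s + 1)" and ?b0 = "\<lambda>\<omega>. below (\<lambda>t. W t \<omega>) b s (s + 1)"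
  let ?bb = "\<lambda>\<omega>. below (\<lambda>t. W t \<omega>) b s (s + a)"
  \<comment> \<open>The Markov property at \<open>s + 1\<close> trades the value at time
    \<open>u\<close> for the free evolution \<open>\<psi>\<close>, which has the continuity that
    \<open>killed_markov\<close> demands.\<close>
  have mk: "(\<integral>\<omega>. indicator E \<omega> * (of_bool (below (\<lambda>t. W t \<omega>) b p (s + 1)) * \<phi> (W u \<omega>)) \<partial>M)
     = (\<integral>\<omega>. indicator E \<omega> * (of_bool (below (\<lambda>t. W t \<omega>) b p (s + 1)) * \<psi> (W (s + 1) \<omega>)) \<partial>M)" if p: "0 \<le> p" for p
  proof -
    let ?E = "E \<inter> {\<omega>\<in>space M. below (\<lambda>t. W t \<omega>) b p (s + 1)}"
    have "?E \<in> sets (past (s + 1))" using E sets_past_mono[of s "s + 1"] below_past[OF p, of b "s + 1"] by auto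
    from markov[OF pos(3,4) this \<phi> B]
    have "(\<integral>\<omega>. indicator ?E \<omega> * \<phi> (W u \<omega>) \<partial>M) = (\<integral>\<omega>. indicator ?E \<omega> * \<psi> (W (s + 1) \<omega>) \<partial>M)"
      by (simp add: \<psi>_def diff_diff_eq)
    moreover have "(\<integral>\<omega>. indicator ?E \<omega> * f \<omega> \<partial>M) = (\<integral>\<omega>. indicator E \<omega> * (of_bool (below (\<lambda>t. W t \<omega>) b p (s + 1)) * f \<omega>) \<partial>M)" for f :: "'a \<Rightarrow> real"
      by (intro Bochner_Integration.integral_cong) (auto simp: indicator_def)
    ultimately show ?thesis by simp
  qed
  have 1: "(\<integral>\<omega>. indicator E \<omega> * (of_bool (?b1 \<omega>) * \<phi> (W u \<omega>)) \<partial>M) = (\<integral>\<omega>. indicator E \<omega> * heat a w (W s \<omega>) \<partial>M)"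
  proof -
    have "(\<integral>\<omega>. indicator E \<omega> * (of_bool (?b1 \<omega>) * \<psi> (W (s + 1) \<omega>)) \<partial>M) = (\<integral>\<omega>. indicator E \<omega> * w (W (s + a) \<omega>) \<partial>M)"
      using killed_markov[OF pos(1,2) E1 \<psi>m \<psi>B \<psi>c] by (simp add: w_def)
    also have "\<dots> = (\<integral>\<omega>. indicator E \<omega> * heat a w (W s \<omega>) \<partial>M)"
      using markov[OF pos(5,6) E wm wB] by simp
    finally show ?thesis using mk[OF pos(7)] by simp
  qed
  have 2: "(\<integral>\<omega>. indicator E \<omega> * (of_bool (?b0 \<omega>) * \<phi> (W u \<omega>)) \<partial>M) = (\<integral>\<omega>. indicator E \<omega> * killed b a w (W s \<omega>) \<partial>M)"
  proof -
    let ?E = "E \<inter> {\<omega>\<in>space M. ?bb \<omega>}"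
    have E': "?E \<in> sets (past (s + a))" using E1 below_past[OF pos(5), of b "s + a"] by auto
    have "(\<integral>\<omega>. indicator E \<omega> * (of_bool (?b0 \<omega>) * \<psi> (W (s + 1) \<omega>)) \<partial>M)
      = (\<integral>\<omega>. indicator ?E \<omega> * (of_bool (?b1 \<omega>) * \<psi> (W (s + 1) \<omega>)) \<partial>M)"
    proof (rule integral_cong_AE)
      show "AE \<omega> in M. indicator E \<omega> * (of_bool (?b0 \<omega>) * \<psi> (W (s + 1) \<omega>)) = indicator ?E \<omega> * (of_bool (?b1 \<omega>) * \<psi> (W (s + 1) \<omega>))"
        using W_neq[OF pos(1), of b] AE_space
      proof eventually_elim
        case (elim \<omega>)
        \<comment> \<open>The two open intervals omit the instant \<open>s + a\<close>; there the
          path is at most \<open>b\<close> by continuity and almost surely different from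
          \<open>b\<close>.\<close>
        have "?b0 \<omega> \<longleftrightarrow> ?bb \<omega> \<and> ?b1 \<omega>"
        proof
          assume "?bb \<omega> \<and> ?b1 \<omega>"
          moreover have "W (s + a) \<omega> \<le> b" if "?bb \<omega>"
            by (rule below_endpoints(2)[OF W_continuous_Icc[OF elim(2) pos(5)] pos(6) that])
          ultimately have "W v \<omega> < b" if "s < v" "v < s + 1" for v
            using that elim(1) by (cases v "s + a" rule: linorder_cases) (auto simp: below_def)
          then show "?b0 \<omega>" by (auto simp: below_def)
        qed (use a in \<open>auto simp: below_def\<close>)
        then show ?case using elim(2) by (auto simp: indicator_def)
      qed
      have [measurable]: "?E \<in> sets M" using E' sets_past_subset by blast
      show "(\<lambda>\<omega>. indicator ?E \<omega> * (of_bool (?b1 \<omega>) * \<psi> (W (s + 1) \<omega>))) \<in> borel_measurable M" by measurable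
    qed measurable
    also have "\<dots> = (\<integral>\<omega>. indicator ?E \<omega> * w (W (s + a) \<omega>) \<partial>M)"
      using killed_markov[OF pos(1,2) E' \<psi>m \<psi>B \<psi>c] by (simp add: w_def)
    also have "\<dots> = (\<integral>\<omega>. indicator E \<omega> * (of_bool (?bb \<omega>) * w (W (s + a) \<omega>)) \<partial>M)"
      by (intro Bochner_Integration.integral_cong) (auto simp: indicator_def)
    also have "\<dots> = (\<integral>\<omega>. indicator E \<omega> * killed b a w (W s \<omega>) \<partial>M)"
      using killed_markov[OF s(1) pos(6) E wm wB wc] by simp
    finally show ?thesis using mk[OF pos(5)] by simp
  qed
  have ib: "integrable M F" if "F \<in> borel_measurable M" "\<And>\<omega>. \<bar>F \<omega>\<bar> \<le> 4 * B" for F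
    using that by (intro integrable_const_bound[where B="4 * B"]) auto
  have sub: "of_bool (?b1 \<omega> \<and> \<not> ?b0 \<omega>) = (of_bool (?b1 \<omega>) - of_bool (?b0 \<omega>) :: real)" for \<omega>
    using below_mono[of "\<lambda>t. W t \<omega>" b s "s + 1" "s + a" "s + 1"] a by auto
  have Bphi: "\<bar>\<phi> x\<bar> \<le> 4 * B" for x using B[of x] B0 by linarith
  have "(\<integral>\<omega>. indicator E \<omega> * (of_bool (?b1 \<omega> \<and> \<not> ?b0 \<omega>) * \<phi> (W u \<omega>)) \<partial>M)
    = (\<integral>\<omega>. indicator E \<omega> * (of_bool (?b1 \<omega>) * \<phi> (W u \<omega>)) - indicator E \<omega> * (of_bool (?b0 \<omega>) * \<phi> (W u \<omega>)) \<partial>M)"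
    unfolding sub by (simp add: algebra_simps)
  also have "\<dots> = (\<integral>\<omega>. indicator E \<omega> * (of_bool (?b1 \<omega>) * \<phi> (W u \<omega>)) \<partial>M) - (\<integral>\<omega>. indicator E \<omega> * (of_bool (?b0 \<omega>) * \<phi> (W u \<omega>)) \<partial>M)"
    using Bphi B0 by (intro Bochner_Integration.integral_diff ib) (auto simp: indicator_def)
  also have "\<dots> = (\<integral>\<omega>. indicator E \<omega> * heat a w (W s \<omega>) \<partial>M) - (\<integral>\<omega>. indicator E \<omega> * killed b a w (W s \<omega>) \<partial>M)"
    unfolding 1 2 ..
  also have "\<dots> = (\<integral>\<omega>. indicator E \<omega> * heat a w (W s \<omega>) - indicator E \<omega> * killed b a w (W s \<omega>) \<partial>M)"
  proof (rule Bochner_Integration.integral_diff[symmetric]; rule ib)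
    have "\<bar>heat a w x\<bar> \<le> 4 * B" for x using heat_bound[OF wm wB a(1), of x] B0 by linarith
    then show "\<bar>indicator E \<omega> * heat a w (W s \<omega>)\<bar> \<le> 4 * B" for \<omega> using B0 by (simp add: indicator_def)
    have "\<bar>killed b a w x\<bar> \<le> 4 * B" for x using killed_bound[OF wm wB a(1), of b x] by linarith
    then show "\<bar>indicator E \<omega> * killed b a w (W s \<omega>)\<bar> \<le> 4 * B" for \<omega> using B0 by (simp add: indicator_def)
  qed measurable
  also have "\<dots> = (\<integral>\<omega>. indicator E \<omega> * heat a w (b + \<bar>W s \<omega> - b\<bar>) \<partial>M)"
    unfolding right_diff_distrib[symmetric] w_def heat_minus_killed ..
  finally show ?thesis unfolding w_def \<psi>_def .
qed

lemma entrance_set_joint: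
  assumes a: "0 < a"
  shows "{x\<in>space (borel \<Otimes>\<^sub>M M). fst x \<in> entrance_set (\<lambda>t. W t (snd x)) b u a} \<in> sets (borel \<Otimes>\<^sub>M M)"
proof -
  have [measurable]: "Measurable.pred (borel \<Otimes>\<^sub>M M) (\<lambda>x. stopped (\<lambda>t. W t (snd x)) b (fst x))"
    using stopped_joint by (simp add: pred_def)
  have [measurable]: "Measurable.pred (borel \<Otimes>\<^sub>M M) (\<lambda>x. 0 < fst x \<and> below (\<lambda>t. W t (snd x)) b (fst x + a) (fst x + 1))"
    using below_joint[of a b 1] a by (simp add: pred_def)
  have [measurable]: "Measurable.pred (borel \<Otimes>\<^sub>M M) (\<lambda>x. 0 < fst x \<and> below (\<lambda>t. W t (snd x)) b (fst x + 0) (fst x + 1))"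
    using below_joint[of 0 b 1] by (simp add: pred_def)
  have "{x\<in>space (borel \<Otimes>\<^sub>M M). fst x < u - 1 \<and> \<not> stopped (\<lambda>t. W t (snd x)) b (fst x) \<and>
     (0 < fst x \<and> below (\<lambda>t. W t (snd x)) b (fst x + a) (fst x + 1)) \<and>
     \<not> (0 < fst x \<and> below (\<lambda>t. W t (snd x)) b (fst x + 0) (fst x + 1))} \<in> sets (borel \<Otimes>\<^sub>M M)"
    by measurable
  also have "{x\<in>space (borel \<Otimes>\<^sub>M M). fst x < u - 1 \<and> \<not> stopped (\<lambda>t. W t (snd x)) b (fst x) \<and>
     (0 < fst x \<and> below (\<lambda>t. W t (snd x)) b (fst x + a) (fst x + 1)) \<and>
     \<not> (0 < fst x \<and> below (\<lambda>t. W t (snd x)) b (fst x + 0) (fst x + 1))}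
    = {x\<in>space (borel \<Otimes>\<^sub>M M). fst x \<in> entrance_set (\<lambda>t. W t (snd x)) b u a}"
    unfolding entrance_set_def by auto
  finally show ?thesis .
qed

end

section \<open>The law of the stopped process\<close>

context brownian
begin

lemma stopped_pred: "Measurable.pred M (\<lambda>\<omega>. stopped (\<lambda>t. W t \<omega>) b u)"
  using subsetD[OF sets_past_subset stopped_past[of b u]] by (simp add: pred_def)

text \<open>The induction hypothesis, for all bounded test functions at once. Integrability is part
  of it because the law of the paths not yet stopped is obtained by subtraction.\<close>

definition stopped_law :: "real \<Rightarrow> real \<Rightarrow> bool" where
  "stopped_law b u \<longleftrightarrow> (\<forall>\<phi> B. \<phi> \<in> borel_measurable borel \<longrightarrow> (\<forall>x. \<bar>\<phi> x\<bar> \<le> B) \<longrightarrow>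
     integrable lborel (\<lambda>y. \<phi> y * h_formula 1 b u y) \<and>
     (\<integral>\<omega>. of_bool (stopped (\<lambda>t. W t \<omega>) b u) * \<phi> (W u \<omega>) \<partial>M) = (\<integral>y. \<phi> y * h_formula 1 b u y \<partial>lborel))"

lemma not_stopped_density:
  fixes g :: "real \<Rightarrow> real"
  assumes s: "0 < s" and law: "stopped_law b s" and [measurable]: "g \<in> borel_measurable borel" and B: "\<And>x. \<bar>g x\<bar> \<le> B"
  shows "(\<integral>\<omega>. indicator {\<omega>\<in>space M. \<not> stopped (\<lambda>t. W t \<omega>) b s} \<omega> * g (W s \<omega>) \<partial>M)
    = (\<integral>x. (gk s x - h_formula 1 b s x) * g x \<partial>lborel)"
proof -
  have [measurable]: "W s \<in> borel_measurable M" using s by (intro W_measurable) simp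
  note [measurable] = stopped_pred
  have i1: "integrable lborel (\<lambda>x. g x * gk s x)"
    using integrable_heat[of g B s 0] B s by simp
  have i2: "integrable lborel (\<lambda>x. g x * h_formula 1 b s x)"
    and e2: "(\<integral>\<omega>. of_bool (stopped (\<lambda>t. W t \<omega>) b s) * g (W s \<omega>) \<partial>M) = (\<integral>x. g x * h_formula 1 b s x \<partial>lborel)"
    using law[unfolded stopped_law_def, rule_format, OF assms(3) B] by auto
  have B0: "0 \<le> B" using abs_ge_zero[of "g 0"] B[of 0] by linarith
  have "(\<integral>\<omega>. indicator {\<omega>\<in>space M. \<not> stopped (\<lambda>t. W t \<omega>) b s} \<omega> * g (W s \<omega>) \<partial>M)
    = (\<integral>\<omega>. g (W s \<omega>) - of_bool (stopped (\<lambda>t. W t \<omega>) b s) * g (W s \<omega>) \<partial>M)"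
    by (intro Bochner_Integration.integral_cong) (auto simp: indicator_def)
  also have "\<dots> = (\<integral>\<omega>. g (W s \<omega>) \<partial>M) - (\<integral>\<omega>. of_bool (stopped (\<lambda>t. W t \<omega>) b s) * g (W s \<omega>) \<partial>M)"
    using B B0 by (intro Bochner_Integration.integral_diff integrable_const_bound[where B=B]) auto
  also have "\<dots> = (\<integral>x. g x * gk s x \<partial>lborel) - (\<integral>x. g x * h_formula 1 b s x \<partial>lborel)"
    unfolding e2 by (simp add: W_density(1)[OF s])
  also have "\<dots> = (\<integral>x. g x * gk s x - g x * h_formula 1 b s x \<partial>lborel)"
    by (rule Bochner_Integration.integral_diff[symmetric, OF i1 i2])
  finally show ?thesis by (simp add: algebra_simps)
qed

definition entrance_mean :: "real \<Rightarrow> (real \<Rightarrow> real) \<Rightarrow> real \<Rightarrow> real \<Rightarrow> real \<Rightarrow> real" where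
  "entrance_mean b \<phi> u a s = (\<integral>\<omega>. of_bool (s \<in> entrance_set (\<lambda>t. W t \<omega>) b u a) * \<phi> (W u \<omega>) \<partial>M)"

section \<open>The induction step: the law at time u from the laws before u - 1\<close>

context
  fixes b u B :: real and \<phi> :: "real \<Rightarrow> real"
  assumes b: "b \<le> 0" and \<phi> [measurable]: "\<phi> \<in> borel_measurable borel" and B: "\<And>x. \<bar>\<phi> x\<bar> \<le> B"
    and law: "\<And>s. 0 < s \<Longrightarrow> s < u - 1 \<Longrightarrow> stopped_law b s" and u: "0 < u"
begin

lemma B_nonneg: "0 \<le> B"
  using abs_ge_zero[of "\<phi> 0"] B[of 0] by linarith

lemma W_u_measurable [measurable]: "W u \<in> borel_measurable M"
  using u by (intro W_measurable) simp

text \<open>Not being stopped at \<open>s\<close> is an event of the past of \<open>s\<close>, so it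
  can serve as \<open>E\<close> in \<open>entrance_step\<close>; the known law at time
  \<open>s\<close> then turns the expectation into an integral over the position.\<close>

lemma entrance_mean_eq:
  assumes s: "0 < s" "s < u - 1" and a: "0 < a" "a \<le> 1/4"
  shows "entrance_mean b \<phi> u a s = (\<integral>x. (gk s x - h_formula 1 b s x) * heat a (killed b (1 - a) (heat (u - s - 1) \<phi>)) (b + \<bar>x - b\<bar>) \<partial>lborel)"
proof -
  let ?E = "{\<omega>\<in>space M. \<not> stopped (\<lambda>t. W t \<omega>) b s}"
  have "{\<omega>\<in>space (past s). \<not> stopped (\<lambda>t. W t \<omega>) b s} \<in> sets (past s)"
    using stopped_past[of b s] by (intro sets.sets_Collect_neg) simp
  then have E: "?E \<in> sets (past s)" by simp
  let ?g = "\<lambda>x. heat a (killed b (1 - a) (heat (u - s - 1) \<phi>)) (b + \<bar>x - b\<bar>)"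
  have us: "0 < u - s - 1" using s by simp
  have kb: "\<bar>killed b (1 - a) (heat (u - s - 1) \<phi>) x\<bar> \<le> 2 * B" for x
    using a by (intro killed_bound heat_bound[OF \<phi> B us]) auto
  have gb: "\<bar>?g x\<bar> \<le> 2 * B" for x
    using a by (intro heat_bound kb) auto
  have "entrance_mean b \<phi> u a s = (\<integral>\<omega>. indicator ?E \<omega> * (of_bool (below (\<lambda>t. W t \<omega>) b (s + a) (s + 1) \<and> \<not> below (\<lambda>t. W t \<omega>) b s (s + 1)) * \<phi> (W u \<omega>)) \<partial>M)"
    unfolding entrance_mean_def using s by (intro Bochner_Integration.integral_cong) (auto simp: indicator_def entrance_set_def)
  also have "\<dots> = (\<integral>\<omega>. indicator ?E \<omega> * ?g (W s \<omega>) \<partial>M)"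
    by (rule entrance_step[OF s a E \<phi> B])
  also have "\<dots> = (\<integral>x. (gk s x - h_formula 1 b s x) * ?g x \<partial>lborel)"
    by (rule not_stopped_density[OF s(1) law[OF s] _ gb]) measurable
  finally show ?thesis .
qed

text \<open>The free density is at most 1 / sqrt s and the formula is bounded up to time
  \<open>u\<close>, so the singularity at \<open>s = 0\<close> is integrable, uniformly in the
  position.\<close>

lemma not_stopped_density_bound:
  "\<exists>C\<ge>0. \<forall>s x. 0 < s \<and> s < u - 1 \<longrightarrow> \<bar>gk s x - h_formula 1 b s x\<bar> \<le> C / sqrt s"
proof -
  obtain H where H: "0 \<le> H" "\<And>s y. s \<le> u \<Longrightarrow> \<bar>h_formula 1 b s y\<bar> \<le> H" using h_formula_bounded[OF b, of u] by blast
  have "\<bar>gk s x - h_formula 1 b s x\<bar> \<le> (1 + H * sqrt u) / sqrt s" if s: "0 < s" "s < u - 1" for s x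
  proof -
    have "1 \<le> sqrt (2 * pi)" using pi_gt3 by (simp add: real_le_rsqrt)
    then have "1 * sqrt s \<le> sqrt (2 * pi) * sqrt s" using s by (intro mult_right_mono) auto
    then have "sqrt s \<le> sqrt (2 * pi * s)" by (simp add: real_sqrt_mult)
    then have "gk s x \<le> 1 / sqrt s" using gk_le[OF s(1), of x] s frac_le[of 1 1 "sqrt s" "sqrt (2 * pi * s)"] by simp
    moreover have "H \<le> H * sqrt u / sqrt s"
    proof -
      have "sqrt s \<le> sqrt u" using s by simp
      then have "H * sqrt s \<le> H * sqrt u" using H(1) by (rule mult_left_mono)
      then show ?thesis using s by (simp add: pos_le_divide_eq)
    qed
    moreover have "\<bar>gk s x - h_formula 1 b s x\<bar> \<le> \<bar>gk s x\<bar> + \<bar>h_formula 1 b s x\<bar>" by (rule abs_triangle_ineq4)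
    ultimately show ?thesis using H(2)[of s x] s by (simp add: add_divide_distrib)
  qed
  then show ?thesis using H(1) u by (intro exI[of _ "1 + H * sqrt u"]) auto
qed

lemma entrance_mean_bound:
  "\<exists>C\<ge>0. \<forall>s a. 0 < s \<and> s < u - 1 \<and> 0 < a \<and> a \<le> 1/4 \<longrightarrow> \<bar>1 / a * entrance_mean b \<phi> u a s\<bar> \<le> C / sqrt s"
proof -
  obtain C where C: "0 \<le> C" "\<And>s x. 0 < s \<Longrightarrow> s < u - 1 \<Longrightarrow> \<bar>gk s x - h_formula 1 b s x\<bar> \<le> C / sqrt s"
    using not_stopped_density_bound by blast
  have "\<bar>1 / a * entrance_mean b \<phi> u a s\<bar> \<le> (8 * sqrt (2 * pi) * C * B) / sqrt s"
    if s: "0 < s" "s < u - 1" and a: "0 < a" "a \<le> 1/4" for s a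
  proof -
    have us: "0 < u - s - 1" using s by simp
    have "\<bar>1 / a * entrance_mean b \<phi> u a s\<bar> \<le> 8 * sqrt (2 * pi) * (C / sqrt s) * B"
      unfolding entrance_mean_eq[OF s a]
      by (rule boundary_bound[OF _ heat_bound[OF \<phi> B us] a _ C(2)[OF s]])
        (use h_formula_measurable[OF b] in measurable)
    then show ?thesis by simp
  qed
  then show ?thesis using C(1) B_nonneg by (intro exI[of _ "8 * sqrt (2 * pi) * C * B"]) auto
qed

text \<open>This is \<open>boundary_limit\<close> with \<open>r\<close> the density at time
  \<open>s\<close> of the paths not yet stopped; it is continuous in the position, and its value at
  \<open>b\<close> is \<open>level_density b s\<close>.\<close>

lemma entrance_mean_limit:
  assumes s: "0 < s" "s < u - 1" and a: "\<And>n. 0 < a n" "\<And>n. a n \<le> 1/4" "a \<longlonglongrightarrow> 0"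
  shows "(\<lambda>n. 1 / a n * entrance_mean b \<phi> u (a n) s) \<longlonglongrightarrow> level_density b s * (\<integral>y. \<phi> y * exit_density b (u - s) y \<partial>lborel)"
proof -
  obtain C where C: "0 \<le> C" "\<And>s x. 0 < s \<Longrightarrow> s < u - 1 \<Longrightarrow> \<bar>gk s x - h_formula 1 b s x\<bar> \<le> C / sqrt s"
    using not_stopped_density_bound by blast
  have us: "0 < u - s - 1" "1 < u - s" using s by auto
  have cont: "isCont (\<lambda>x. gk s x - h_formula 1 b s x) b"
    using s(1) h_formula_isCont[OF b] unfolding gk_def normal_density_def by (intro continuous_intros) auto
  have "(\<lambda>n. 1 / a n * (\<integral>x. (gk s x - h_formula 1 b s x) * heat (a n) (killed b (1 - a n) (heat (u - s - 1) \<phi>)) (b + \<bar>x - b\<bar>) \<partial>lborel))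
    \<longlonglongrightarrow> (gk s b - h_formula 1 b s b) * (\<integral>x. indicator {0<..} x * (x * gk 1 x) * heat (u - s - 1) \<phi> (b - x) \<partial>lborel)"
    by (rule boundary_limit[OF _ heat_bound[OF \<phi> B us(1)] a _ C(2)[OF s] cont])
      (use h_formula_measurable[OF b] in measurable)
  then show ?thesis
    unfolding entrance_mean_eq[OF s a(1,2)] level_density_def exit_density_integral(2)[OF us(2) \<phi> B]
    by (simp add: diff_diff_eq2 diff_right_commute)
qed

text \<open>The length of the entrance set is the integral over \<open>s\<close> of its indicator,
  and exchanging it with the expectation leaves a quantity at a fixed time \<open>s\<close>.
  Integrability holds since the set lies in a bounded interval and \<open>\<phi>\<close> is
  bounded.\<close>

lemma entrance_fubini:
  assumes a: "0 < a"
  shows "(\<integral>\<omega>. measure lborel (entrance_set (\<lambda>t. W t \<omega>) b u a) * \<phi> (W u \<omega>) \<partial>M)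
    = (\<integral>s. indicator {0<..<u - 1} s * entrance_mean b \<phi> u a s \<partial>lborel)"
    and "(\<lambda>s. entrance_mean b \<phi> u a s) \<in> borel_measurable borel"
    and "\<And>\<omega>. \<omega> \<in> space M \<Longrightarrow> entrance_set (\<lambda>t. W t \<omega>) b u a \<in> sets lborel"
    and "(\<lambda>\<omega>. measure lborel (entrance_set (\<lambda>t. W t \<omega>) b u a)) \<in> borel_measurable M"
proof -
  interpret P: pair_sigma_finite lborel M ..
  let ?S = "{x\<in>space (borel \<Otimes>\<^sub>M M). fst x \<in> entrance_set (\<lambda>t. W t (snd x)) b u a}"
  have S: "?S \<in> sets (borel \<Otimes>\<^sub>M M)" by (rule entrance_set_joint[OF a])
  have S': "?S \<in> sets (lborel \<Otimes>\<^sub>M M)" using S by (simp cong: sets_pair_measure_cong)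
  have [measurable]: "Measurable.pred (borel \<Otimes>\<^sub>M M) (\<lambda>x. fst x \<in> entrance_set (\<lambda>t. W t (snd x)) b u a)"
    using S by (simp add: pred_def)
  have F: "(\<lambda>x. of_bool (fst x \<in> entrance_set (\<lambda>t. W t (snd x)) b u a) * \<phi> (W u (snd x))) \<in> borel_measurable (borel \<Otimes>\<^sub>M M)"
    by measurable
  then have F': "(\<lambda>(s, \<omega>). of_bool (s \<in> entrance_set (\<lambda>t. W t \<omega>) b u a) * \<phi> (W u \<omega>)) \<in> borel_measurable (lborel \<Otimes>\<^sub>M M)"
    by (simp add: case_prod_beta' cong: measurable_cong_sets sets_pair_measure_cong)
  have sec: "(\<lambda>s. (s, \<omega>)) -` ?S = entrance_set (\<lambda>t. W t \<omega>) b u a" if "\<omega> \<in> space M" for \<omega>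
    using that by (auto simp: space_pair_measure)
  show es: "entrance_set (\<lambda>t. W t \<omega>) b u a \<in> sets lborel" if "\<omega> \<in> space M" for \<omega>
    using sets_Pair2[OF S', of \<omega>] unfolding sec[OF that] .
  have "(\<lambda>\<omega>. emeasure lborel ((\<lambda>s. (s, \<omega>)) -` ?S)) \<in> borel_measurable M"
    by (rule P.measurable_emeasure_Pair2[OF S'])
  then have "(\<lambda>\<omega>. emeasure lborel (entrance_set (\<lambda>t. W t \<omega>) b u a)) \<in> borel_measurable M"
    by (rule measurable_cong[THEN iffD1, rotated]) (simp only: sec)
  then show "(\<lambda>\<omega>. measure lborel (entrance_set (\<lambda>t. W t \<omega>) b u a)) \<in> borel_measurable M"
    unfolding measure_def by measurable
  show "(\<lambda>s. entrance_mean b \<phi> u a s) \<in> borel_measurable borel"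
    unfolding entrance_mean_def using F by (intro borel_measurable_lebesgue_integral) (simp add: case_prod_beta')
  have int: "integrable (lborel \<Otimes>\<^sub>M M) (\<lambda>(s, \<omega>). of_bool (s \<in> entrance_set (\<lambda>t. W t \<omega>) b u a) * \<phi> (W u \<omega>))"
  proof (rule integrableI_bounded_set[where A="{0<..<u - 1} \<times> space M" and B=B])
    show "emeasure (lborel \<Otimes>\<^sub>M M) ({0<..<u - 1} \<times> space M) < \<infinity>"
      using emeasure_bounded_finite[of "{0<..<u - 1}"] by (subst emeasure_pair_measure_Times) (auto simp: emeasure_space_1)
    show "{0<..<u - 1} \<times> space M \<in> sets (lborel \<Otimes>\<^sub>M M)" by (intro pair_measureI) auto
    have "norm (of_bool c * \<phi> x) \<le> B" for c x using B[of x] B_nonneg by simp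
    then show "AE x in lborel \<Otimes>\<^sub>M M. x \<in> {0<..<u - 1} \<times> space M \<longrightarrow>
        norm (case x of (s, \<omega>) \<Rightarrow> of_bool (s \<in> entrance_set (\<lambda>t. W t \<omega>) b u a) * \<phi> (W u \<omega>)) \<le> B"
      by (intro AE_I2) (simp only: case_prod_beta' simp_thms)
    show "AE x in lborel \<Otimes>\<^sub>M M. x \<notin> {0<..<u - 1} \<times> space M \<longrightarrow>
        (case x of (s, \<omega>) \<Rightarrow> of_bool (s \<in> entrance_set (\<lambda>t. W t \<omega>) b u a) * \<phi> (W u \<omega>)) = 0"
      by (intro AE_I2) (auto simp: space_pair_measure entrance_set_def)
  qed (rule F')
  have fub: "(\<integral>\<omega>. (\<integral>s. of_bool (s \<in> entrance_set (\<lambda>t. W t \<omega>) b u a) * \<phi> (W u \<omega>) \<partial>lborel) \<partial>M) = (\<integral>s. entrance_mean b \<phi> u a s \<partial>lborel)"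
    unfolding entrance_mean_def by (rule P.Fubini_integral[OF int])
  have sec_int: "(\<integral>s. of_bool (s \<in> entrance_set (\<lambda>t. W t \<omega>) b u a) * \<phi> (W u \<omega>) \<partial>lborel) = measure lborel (entrance_set (\<lambda>t. W t \<omega>) b u a) * \<phi> (W u \<omega>)"
    if "\<omega> \<in> space M" for \<omega>
  proof -
    have "(\<integral>s. of_bool (s \<in> entrance_set (\<lambda>t. W t \<omega>) b u a) * \<phi> (W u \<omega>) \<partial>lborel) = (\<integral>s. indicator (entrance_set (\<lambda>t. W t \<omega>) b u a) s * \<phi> (W u \<omega>) \<partial>lborel)"
      by (intro Bochner_Integration.integral_cong) (auto simp: indicator_def)
    then show ?thesis by simp
  qed
  have supp: "entrance_mean b \<phi> u a s = indicator {0<..<u - 1} s * entrance_mean b \<phi> u a s" for s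
  proof (cases "s \<in> {0<..<u - 1}")
    case False
    then have "s \<notin> entrance_set w b u a" for w by (auto simp: entrance_set_def)
    then show ?thesis by (simp add: entrance_mean_def)
  qed simp
  have "(\<integral>\<omega>. measure lborel (entrance_set (\<lambda>t. W t \<omega>) b u a) * \<phi> (W u \<omega>) \<partial>M)
    = (\<integral>\<omega>. (\<integral>s. of_bool (s \<in> entrance_set (\<lambda>t. W t \<omega>) b u a) * \<phi> (W u \<omega>) \<partial>lborel) \<partial>M)"
    by (intro Bochner_Integration.integral_cong refl sec_int[symmetric])
  also have "\<dots> = (\<integral>s. indicator {0<..<u - 1} s * entrance_mean b \<phi> u a s \<partial>lborel)"
    unfolding fub by (intro Bochner_Integration.integral_cong refl supp)
  finally show "(\<integral>\<omega>. measure lborel (entrance_set (\<lambda>t. W t \<omega>) b u a) * \<phi> (W u \<omega>) \<partial>M)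
    = (\<integral>s. indicator {0<..<u - 1} s * entrance_mean b \<phi> u a s \<partial>lborel)" .
qed

text \<open>Almost surely the length divided by \<open>a n\<close> is eventually exactly 1 or
  exactly 0, according to whether the path is stopped by time \<open>u\<close>;
  \<open>emeasure_entrance_set\<close> supplies the constant majorant.\<close>

lemma entrance_measure_limit:
  assumes a: "\<And>n. 0 < a n" "\<And>n. a n \<le> 1/4" "a \<longlonglongrightarrow> 0"
  shows "(\<lambda>n. \<integral>\<omega>. 1 / a n * (measure lborel (entrance_set (\<lambda>t. W t \<omega>) b u (a n)) * \<phi> (W u \<omega>)) \<partial>M)
    \<longlonglongrightarrow> (\<integral>\<omega>. of_bool (stopped (\<lambda>t. W t \<omega>) b u) * \<phi> (W u \<omega>) \<partial>M)"
proof (rule integral_dominated_convergence[where w="\<lambda>_. real (nat \<lceil>2 * u\<rceil>) * B"])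
  let ?m = "\<lambda>n \<omega>. measure lborel (entrance_set (\<lambda>t. W t \<omega>) b u (a n))"
  have [measurable]: "?m n \<in> borel_measurable M" for n by (rule entrance_fubini(4)[OF a(1)])
  show "(\<lambda>\<omega>. 1 / a n * (?m n \<omega> * \<phi> (W u \<omega>))) \<in> borel_measurable M" for n by measurable
  show "(\<lambda>\<omega>. of_bool (stopped (\<lambda>t. W t \<omega>) b u) * \<phi> (W u \<omega>)) \<in> borel_measurable M"
    using stopped_pred by measurable
  show "AE \<omega> in M. norm (1 / a n * (?m n \<omega> * \<phi> (W u \<omega>))) \<le> real (nat \<lceil>2 * u\<rceil>) * B" for n
  proof (rule AE_I2)
    fix \<omega> assume w: "\<omega> \<in> space M"
    have "emeasure lborel (entrance_set (\<lambda>t. W t \<omega>) b u (a n)) \<le> ennreal (real (nat \<lceil>2 * u\<rceil>) * a n)"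
      by (rule emeasure_entrance_set[OF a(1,2) entrance_fubini(3)[OF a(1) w]])
    then have "?m n \<omega> \<le> real (nat \<lceil>2 * u\<rceil>) * a n"
      unfolding measure_def using a(1)[of n] by (intro enn2real_leI) auto
    then have "?m n \<omega> / a n \<le> real (nat \<lceil>2 * u\<rceil>)" using a(1)[of n] by (simp add: pos_divide_le_eq)
    then have "(?m n \<omega> / a n) * \<bar>\<phi> (W u \<omega>)\<bar> \<le> real (nat \<lceil>2 * u\<rceil>) * B"
      using a(1)[of n] by (intro mult_mono B) auto
    then show "norm (1 / a n * (?m n \<omega> * \<phi> (W u \<omega>))) \<le> real (nat \<lceil>2 * u\<rceil>) * B"
      using a(1)[of n] by (simp add: abs_mult)
  qed
  show "AE \<omega> in M. (\<lambda>n. 1 / a n * (?m n \<omega> * \<phi> (W u \<omega>))) \<longlonglongrightarrow> of_bool (stopped (\<lambda>t. W t \<omega>) b u) * \<phi> (W u \<omega>)"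
    using AE_not_below_start[OF b] AE_no_adjacent[of b] AE_space
  proof eventually_elim
    case (elim \<omega>)
    let ?w = "\<lambda>t. W t \<omega>"
    have c: "continuous_on {0..} ?w" by (rule W_continuous[OF elim(3)])
    have "eventually (\<lambda>n. of_bool (stopped ?w b u) * \<phi> (W u \<omega>) = 1 / a n * (?m n \<omega> * \<phi> (W u \<omega>))) sequentially"
    proof (cases "stopped ?w b u")
      case True
      have "\<exists>a0>0. \<forall>a. 0 < a \<and> a < a0 \<longrightarrow> (\<exists>g. entrance_set ?w b u a = {g - a..<g})"
        by (rule entrance_set_stopped[OF c elim(1) _ True]) (use elim(2) in blast)
      then obtain a0 where a0: "a0 > 0" "\<And>a. 0 < a \<Longrightarrow> a < a0 \<Longrightarrow> \<exists>g. entrance_set ?w b u a = {g - a..<g}" by blast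
      from order_tendstoD(2)[OF a(3) a0(1)] show ?thesis
      proof eventually_elim
        case (elim n)
        obtain g where "entrance_set ?w b u (a n) = {g - a n..<g}" using a0(2)[OF a(1) elim] by blast
        then have "?m n \<omega> = a n" using a(1)[of n] by simp
        then show ?case using True a(1)[of n] by simp
      qed
    next
      case False
      obtain a0 where a0: "a0 > 0" "\<And>a. 0 < a \<Longrightarrow> a < a0 \<Longrightarrow> entrance_set ?w b u a = {}"
        using entrance_set_not_stopped[OF False] by blast
      from order_tendstoD(2)[OF a(3) a0(1)] show ?thesis
        by eventually_elim (use False a0(2) a(1) in simp)
    qed
    then show ?case by (rule Lim_transform_eventually[OF tendsto_const])
  qed
qed simp

text \<open>The level density is dominated by C / sqrt s and the exit density has the same finite
  mass for all \<open>s\<close>, so the double integral converges absolutely. The integrability of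
  \<open>\<phi>\<close> times the formula is a by-product that the induction hypothesis asks
  for.\<close>

lemma renewal_fubini:
  "integrable lborel (\<lambda>y. \<phi> y * h_formula 1 b u y)"
  "(\<integral>s. indicator {0<..<u - 1} s * (level_density b s * (\<integral>y. \<phi> y * exit_density b (u - s) y \<partial>lborel)) \<partial>lborel)
    = (\<integral>y. \<phi> y * h_formula 1 b u y \<partial>lborel)"
proof -
  let ?l = "\<lambda>s. indicator {0<..<u - 1} s * level_density b s"
  let ?F = "\<lambda>s y. ?l s * (\<phi> y * exit_density b (u - s) y)"
  have [measurable]: "?l \<in> borel_measurable borel" by (rule level_density_measurable[OF b])
  obtain C where C: "0 \<le> C" "\<And>s. 0 < s \<Longrightarrow> s < u - 1 \<Longrightarrow> \<bar>level_density b s\<bar> \<le> C / sqrt s"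
    using not_stopped_density_bound unfolding level_density_def by blast
  let ?K = "\<integral>x. indicator {0<..} x * (x * gk 1 x) \<partial>lborel"
  have ex: "integrable lborel (\<lambda>y. \<phi> y * exit_density b (u - s) y)"
    and nb: "(\<integral>y. norm (\<phi> y * exit_density b (u - s) y) \<partial>lborel) \<le> B * ?K" if s: "0 < s" "s < u - 1" for s
  proof -
    have r: "1 < u - s" using s by simp
    show i: "integrable lborel (\<lambda>y. \<phi> y * exit_density b (u - s) y)" by (rule exit_density_integral(1)[OF r \<phi> B])
    have i1: "integrable lborel (\<lambda>y. 1 * exit_density b (u - s) y)" by (rule exit_density_integral(1)[OF r, where B=1]) auto
    have "(\<integral>y. norm (\<phi> y * exit_density b (u - s) y) \<partial>lborel) \<le> (\<integral>y. B * (1 * exit_density b (u - s) y) \<partial>lborel)"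
      using exit_density_nonneg[OF r] by (intro integral_mono integrable_norm i integrable_mult_right i1) (auto simp: abs_mult intro!: mult_right_mono B)
    also have "\<dots> = B * (\<integral>x. indicator {0<..} x * (x * gk 1 x) * heat (u - s - 1) (\<lambda>_. 1) (b - x) \<partial>lborel)"
      by (subst integral_mult_right_zero, subst exit_density_integral(2)[OF r, where B=1]) auto
    also have "heat (u - s - 1) (\<lambda>_. 1) = (\<lambda>_. 1)" using s by (simp add: heat_def fun_eq_iff)
    finally show "(\<integral>y. norm (\<phi> y * exit_density b (u - s) y) \<partial>lborel) \<le> B * ?K" by simp
  qed
  have int: "integrable (lborel \<Otimes>\<^sub>M lborel) (\<lambda>(s, y). ?F s y)"
  proof (rule lborel_pair.Fubini_integrable)
    show "AE s in lborel. integrable lborel (\<lambda>y. case (s, y) of (s, y) \<Rightarrow> ?F s y)"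
    proof (rule AE_I2)
      fix s
      show "integrable lborel (\<lambda>y. case (s, y) of (s, y) \<Rightarrow> ?F s y)"
      proof (cases "0 < s \<and> s < u - 1")
        case True then show ?thesis using ex[of s] by simp
      qed (auto simp: indicator_def)
    qed
    show "integrable lborel (\<lambda>s. \<integral>y. norm (case (s, y) of (s, y) \<Rightarrow> ?F s y) \<partial>lborel)"
    proof (cases "0 < u - 1")
      case True
      show ?thesis unfolding prod.case
      proof (rule abs_integral_le(1))
        show "integrable lborel (\<lambda>s. C * (B * ?K) * (indicator {0<..<u - 1} s * (1 / sqrt s)))"
          by (intro integrable_mult_right integrable.intros[OF has_bochner_integral_inverse_sqrt[OF True]])
        show "\<bar>\<integral>y. norm (?F s y) \<partial>lborel\<bar> \<le> C * (B * ?K) * (indicator {0<..<u - 1} s * (1 / sqrt s))" for s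
        proof (cases "0 < s \<and> s < u - 1")
          case s: True
          have "(\<integral>y. norm (?F s y) \<partial>lborel) = \<bar>level_density b s\<bar> * (\<integral>y. norm (\<phi> y * exit_density b (u - s) y) \<partial>lborel)"
            using s by (simp add: abs_mult)
          also have "\<dots> \<le> (C / sqrt s) * (B * ?K)"
            using s C by (intro mult_mono nb) auto
          finally have "(\<integral>y. norm (?F s y) \<partial>lborel) \<le> (C / sqrt s) * (B * ?K)" .
          moreover have "0 \<le> (\<integral>y. norm (?F s y) \<partial>lborel)" by (intro integral_nonneg_AE AE_I2) simp
          ultimately show ?thesis using s by (simp add: mult_ac)
        qed (auto simp: indicator_def)
      qed measurable
    qed (simp add: indicator_def)
  qed measurable
  have e: "(\<integral>s. ?F s y \<partial>lborel) = \<phi> y * h_formula 1 b u y" for y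
    unfolding h_formula_renewal[OF b] by (subst integral_mult_right_zero[symmetric]) (simp add: mult_ac)
  show "integrable lborel (\<lambda>y. \<phi> y * h_formula 1 b u y)"
    using lborel_pair.integrable_snd[OF int] unfolding e .
  show "(\<integral>s. indicator {0<..<u - 1} s * (level_density b s * (\<integral>y. \<phi> y * exit_density b (u - s) y \<partial>lborel)) \<partial>lborel)
    = (\<integral>y. \<phi> y * h_formula 1 b u y \<partial>lborel)"
    using lborel_pair.Fubini_integral[OF int] unfolding e by (simp add: mult.assoc)
qed

text \<open>The mean length divided by \<open>a\<close> is evaluated in the limit twice: path by
  path it gives the left side, time by time the renewal integral. Limits are unique.\<close>

lemma stopped_law_step:
  "(\<integral>\<omega>. of_bool (stopped (\<lambda>t. W t \<omega>) b u) * \<phi> (W u \<omega>) \<partial>M) = (\<integral>y. \<phi> y * h_formula 1 b u y \<partial>lborel)"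
proof -
  \<comment> \<open>A concrete sequence tending to 0; the 4 keeps it in the range
    \<open>a \<le> 1/4\<close> of the estimates.\<close>
  define a :: "nat \<Rightarrow> real" where "a n = 1 / (real n + 4)" for n
  have a: "0 < a n" "a n \<le> 1/4" for n by (auto simp: a_def field_simps)
  have a0: "a \<longlonglongrightarrow> 0" unfolding a_def by real_asymp
  obtain C where C: "0 \<le> C" "\<And>s a. 0 < s \<Longrightarrow> s < u - 1 \<Longrightarrow> 0 < a \<Longrightarrow> a \<le> 1/4 \<Longrightarrow> \<bar>1 / a * entrance_mean b \<phi> u a s\<bar> \<le> C / sqrt s"
    using entrance_mean_bound by blast
  have [measurable]: "(\<lambda>s. entrance_mean b \<phi> u (a n) s) \<in> borel_measurable borel" for n by (rule entrance_fubini(2)[OF a(1)])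
  let ?I = "\<lambda>s. indicator {0<..<u - 1} s * (level_density b s * (\<integral>y. \<phi> y * exit_density b (u - s) y \<partial>lborel))"
  have Im: "?I \<in> borel_measurable borel"
  proof -
    have [measurable]: "(\<lambda>s. indicator {0<..<u - 1} s * level_density b s) \<in> borel_measurable borel" by (rule level_density_measurable[OF b])
    have "(\<lambda>s. (indicator {0<..<u - 1} s * level_density b s) * (\<integral>y. \<phi> y * exit_density b (u - s) y \<partial>lborel)) \<in> borel_measurable borel"
      by measurable
    then show ?thesis by (simp add: mult.assoc)
  qed
  have "(\<lambda>n. \<integral>s. indicator {0<..<u - 1} s * (1 / a n * entrance_mean b \<phi> u (a n) s) \<partial>lborel) \<longlonglongrightarrow> integral\<^sup>L lborel ?I"
  proof (cases "0 < u - 1")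
    case True
    show ?thesis
    proof (rule integral_dominated_convergence[where w="\<lambda>s. C * (indicator {0<..<u - 1} s * (1 / sqrt s))"])
      show "integrable lborel (\<lambda>s. C * (indicator {0<..<u - 1} s * (1 / sqrt s)))"
        by (intro integrable_mult_right integrable.intros[OF has_bochner_integral_inverse_sqrt[OF True]])
      show "AE s in lborel. (\<lambda>n. indicator {0<..<u - 1} s * (1 / a n * entrance_mean b \<phi> u (a n) s)) \<longlonglongrightarrow> ?I s"
      proof (rule AE_I2)
        fix s
        show "(\<lambda>n. indicator {0<..<u - 1} s * (1 / a n * entrance_mean b \<phi> u (a n) s)) \<longlonglongrightarrow> ?I s"
        proof (cases "0 < s \<and> s < u - 1")
          case True
          then show ?thesis by (intro tendsto_mult tendsto_const entrance_mean_limit a a0) auto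
        qed (auto simp: indicator_def)
      qed
      show "AE s in lborel. norm (indicator {0<..<u - 1} s * (1 / a n * entrance_mean b \<phi> u (a n) s)) \<le> C * (indicator {0<..<u - 1} s * (1 / sqrt s))" for n
      proof (rule AE_I2)
        fix s
        show "norm (indicator {0<..<u - 1} s * (1 / a n * entrance_mean b \<phi> u (a n) s)) \<le> C * (indicator {0<..<u - 1} s * (1 / sqrt s))"
          using C(2)[OF _ _ a, of s n] by (cases "0 < s \<and> s < u - 1") (auto simp: indicator_def)
      qed
    qed (use Im in measurable)
  qed (simp add: indicator_def)
  moreover have "(\<integral>s. indicator {0<..<u - 1} s * (1 / a n * entrance_mean b \<phi> u (a n) s) \<partial>lborel) =
     (\<integral>\<omega>. 1 / a n * (measure lborel (entrance_set (\<lambda>t. W t \<omega>) b u (a n)) * \<phi> (W u \<omega>)) \<partial>M)" for n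
  proof -
    have "(\<integral>s. indicator {0<..<u - 1} s * (1 / a n * entrance_mean b \<phi> u (a n) s) \<partial>lborel) = (\<integral>s. 1 / a n * (indicator {0<..<u - 1} s * entrance_mean b \<phi> u (a n) s) \<partial>lborel)"
      by (intro Bochner_Integration.integral_cong) auto
    also have "\<dots> = 1 / a n * (\<integral>s. indicator {0<..<u - 1} s * entrance_mean b \<phi> u (a n) s \<partial>lborel)"
      by (rule integral_mult_right_zero)
    also have "\<dots> = (\<integral>\<omega>. 1 / a n * (measure lborel (entrance_set (\<lambda>t. W t \<omega>) b u (a n)) * \<phi> (W u \<omega>)) \<partial>M)"
      unfolding entrance_fubini(1)[OF a(1), symmetric] by (rule integral_mult_right_zero[symmetric])
    finally show ?thesis .
  qed
  ultimately have "(\<lambda>n. \<integral>\<omega>. 1 / a n * (measure lborel (entrance_set (\<lambda>t. W t \<omega>) b u (a n)) * \<phi> (W u \<omega>)) \<partial>M) \<longlonglongrightarrow> integral\<^sup>L lborel ?I"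
    by (simp only:)
  from LIMSEQ_unique[OF entrance_measure_limit[OF a a0] this]
  show ?thesis unfolding renewal_fubini(2) .
qed

end

text \<open>Times before \<open>u - 1\<close> belong to earlier unit blocks, so induction on
  \<open>k\<close> closes. For \<open>u \<le> 1\<close> no such positive time exists, and the step
  yields 0 on both sides.\<close>

lemma stopped_law:
  assumes b: "b \<le> 0"
  shows "0 < u \<Longrightarrow> stopped_law b u"
proof -
  have "\<forall>u. 0 < u \<longrightarrow> u \<le> real k \<longrightarrow> stopped_law b u" for k
  proof (induction k)
    case (Suc k)
    show ?case
    proof (intro allI impI)
      fix u assume u: "0 < u" "u \<le> real (Suc k)"
      have law: "stopped_law b s" if "0 < s" "s < u - 1" for s using Suc that u by simp
      show "stopped_law b u"
        unfolding stopped_law_def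
      proof (intro allI impI conjI)
        fix \<phi> :: "real \<Rightarrow> real" and B
        assume \<phi>: "\<phi> \<in> borel_measurable borel" and "\<forall>x. \<bar>\<phi> x\<bar> \<le> B"
        then have B: "\<bar>\<phi> x\<bar> \<le> B" for x by blast
        show "integrable lborel (\<lambda>y. \<phi> y * h_formula 1 b u y)"
          by (rule renewal_fubini(1)[OF b \<phi> B law u(1)])
        show "(\<integral>\<omega>. of_bool (stopped (\<lambda>t. W t \<omega>) b u) * \<phi> (W u \<omega>) \<partial>M) = (\<integral>y. \<phi> y * h_formula 1 b u y \<partial>lborel)"
          by (rule stopped_law_step[OF b \<phi> B law u(1)])
      qed
    qed
  qed simp
  then show "0 < u \<Longrightarrow> stopped_law b u" using real_arch_simple[of u] by blast
qed

end

section \<open>Scaling\<close>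

lemma below_scale:
  assumes "0 < D"
  shows "below (\<lambda>t. w (D * t) / sqrt D) (b / sqrt D) p q \<longleftrightarrow> below w b (D * p) (D * q)"
  unfolding below_def
proof safe
  fix v assume H: "\<forall>v. p < v \<and> v < q \<longrightarrow> w (D * v) / sqrt D < b / sqrt D" and v: "D * p < v" "v < D * q"
  have "p < v / D" "v / D < q" using v assms by (auto simp: pos_less_divide_eq pos_divide_less_eq mult.commute)
  then have "w (D * (v / D)) / sqrt D < b / sqrt D" using H by blast
  then show "w v < b" using assms by (simp add: divide_less_cancel)
next
  fix v assume H: "\<forall>v. D * p < v \<and> v < D * q \<longrightarrow> w v < b" and v: "p < v" "v < q"
  have "w (D * v) < b" using H v assms by simp
  then show "w (D * v) / sqrt D < b / sqrt D" using assms by (simp add: divide_strict_right_mono)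
qed

text \<open>An excursion of length \<open>D\<close> ending at \<open>s\<close> corresponds to the
  start s / D - 1 in rescaled time; \<open>stopped\<close> records starts whereas
  \<open>H_time\<close> records ends.\<close>

lemma H_time_le_iff_stopped:
  assumes D: "0 < D"
  shows "H_time D b W \<omega> \<le> ereal u \<longleftrightarrow> stopped (\<lambda>t. W (D * t) \<omega> / sqrt D) (b / sqrt D) (u / D)"
proof
  assume "H_time D b W \<omega> \<le> ereal u"
  then obtain s where s: "D \<le> s" "s \<le> u" "below (\<lambda>t. W t \<omega>) b (s - D) s"
    unfolding H_time_le_iff[OF D] by blast
  have "D * (s / D - 1) = s - D" "D * (s / D - 1 + 1) = s" using D by (auto simp: field_simps)
  moreover have "0 \<le> s / D - 1" "s / D - 1 \<le> u / D - 1" using s D by (auto simp: divide_right_mono)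
  ultimately show "stopped (\<lambda>t. W (D * t) \<omega> / sqrt D) (b / sqrt D) (u / D)"
    using s(3) unfolding stopped_def below_scale[OF D, of "\<lambda>t. W t \<omega>"]
    by (intro exI[of _ "s / D - 1"]) simp
next
  assume "stopped (\<lambda>t. W (D * t) \<omega> / sqrt D) (b / sqrt D) (u / D)"
  then obtain g where g: "0 \<le> g" "g \<le> u / D - 1" "below (\<lambda>t. W t \<omega>) b (D * g) (D * (g + 1))"
    unfolding stopped_def below_scale[OF D, of "\<lambda>t. W t \<omega>"] by blast
  have "D \<le> D * (g + 1)" using g D by simp
  moreover have "g + 1 \<le> u / D" using g by simp
  then have "D * (g + 1) \<le> u" using D by (simp add: pos_le_divide_eq mult.commute)
  moreover have "D * (g + 1) - D = D * g" by (simp add: algebra_simps)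
  ultimately show "H_time D b W \<omega> \<le> ereal u"
    unfolding H_time_le_iff[OF D] using g(3) by (intro exI[of _ "D * (g + 1)"]) simp
qed

lemma std_BM_scale:
  assumes BM: "std_BM M W" and D: "0 < D"
  shows "std_BM M (\<lambda>t \<omega>. W (D * t) \<omega> / sqrt D)"
proof -
  interpret brownian M W by unfold_locales (rule BM)
  have "distributed M lborel (\<lambda>\<omega>. W (D * t) \<omega> / sqrt D - W (D * s) \<omega> / sqrt D) (normal_density 0 (sqrt (t - s)))"
    if st: "0 \<le> s" "s < t" for s t
  proof -
    have "distributed M lborel (\<lambda>\<omega>. W (D * t) \<omega> - W (D * s) \<omega>) (normal_density 0 (sqrt (D * t - D * s)))"
      using BM st D by (simp add: std_BM_def)
    from normal_density_affine[OF this, of "1 / sqrt D" 0]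
    have "distributed M lborel (\<lambda>\<omega>. 0 + 1 / sqrt D * (W (D * t) \<omega> - W (D * s) \<omega>))
      (normal_density (0 + 1 / sqrt D * 0) (\<bar>1 / sqrt D\<bar> * sqrt (D * t - D * s)))"
      using st D by simp
    moreover have "\<bar>1 / sqrt D\<bar> * sqrt (D * t - D * s) = sqrt (t - s)"
      using D by (simp add: right_diff_distrib[symmetric] real_sqrt_mult)
    ultimately show ?thesis by (simp add: diff_divide_distrib)
  qed
  moreover have "indep_vars (\<lambda>_. borel) (\<lambda>i \<omega>. W (D * ts (Suc i)) \<omega> / sqrt D - W (D * ts i) \<omega> / sqrt D) {..<n}"
    if ts: "0 \<le> ts 0" "\<forall>i<n. ts i < ts (Suc i)" for ts :: "nat \<Rightarrow> real" and n
  proof -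
    have "indep_vars (\<lambda>_. borel) (\<lambda>i \<omega>. W (D * ts (Suc i)) \<omega> - W (D * ts i) \<omega>) {..<n}"
      using W_indep[of "\<lambda>i. D * ts i" n] ts D by simp
    from indep_vars_compose2[OF this, of "\<lambda>_ x. x / sqrt D" "\<lambda>_. borel"] show ?thesis
      by (simp add: diff_divide_distrib)
  qed
  moreover have "continuous_on {0..} (\<lambda>t. W (D * t) \<omega> / sqrt D)" if "\<omega> \<in> space M" for \<omega>
    using D by (intro continuous_intros continuous_on_compose2[OF W_continuous[OF that]]) auto
  moreover have "(\<lambda>\<omega>. W (D * t) \<omega> / sqrt D) \<in> borel_measurable M" if "0 \<le> t" for t
    using W_measurable[of "D * t"] that D by simp
  ultimately show ?thesis
    using prob_space_axioms W_zero unfolding std_BM_def by simp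
qed

lemma conv_nu_pow_scale: "conv_nu_pow (\<lambda>u. k * f u) n = (\<lambda>u. k * conv_nu_pow f n u)"
proof (induction n)
  case (Suc n)
  have "conv (\<lambda>u. k * conv_nu_pow f n u) nu t = k * conv (conv_nu_pow f n) nu t" for t
    unfolding conv_def set_lebesgue_integral_def
    by (subst integral_mult_right_zero[symmetric]) (simp add: mult_ac)
  then show ?case by (simp add: Suc)
qed simp

text \<open>The factor \<open>sqrt D\<close> of \<open>rho\<close> passes through all convolutions
  by \<open>conv_nu_pow_scale\<close>; with 1 / D it leaves 1 / sqrt D, the Jacobian of the change
  to the scaled position.\<close>

lemma h_formula_scale:
  assumes D: "0 < D"
  shows "h_formula D b u y = h_formula 1 (b / sqrt D) (u / D) (y / sqrt D) / sqrt D"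
proof -
  have rho: "rho D a c = (\<lambda>u. sqrt D * rho 1 a c u)" for a c by (auto simp: rho_def fun_eq_iff)
  let ?A = "{n::nat. 1 \<le> n \<and> real n < u / D}"
  let ?f = "\<lambda>n. (-1) ^ (n - 1) / (2 * pi) powr (real n / 2) * conv_nu_pow (rho 1 (b / sqrt D) ((b - y) / sqrt D)) (n - 1) ((u / D - real n) / 2)"
  have "h_formula D b u y = 1 / (2 * D) * (\<Sum>n\<in>?A. sqrt D * ?f n)"
    unfolding h_formula_def rho conv_nu_pow_scale
    by (rule arg_cong2[where f="(*)", OF refl], rule sum.cong[OF refl]) (simp add: mult_ac)
  also have "\<dots> = (sqrt D / D) * (1 / 2 * (\<Sum>n\<in>?A. ?f n))"
    unfolding sum_distrib_left[symmetric] by simp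
  also have "sqrt D / D = 1 / sqrt D" using D by (simp add: real_div_sqrt field_simps)
  also have "1 / 2 * (\<Sum>n\<in>?A. ?f n) = h_formula 1 (b / sqrt D) (u / D) (y / sqrt D)"
    by (simp add: h_formula_def diff_divide_distrib)
  finally show ?thesis by simp
qed

theorem theorem3p1:
  fixes M :: "'a measure" and W :: "real \<Rightarrow> 'a \<Rightarrow> real" and D b u :: real
    and \<phi> :: "real \<Rightarrow> real"
  assumes "D > 0" and "b \<le> 0" and "std_BM M W"
    and "u > 0" and "\<phi> \<in> borel_measurable borel" and "bounded (range \<phi>)"
  shows "integrable lborel (\<lambda>y. \<phi> y * h_formula D b u y) \<and>
    (\<integral>\<omega>. indicator {\<omega>\<in>space M. H_time D b W \<omega> \<le> ereal u} \<omega> * \<phi> (W u \<omega>) \<partial>M)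
      = (\<integral>y. \<phi> y * h_formula D b u y \<partial>lborel)"
proof -
  note D = \<open>D > 0\<close>
  obtain B where B: "\<And>x. \<bar>\<phi> x\<bar> \<le> B" using assms(6) by (auto simp: bounded_iff)
  interpret brownian M "\<lambda>t \<omega>. W (D * t) \<omega> / sqrt D"
    by unfold_locales (rule std_BM_scale[OF assms(3) D])
  let ?h = "h_formula 1 (b / sqrt D) (u / D)"
  have "b / sqrt D \<le> 0" "0 < u / D" using assms by (auto simp: divide_nonpos_pos)
  note stopped = stopped_law[OF this]
  \<comment> \<open>The test function in the scaled variable: evaluated at the scaled path it gives
    \<open>\<phi> (W u)\<close> back.\<close>
  have \<phi>m: "(\<lambda>x. \<phi> (sqrt D * x)) \<in> borel_measurable borel" using assms(5) by measurable
  have law: "integrable lborel (\<lambda>y. \<phi> (sqrt D * y) * ?h y)"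
    "(\<integral>\<omega>. of_bool (stopped (\<lambda>t. W (D * t) \<omega> / sqrt D) (b / sqrt D) (u / D)) * \<phi> (sqrt D * (W (D * (u / D)) \<omega> / sqrt D)) \<partial>M)
     = (\<integral>y. \<phi> (sqrt D * y) * ?h y \<partial>lborel)"
    using stopped[unfolded stopped_law_def, rule_format, OF \<phi>m B] by blast+
  have s: "sqrt D \<noteq> 0" "sqrt D > 0" using D by auto
  \<comment> \<open>The factor 1 / sqrt D on the right is cancelled by the Jacobian of the
    substitution in the integral below.\<close>
  have e: "\<phi> (0 + sqrt D * y) * h_formula D b u (0 + sqrt D * y) = (\<phi> (sqrt D * y) * ?h y) / sqrt D" for y
    unfolding h_formula_scale[OF D] using s by simp
  have "integrable lborel (\<lambda>y. \<phi> (0 + sqrt D * y) * h_formula D b u (0 + sqrt D * y))"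
    unfolding e by (intro integrable_divide_zero law(1))
  then have "integrable lborel (\<lambda>y. \<phi> y * h_formula D b u y)"
    using lborel_integrable_real_affine_iff[OF s(1), of "\<lambda>y. \<phi> y * h_formula D b u y" 0] by simp
  moreover have "(\<integral>y. \<phi> y * h_formula D b u y \<partial>lborel) = (\<integral>y. \<phi> (sqrt D * y) * ?h y \<partial>lborel)"
    using lborel_integral_real_affine[OF s(1), of "\<lambda>y. \<phi> y * h_formula D b u y" 0] s(2)
    unfolding e by simp
  moreover have "(\<integral>\<omega>. indicator {\<omega>\<in>space M. H_time D b W \<omega> \<le> ereal u} \<omega> * \<phi> (W u \<omega>) \<partial>M)
    = (\<integral>\<omega>. of_bool (stopped (\<lambda>t. W (D * t) \<omega> / sqrt D) (b / sqrt D) (u / D)) * \<phi> (sqrt D * (W (D * (u / D)) \<omega> / sqrt D)) \<partial>M)"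
    using D by (intro Bochner_Integration.integral_cong) (auto simp: H_time_le_iff_stopped indicator_def)
  ultimately show ?thesis unfolding law(2) by simp
qed

end
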